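(* Let $\mathcal{H}$ be a Hopf algebra over $k$ with invertible antipode $\gamma$ and let $\mathcal{L}$ be an $\mathcal{H}$-base algebra with coaction $\delta(\lambda)=\lambda^{(1)}\otimes\lambda^{[2]}$. Then the map $$\zeta:\lambda\otimes h\mapsto\lambda^{[2]}\otimes\gamma(\lambda^{(1)})\cdot\gamma(h),$$ where $\cdot$ denotes the multiplication in $\mathcal{H}_{op}$, defines an isomorphism of $\mathcal{L}_{op}$-bialgebroids $$\zeta:(\mathcal{L}\rtimes\mathcal{H})^{op}\to\mathcal{L}_{op}\rtimes\mathcal{H}_{op}.$$
   Context: $k$ is a field of characteristic zero (or a ring of formal power series over such a field); algebras are associative unital $k$-algebras, $\otimes=\otimes_k$. A subscript $op$ on an algebra denotes the opposite algebra; $\mathcal{H}_{op}$ is the Hopf algebra with opposite multiplication and the same comultiplication (its antipode is $\gamma^{-1}$). **Base algebra.** An $\mathcal{H}$-base algebra is an algebra $\mathcal{L}$ that is a left $\mathcal{H}$-module algebra (action $\triangleright$) and a left $\mathcal{H}$-comodule algebra with coaction $\delta(\lambda)=\lambda^{(1)}\otimes\lambda^{[2]}\in\mathcal{H}\otimes\mathcal{L}$ such that $\delta(h\triangleright\lambda)=h^{(1)}\lambda^{(1)}\gamma(h^{(3)})\otimes h^{(2)}\triangleright\lambda^{[2]}$ and $\lambda\mu=(\lambda^{(1)}\triangleright\mu)\lambda^{[2]}$. (In terms of the canonical R-matrix $\Theta=\Theta_1\otimes\Theta_2\in\mathcal{H}^*_{op}\otimes\mathcal{H}$ of the double of $\mathcal{H}$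 one has $\lambda^{(1)}\otimes\lambda^{[2]}=\Theta_2\otimes\Theta_1\triangleright\lambda$, so $\zeta(\lambda\otimes h)=\Theta_1\triangleright\lambda\otimes\gamma(\Theta_2)\cdot\gamma(h)$.) **Bialgebroids.** An $\mathcal{L}$-bialgebroid is an algebra $B$ with an algebra homomorphism $s:\mathcal{L}\to B$ (source) and an algebra anti-homomorphism $t:\mathcal{L}\to B$ (target) with commuting images, so that $B$ is an $\mathcal{L}$-bimodule by $\lambda\cdot a=s(\lambda)a$, $a\cdot\lambda=t(\lambda)a$; a coassociative bimodule map $\Delta:B\to B\otimes_{\mathcal{L}}B$ which is an algebra homomorphism into $\{z\in B\otimes_{\mathcal{L}}B: z(t(\lambda)\otimes1)=z(1\otimes s(\lambda))\ \forall\lambda\}$; and a bimodule map $\varepsilon:B\to\mathcal{L}$ with $\varepsilon(1)=1$, $\varepsilon(a\,s(\varepsilon(b)))=\varepsilon(ab)=\varepsilon(a\,t(\varepsilon(b)))$ and $(\varepsilon\otimes_{\mathcal{L}}\mathrm{id})\Delta=\mathrm{id}=(\mathrm{id}\otimes_{\mathcal{L}}\varepsilon)\Delta$. A homomorphism of $\mathcal{L}$-bialgebroids is an algebra map that is an $\mathcal{L}$-bimodule map and intertwines counits and coproducts. **Coopposite.** For an $\mathcal{L}$-bialgebroid $B$, the coopposite $B^{op}$ is the $\mathcal{L}_{op}$-bialgebroid with the same algebra $B$, source map $t$ and target map $s$ (viewed as maps from $\mathcal{L}_{op}$), coproduct $\Delta^{op}(a)=a^{(2)}\otimes_{\mathcal{L}_{op}}a^{(1)}$,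 and counit $\varepsilon$ followed by the identity map $\mathcal{L}\to\mathcal{L}_{op}$. **Smash product bialgebroid.** For an $\mathcal{H}$-base algebra $\mathcal{L}$, the $\mathcal{L}$-bialgebroid $\mathcal{L}\rtimes\mathcal{H}$ has multiplication $(\lambda\otimes f)(\mu\otimes g)=\lambda(f^{(1)}\triangleright\mu)\otimes f^{(2)}g$, $s(\lambda)=\lambda\otimes1$, $t(\lambda)=\lambda^{[2]}\otimes\gamma^{-1}(\lambda^{(1)})$, $\Delta(\lambda\otimes h)=(\lambda\otimes h^{(1)})\otimes_{\mathcal{L}}(1\otimes h^{(2)})$, $\varepsilon(\lambda\otimes h)=\lambda\varepsilon(h)$. **The bialgebroid $\mathcal{L}_{op}\rtimes\mathcal{H}_{op}$.** $\mathcal{L}_{op}$ is an $\mathcal{H}_{op}$-base algebra with action $x\blacktriangleright\lambda=\gamma^{-1}(x)\triangleright\lambda$ and coaction $\delta$; $\mathcal{L}_{op}\rtimes\mathcal{H}_{op}$ is the corresponding smash product $\mathcal{L}_{op}$-bialgebroid, obtained from the preceding paragraph with $\mathcal{L},\mathcal{H},\triangleright,\gamma$ replaced by $\mathcal{L}_{op},\mathcal{H}_{op},\blacktriangleright,\gamma^{-1}$ (so its target map is $\lambda\mapsto\lambda^{[2]}\otimes\gamma(\lambda^{(1)})$). *)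

theory Defs
  imports "HOL-Algebra.Algebra" "HOL-Library.Poly_Mapping"
begin

section \<open>Ground ring and algebras\<close>

definition char_zero_field :: "('k, 'x) ring_scheme \<Rightarrow> bool" where
  "char_zero_field K \<longleftrightarrow> field K \<and> (\<forall>n::nat. n > 0 \<longrightarrow> add_pow K n \<one>\<^bsub>K\<^esub> \<noteq> \<zero>\<^bsub>K\<^esub>)"

text \<open>Formal power series over \<open>F\<close> in the variables \<open>0, \<dots>, n - 1\<close>: all functions from the monomials
  in these variables to \<open>F\<close>, with the Cauchy product.\<close>

definition power_series_ring ::
  "('k, 'x) ring_scheme \<Rightarrow> nat \<Rightarrow> ((nat \<Rightarrow>\<^sub>0 nat) \<Rightarrow> 'k) ring" where
  "power_series_ring F n =
     \<lparr> carrier = {p. \<forall>m. p m \<in> carrier F \<and> (\<not> Poly_Mapping.keys m \<subseteq> {..<n} \<longrightarrow> p m = \<zero>\<^bsub>F\<^esub>)},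
       monoid.mult = (\<lambda>p q m. \<Oplus>\<^bsub>F\<^esub>ab\<in>{ab. fst ab + snd ab = m}. p (fst ab) \<otimes>\<^bsub>F\<^esub> q (snd ab)),
       one = (\<lambda>m. if m = 0 then \<one>\<^bsub>F\<^esub> else \<zero>\<^bsub>F\<^esub>),
       ring.zero = (\<lambda>m. \<zero>\<^bsub>F\<^esub>),
       add = (\<lambda>p q m. p m \<oplus>\<^bsub>F\<^esub> q m) \<rparr>"

text \<open>Taking the coefficient field on the same type as \<open>K\<close> loses nothing, since it embeds into \<open>K\<close>
  as the constant series.\<close>

definition ground_ring :: "'k ring \<Rightarrow> bool" where
  "ground_ring K \<longleftrightarrow> cring K \<and>
     (char_zero_field K \<or>
      (\<exists>(F :: 'k ring) n. char_zero_field F \<and> K \<simeq> power_series_ring F n))"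

text \<open>The library locale \<open>algebra\<close> is restricted to commutative algebras.\<close>

locale assoc_algebra = module K A + ring A
  for K :: "'k ring" and A :: "('k, 'a, 'x) module_scheme" (structure) +
  assumes smult_mult_left:
      "\<lbrakk>c \<in> carrier K; x \<in> carrier A; y \<in> carrier A\<rbrakk> \<Longrightarrow> (c \<odot> x) \<otimes> y = c \<odot> (x \<otimes> y)"
    and smult_mult_right:
      "\<lbrakk>c \<in> carrier K; x \<in> carrier A; y \<in> carrier A\<rbrakk> \<Longrightarrow> x \<otimes> (c \<odot> y) = c \<odot> (x \<otimes> y)"

definition op_alg :: "('a, 'x) ring_scheme \<Rightarrow> ('a, 'x) ring_scheme" where
  "op_alg A = A\<lparr>monoid.mult := (\<lambda>x y. y \<otimes>\<^bsub>A\<^esub> x)\<rparr>"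

definition algebra_hom ::
  "'k ring \<Rightarrow> ('k, 'a, 'x) module_scheme \<Rightarrow> ('k, 'b, 'y) module_scheme \<Rightarrow> ('a \<Rightarrow> 'b) set" where
  "algebra_hom K A B =
     {f \<in> ring_hom A B. \<forall>c\<in>carrier K. \<forall>x\<in>carrier A. f (c \<odot>\<^bsub>A\<^esub> x) = c \<odot>\<^bsub>B\<^esub> f x}"

section \<open>Bimodules and balanced tensor products\<close>

text \<open>As for library modules, the multiplicative fields of the underlying ring record are irrelevant
  for the bimodule structure; they only serve the componentwise product on tensor products.\<close>

record ('r, 'm) bimodule = "'m ring" +
  lact :: "'r \<Rightarrow> 'm \<Rightarrow> 'm"
  ract :: "'m \<Rightarrow> 'r \<Rightarrow> 'm"

definition bimodule_hom ::
  "('r, 'x) ring_scheme \<Rightarrow> ('r, 'm, 'y) bimodule_scheme \<Rightarrow> ('r, 'n, 'z) bimodule_scheme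
   \<Rightarrow> ('m \<Rightarrow> 'n) set" where
  "bimodule_hom R M N =
     {f \<in> carrier M \<rightarrow> carrier N.
        (\<forall>x\<in>carrier M. \<forall>y\<in>carrier M. f (x \<oplus>\<^bsub>M\<^esub> y) = f x \<oplus>\<^bsub>N\<^esub> f y) \<and>
        (\<forall>r\<in>carrier R. \<forall>x\<in>carrier M.
           f (lact M r x) = lact N r (f x) \<and> f (ract M x r) = ract N (f x) r)}"

definition regular_bimodule :: "('r, 'x) ring_scheme \<Rightarrow> ('r, 'r) bimodule" where
  "regular_bimodule R =
     \<lparr> carrier = carrier R, monoid.mult = monoid.mult R, one = one R, ring.zero = ring.zero R, add = add R,
       lact = monoid.mult R, ract = monoid.mult R \<rparr>"

text \<open>A module over a commutative ring, with the two actions equal.\<close>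

definition sym_bimodule :: "('k, 'a, 'x) module_scheme \<Rightarrow> ('k, 'a) bimodule" where
  "sym_bimodule A =
     \<lparr> carrier = carrier A, monoid.mult = monoid.mult A, one = one A, ring.zero = ring.zero A, add = add A,
       lact = smult A, ract = (\<lambda>x c. c \<odot>\<^bsub>A\<^esub> x) \<rparr>"

text \<open>The tensor product \<open>M \<otimes>\<^sub>R N\<close> of a right and a left module over a possibly noncommutative ring
  \<open>R\<close>: the free abelian group on \<open>M \<times> N\<close> modulo the subgroup of biadditivity and balancing
  relations.\<close>

abbreviation pairs_group ::
  "('m, 'y) ring_scheme \<Rightarrow> ('n, 'z) ring_scheme \<Rightarrow> ('m \<times> 'n \<Rightarrow>\<^sub>0 int) monoid" where
  "pairs_group M N \<equiv> free_Abelian_group (carrier M \<times> carrier N)"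

definition tensor_relations ::
  "('r, 'x) ring_scheme \<Rightarrow> ('r, 'm, 'y) bimodule_scheme \<Rightarrow> ('r, 'n, 'z) bimodule_scheme
   \<Rightarrow> ('m \<times> 'n \<Rightarrow>\<^sub>0 int) set" where
  "tensor_relations R M N = generate (pairs_group M N)
     ({frag_of (x \<oplus>\<^bsub>M\<^esub> x', y) - frag_of (x, y) - frag_of (x', y) | x x' y.
         x \<in> carrier M \<and> x' \<in> carrier M \<and> y \<in> carrier N} \<union>
      {frag_of (x, y \<oplus>\<^bsub>N\<^esub> y') - frag_of (x, y) - frag_of (x, y') | x y y'.
         x \<in> carrier M \<and> y \<in> carrier N \<and> y' \<in> carrier N} \<union>
      {frag_of (ract M x r, y) - frag_of (x, lact N r y) | x r y.
         x \<in> carrier M \<and> r \<in> carrier R \<and> y \<in> carrier N})"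

definition pure ::
  "('r, 'x) ring_scheme \<Rightarrow> ('r, 'm, 'y) bimodule_scheme \<Rightarrow> ('r, 'n, 'z) bimodule_scheme
   \<Rightarrow> 'm \<Rightarrow> 'n \<Rightarrow> ('m \<times> 'n \<Rightarrow>\<^sub>0 int) set" where
  "pure R M N x y = tensor_relations R M N #>\<^bsub>pairs_group M N\<^esub> frag_of (x, y)"

definition tensor_group ::
  "('r, 'x) ring_scheme \<Rightarrow> ('r, 'm, 'y) bimodule_scheme \<Rightarrow> ('r, 'n, 'z) bimodule_scheme
   \<Rightarrow> ('m \<times> 'n \<Rightarrow>\<^sub>0 int) set ring" where
  "tensor_group R M N =
     (let Q = pairs_group M N Mod tensor_relations R M N
      in \<lparr> carrier = carrier Q, monoid.mult = undefined, one = undefined,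
           ring.zero = one Q, add = monoid.mult Q \<rparr>)"

text \<open>The additive map \<open>x \<otimes> y \<mapsto> f x y\<close> into the abelian group \<open>A\<close>, evaluated on an arbitrary
  representative of \<open>z\<close>; it is independent of the representative when \<open>f\<close> is biadditive and
  balanced. An expression written in Sweedler notation, such as \<open>f (h\<^sup>(\<^sup>1\<^sup>)) (h\<^sup>(\<^sup>2\<^sup>))\<close>, is
  \<open>tensor_lift A f\<close> of the coproduct of \<open>h\<close>.\<close>

definition tensor_lift ::
  "('a, 'x) ring_scheme \<Rightarrow> ('m \<Rightarrow> 'n \<Rightarrow> 'a) \<Rightarrow> ('m \<times> 'n \<Rightarrow>\<^sub>0 int) set \<Rightarrow> 'a" where
  "tensor_lift A f z =
     (let c = (SOME c. c \<in> z)
      in \<Oplus>\<^bsub>A\<^esub>p\<in>Poly_Mapping.keys c.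
           add_pow A (Poly_Mapping.lookup c p) (f (fst p) (snd p)))"

text \<open>Right multiplication \<open>z \<mapsto> z (c \<otimes> d)\<close>. The induced product \<open>z w\<close> on \<open>M \<otimes>\<^sub>R N\<close> is meaningful
  for algebras \<open>M\<close>, \<open>N\<close> over a commutative ring \<open>R\<close>, and, over the base of a bialgebroid,
  for \<open>z\<close> in the Takeuchi product.\<close>

definition tensor_rmult ::
  "('r, 'x) ring_scheme \<Rightarrow> ('r, 'm, 'y) bimodule_scheme \<Rightarrow> ('r, 'n, 'z) bimodule_scheme
   \<Rightarrow> ('m \<times> 'n \<Rightarrow>\<^sub>0 int) set \<Rightarrow> 'm \<Rightarrow> 'n \<Rightarrow> ('m \<times> 'n \<Rightarrow>\<^sub>0 int) set" where
  "tensor_rmult R M N z c d =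
     tensor_lift (tensor_group R M N) (\<lambda>a b. pure R M N (a \<otimes>\<^bsub>M\<^esub> c) (b \<otimes>\<^bsub>N\<^esub> d)) z"

definition tensor ::
  "('r, 'x) ring_scheme \<Rightarrow> ('r, 'm, 'y) bimodule_scheme \<Rightarrow> ('r, 'n, 'z) bimodule_scheme
   \<Rightarrow> ('r, ('m \<times> 'n \<Rightarrow>\<^sub>0 int) set) bimodule" where
  "tensor R M N = (let T = tensor_group R M N in
     \<lparr> carrier = carrier T,
       monoid.mult = (\<lambda>z w. tensor_lift T (tensor_rmult R M N z) w),
       one = pure R M N \<one>\<^bsub>M\<^esub> \<one>\<^bsub>N\<^esub>,
       ring.zero = ring.zero T,
       add = add T,
       lact = (\<lambda>r. tensor_lift T (\<lambda>x y. pure R M N (lact M r x) y)),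
       ract = (\<lambda>z r. tensor_lift T (\<lambda>x y. pure R M N x (ract N y r)) z) \<rparr>)"

definition tensor_map ::
  "('r, 'x) ring_scheme \<Rightarrow> ('r, 'm, 'y) bimodule_scheme \<Rightarrow> ('r, 'n, 'z) bimodule_scheme
   \<Rightarrow> ('p \<Rightarrow> 'm) \<Rightarrow> ('q \<Rightarrow> 'n) \<Rightarrow> ('p \<times> 'q \<Rightarrow>\<^sub>0 int) set \<Rightarrow> ('m \<times> 'n \<Rightarrow>\<^sub>0 int) set" where
  "tensor_map R M N f g = tensor_lift (tensor R M N) (\<lambda>x y. pure R M N (f x) (g y))"

text \<open>The canonical map \<open>(M \<otimes> N) \<otimes> P \<rightarrow> M \<otimes> (N \<otimes> P)\<close>.\<close>

definition tensor_assoc ::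
  "('r, 'x) ring_scheme \<Rightarrow> ('r, 'm, 'y) bimodule_scheme \<Rightarrow> ('r, 'n, 'z) bimodule_scheme
   \<Rightarrow> ('r, 'p, 'w) bimodule_scheme
   \<Rightarrow> (('m \<times> 'n \<Rightarrow>\<^sub>0 int) set \<times> 'p \<Rightarrow>\<^sub>0 int) set
   \<Rightarrow> ('m \<times> ('n \<times> 'p \<Rightarrow>\<^sub>0 int) set \<Rightarrow>\<^sub>0 int) set" where
  "tensor_assoc R M N P =
     (let T = tensor R M (tensor R N P)
      in tensor_lift T (\<lambda>u z.
           tensor_lift T (\<lambda>x y. pure R M (tensor R N P) x (pure R N P y z)) u))"

abbreviation ktensor ::
  "'k ring \<Rightarrow> ('k, 'a, 'x) module_scheme \<Rightarrow> ('k, 'b, 'y) module_scheme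
   \<Rightarrow> ('k, ('a \<times> 'b \<Rightarrow>\<^sub>0 int) set) bimodule" where
  "ktensor K A B \<equiv> tensor K (sym_bimodule A) (sym_bimodule B)"

abbreviation kpure ::
  "'k ring \<Rightarrow> ('k, 'a, 'x) module_scheme \<Rightarrow> ('k, 'b, 'y) module_scheme
   \<Rightarrow> 'a \<Rightarrow> 'b \<Rightarrow> ('a \<times> 'b \<Rightarrow>\<^sub>0 int) set" where
  "kpure K A B \<equiv> pure K (sym_bimodule A) (sym_bimodule B)"

section \<open>Hopf algebras\<close>

record ('k, 'h) hopf = "('k, 'h) module" +
  comul :: "'h \<Rightarrow> ('h \<times> 'h \<Rightarrow>\<^sub>0 int) set"
  counit :: "'h \<Rightarrow> 'k"
  antipode :: "'h \<Rightarrow> 'h"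

locale hopf_algebra = assoc_algebra K H
  for K :: "'k ring" and H :: "('k, 'h, 'x) hopf_scheme" (structure) +
  assumes comul_linear: "comul H \<in> bimodule_hom K (sym_bimodule H) (ktensor K H H)"
    and comul_ring_hom: "comul H \<in> ring_hom H (ktensor K H H)"
    and counit_linear: "counit H \<in> bimodule_hom K (sym_bimodule H) (regular_bimodule K)"
    and counit_ring_hom: "counit H \<in> ring_hom H K"
    and coassoc: "h \<in> carrier H \<Longrightarrow>
          tensor_assoc K (sym_bimodule H) (sym_bimodule H) (sym_bimodule H)
            (tensor_map K (ktensor K H H) (sym_bimodule H) (comul H) id (comul H h)) =
          tensor_map K (sym_bimodule H) (ktensor K H H) id (comul H) (comul H h)"
    and counit_left: "h \<in> carrier H \<Longrightarrow>
          tensor_lift H (\<lambda>x y. counit H x \<odot> y) (comul H h) = h"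
    and counit_right: "h \<in> carrier H \<Longrightarrow>
          tensor_lift H (\<lambda>x y. counit H y \<odot> x) (comul H h) = h"
    and antipode_linear: "antipode H \<in> bimodule_hom K (sym_bimodule H) (sym_bimodule H)"
    and antipode_left: "h \<in> carrier H \<Longrightarrow>
          tensor_lift H (\<lambda>x y. antipode H x \<otimes> y) (comul H h) = counit H h \<odot> \<one>"
    and antipode_right: "h \<in> carrier H \<Longrightarrow>
          tensor_lift H (\<lambda>x y. x \<otimes> antipode H y) (comul H h) = counit H h \<odot> \<one>"

abbreviation antipode_inv :: "('k, 'h, 'x) hopf_scheme \<Rightarrow> 'h \<Rightarrow> 'h" where
  "antipode_inv H \<equiv> inv_into (carrier H) (antipode H)"

definition op_hopf :: "('k, 'h, 'x) hopf_scheme \<Rightarrow> ('k, 'h, 'x) hopf_scheme" where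
  "op_hopf H = (op_alg H)\<lparr>antipode := antipode_inv H\<rparr>"

section \<open>Base algebras\<close>

record ('k, 'h, 'l) base_alg = "('k, 'l) module" +
  act :: "'h \<Rightarrow> 'l \<Rightarrow> 'l"
  coact :: "'l \<Rightarrow> ('h \<times> 'l \<Rightarrow>\<^sub>0 int) set"

locale base_algebra = H: hopf_algebra K H + L: assoc_algebra K L
  for K :: "'k ring" and H :: "('k, 'h, 'x) hopf_scheme"
    and L :: "('k, 'h, 'l, 'y) base_alg_scheme" +
  assumes act_closed: "\<lbrakk>h \<in> carrier H; l \<in> carrier L\<rbrakk> \<Longrightarrow> act L h l \<in> carrier L"
    and act_add_left: "\<lbrakk>g \<in> carrier H; h \<in> carrier H; l \<in> carrier L\<rbrakk> \<Longrightarrow>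
          act L (g \<oplus>\<^bsub>H\<^esub> h) l = act L g l \<oplus>\<^bsub>L\<^esub> act L h l"
    and act_add_right: "\<lbrakk>h \<in> carrier H; l \<in> carrier L; m \<in> carrier L\<rbrakk> \<Longrightarrow>
          act L h (l \<oplus>\<^bsub>L\<^esub> m) = act L h l \<oplus>\<^bsub>L\<^esub> act L h m"
    and act_smult_left: "\<lbrakk>c \<in> carrier K; h \<in> carrier H; l \<in> carrier L\<rbrakk> \<Longrightarrow>
          act L (c \<odot>\<^bsub>H\<^esub> h) l = c \<odot>\<^bsub>L\<^esub> act L h l"
    and act_smult_right: "\<lbrakk>c \<in> carrier K; h \<in> carrier H; l \<in> carrier L\<rbrakk> \<Longrightarrow>
          act L h (c \<odot>\<^bsub>L\<^esub> l) = c \<odot>\<^bsub>L\<^esub> act L h l"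
    and act_mult: "\<lbrakk>g \<in> carrier H; h \<in> carrier H; l \<in> carrier L\<rbrakk> \<Longrightarrow>
          act L (g \<otimes>\<^bsub>H\<^esub> h) l = act L g (act L h l)"
    and act_one: "l \<in> carrier L \<Longrightarrow> act L \<one>\<^bsub>H\<^esub> l = l"
    and act_on_mult: "\<lbrakk>h \<in> carrier H; l \<in> carrier L; m \<in> carrier L\<rbrakk> \<Longrightarrow>
          act L h (l \<otimes>\<^bsub>L\<^esub> m) =
          tensor_lift L (\<lambda>x y. act L x l \<otimes>\<^bsub>L\<^esub> act L y m) (comul H h)"
    and act_on_one: "h \<in> carrier H \<Longrightarrow> act L h \<one>\<^bsub>L\<^esub> = counit H h \<odot>\<^bsub>L\<^esub> \<one>\<^bsub>L\<^esub>"
    and coact_linear: "coact L \<in> bimodule_hom K (sym_bimodule L) (ktensor K H L)"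
    and coact_ring_hom: "coact L \<in> ring_hom L (ktensor K H L)"
    and coact_coassoc: "l \<in> carrier L \<Longrightarrow>
          tensor_assoc K (sym_bimodule H) (sym_bimodule H) (sym_bimodule L)
            (tensor_map K (ktensor K H H) (sym_bimodule L) (comul H) id (coact L l)) =
          tensor_map K (sym_bimodule H) (ktensor K H L) id (coact L) (coact L l)"
    and coact_counit: "l \<in> carrier L \<Longrightarrow>
          tensor_lift L (\<lambda>x m. counit H x \<odot>\<^bsub>L\<^esub> m) (coact L l) = l"
    and coact_act: "\<lbrakk>h \<in> carrier H; l \<in> carrier L\<rbrakk> \<Longrightarrow>
          coact L (act L h l) =
          tensor_lift (ktensor K H L) (\<lambda>h1 w.
            tensor_lift (ktensor K H L) (\<lambda>h2 h3.
              tensor_lift (ktensor K H L) (\<lambda>p m.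
                kpure K H L (h1 \<otimes>\<^bsub>H\<^esub> p \<otimes>\<^bsub>H\<^esub> antipode H h3) (act L h2 m))
              (coact L l))
            (comul H w))
          (comul H h)"
    and braided_commutative: "\<lbrakk>l \<in> carrier L; m \<in> carrier L\<rbrakk> \<Longrightarrow>
          l \<otimes>\<^bsub>L\<^esub> m = tensor_lift L (\<lambda>p n. act L p m \<otimes>\<^bsub>L\<^esub> n) (coact L l)"

text \<open>The opposite of a base algebra, as a base algebra over \<open>op_hopf H\<close>.\<close>

definition op_base ::
  "('k, 'h, 'x) hopf_scheme \<Rightarrow> ('k, 'h, 'l, 'y) base_alg_scheme
   \<Rightarrow> ('k, 'h, 'l, 'y) base_alg_scheme" where
  "op_base H L = (op_alg L)\<lparr>act := (\<lambda>x l. act L (antipode_inv H x) l)\<rparr>"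

section \<open>Bialgebroids\<close>

record ('k, 'l, 'b) st_algebra = "('k, 'b) module" +
  src :: "'l \<Rightarrow> 'b"
  tgt :: "'l \<Rightarrow> 'b"

record ('k, 'l, 'b) bialgebroid = "('k, 'l, 'b) st_algebra" +
  cop :: "'b \<Rightarrow> ('b \<times> 'b \<Rightarrow>\<^sub>0 int) set"
  cou :: "'b \<Rightarrow> 'l"

text \<open>Both actions are by multiplication on the left.\<close>

definition st_bimodule :: "('k, 'l, 'b, 'x) st_algebra_scheme \<Rightarrow> ('l, 'b) bimodule" where
  "st_bimodule B =
     \<lparr> carrier = carrier B, monoid.mult = monoid.mult B, one = one B, ring.zero = ring.zero B, add = add B,
       lact = (\<lambda>l a. src B l \<otimes>\<^bsub>B\<^esub> a),
       ract = (\<lambda>a l. tgt B l \<otimes>\<^bsub>B\<^esub> a) \<rparr>"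

abbreviation st_tensor ::
  "('l, 'y) ring_scheme \<Rightarrow> ('k, 'l, 'b, 'x) st_algebra_scheme
   \<Rightarrow> ('l, ('b \<times> 'b \<Rightarrow>\<^sub>0 int) set) bimodule" where
  "st_tensor L B \<equiv> tensor L (st_bimodule B) (st_bimodule B)"

abbreviation st_pure ::
  "('l, 'y) ring_scheme \<Rightarrow> ('k, 'l, 'b, 'x) st_algebra_scheme
   \<Rightarrow> 'b \<Rightarrow> 'b \<Rightarrow> ('b \<times> 'b \<Rightarrow>\<^sub>0 int) set" where
  "st_pure L B \<equiv> pure L (st_bimodule B) (st_bimodule B)"

definition takeuchi ::
  "('l, 'y) ring_scheme \<Rightarrow> ('k, 'l, 'b, 'x) st_algebra_scheme \<Rightarrow> ('b \<times> 'b \<Rightarrow>\<^sub>0 int) set set" where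
  "takeuchi L B =
     {z \<in> carrier (st_tensor L B). \<forall>l\<in>carrier L.
        tensor_rmult L (st_bimodule B) (st_bimodule B) z (tgt B l) \<one>\<^bsub>B\<^esub> =
        tensor_rmult L (st_bimodule B) (st_bimodule B) z \<one>\<^bsub>B\<^esub> (src B l)}"

locale bialgebroid = L: assoc_algebra K L + B: assoc_algebra K B
  for K :: "'k ring" and L :: "('k, 'l, 'x) module_scheme"
    and B :: "('k, 'l, 'b, 'y) bialgebroid_scheme" +
  assumes src_hom: "src B \<in> algebra_hom K L B"
    and tgt_antihom: "tgt B \<in> algebra_hom K (op_alg L) B"
    and src_tgt_commute: "\<lbrakk>l \<in> carrier L; m \<in> carrier L\<rbrakk> \<Longrightarrow>
          src B l \<otimes>\<^bsub>B\<^esub> tgt B m = tgt B m \<otimes>\<^bsub>B\<^esub> src B l"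
    and cop_bimodule_hom: "cop B \<in> bimodule_hom L (st_bimodule B) (st_tensor L B)"
    and cop_coassoc: "a \<in> carrier B \<Longrightarrow>
          tensor_assoc L (st_bimodule B) (st_bimodule B) (st_bimodule B)
            (tensor_map L (st_tensor L B) (st_bimodule B) (cop B) id (cop B a)) =
          tensor_map L (st_bimodule B) (st_tensor L B) id (cop B) (cop B a)"
    and cop_takeuchi: "a \<in> carrier B \<Longrightarrow> cop B a \<in> takeuchi L B"
    and cop_ring_hom: "cop B \<in> ring_hom B (st_tensor L B)"
    and cou_bimodule_hom: "cou B \<in> bimodule_hom L (st_bimodule B) (regular_bimodule L)"
    and cou_one: "cou B \<one>\<^bsub>B\<^esub> = \<one>\<^bsub>L\<^esub>"
    and cou_mult_src: "\<lbrakk>a \<in> carrier B; b \<in> carrier B\<rbrakk> \<Longrightarrow>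
          cou B (a \<otimes>\<^bsub>B\<^esub> src B (cou B b)) = cou B (a \<otimes>\<^bsub>B\<^esub> b)"
    and cou_mult_tgt: "\<lbrakk>a \<in> carrier B; b \<in> carrier B\<rbrakk> \<Longrightarrow>
          cou B (a \<otimes>\<^bsub>B\<^esub> tgt B (cou B b)) = cou B (a \<otimes>\<^bsub>B\<^esub> b)"
    and cou_left: "a \<in> carrier B \<Longrightarrow>
          tensor_lift B (\<lambda>x y. lact (st_bimodule B) (cou B x) y) (cop B a) = a"
    and cou_right: "a \<in> carrier B \<Longrightarrow>
          tensor_lift B (\<lambda>x y. ract (st_bimodule B) x (cou B y)) (cop B a) = a"

definition bialgebroid_hom ::
  "'k ring \<Rightarrow> ('k, 'l, 'x) module_scheme
   \<Rightarrow> ('k, 'l, 'a, 'y) bialgebroid_scheme \<Rightarrow> ('k, 'l, 'b, 'z) bialgebroid_scheme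
   \<Rightarrow> ('a \<Rightarrow> 'b) set" where
  "bialgebroid_hom K L A B =
     {f \<in> algebra_hom K A B \<inter> bimodule_hom L (st_bimodule A) (st_bimodule B).
        \<forall>a\<in>carrier A. cou B (f a) = cou A a \<and>
          cop B (f a) = tensor_map L (st_bimodule B) (st_bimodule B) f f (cop A a)}"

definition bialgebroid_iso ::
  "'k ring \<Rightarrow> ('k, 'l, 'x) module_scheme
   \<Rightarrow> ('k, 'l, 'a, 'y) bialgebroid_scheme \<Rightarrow> ('k, 'l, 'b, 'z) bialgebroid_scheme
   \<Rightarrow> ('a \<Rightarrow> 'b) set" where
  "bialgebroid_iso K L A B =
     {f \<in> bialgebroid_hom K L A B. bij_betw f (carrier A) (carrier B)}"

text \<open>The coopposite, to be read over \<open>op_alg L\<close>.\<close>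

definition st_swap :: "('k, 'l, 'b, 'x) st_algebra_scheme \<Rightarrow> ('k, 'l, 'b, 'x) st_algebra_scheme" where
  "st_swap B = B\<lparr>src := tgt B, tgt := src B\<rparr>"

definition coop ::
  "('l, 'y) ring_scheme \<Rightarrow> ('k, 'l, 'b, 'x) bialgebroid_scheme
   \<Rightarrow> ('k, 'l, 'b, 'x) bialgebroid_scheme" where
  "coop L B = (st_swap B)\<lparr>cop := (\<lambda>a.
     tensor_lift (st_tensor (op_alg L) (st_swap B))
       (\<lambda>x y. st_pure (op_alg L) (st_swap B) y x) (cop B a))\<rparr>"

section \<open>The smash product bialgebroid\<close>

definition smash_algebra ::
  "'k ring \<Rightarrow> ('k, 'h, 'x) hopf_scheme \<Rightarrow> ('k, 'h, 'l, 'y) base_alg_scheme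
   \<Rightarrow> ('k, 'l, ('l \<times> 'h \<Rightarrow>\<^sub>0 int) set) st_algebra" where
  "smash_algebra K H L = (let T = ktensor K L H in
     \<lparr> carrier = carrier T,
       monoid.mult = (\<lambda>z w.
         tensor_lift T (\<lambda>l f.
           tensor_lift T (\<lambda>m g.
             tensor_lift T (\<lambda>f1 f2.
               kpure K L H (l \<otimes>\<^bsub>L\<^esub> act L f1 m) (f2 \<otimes>\<^bsub>H\<^esub> g))
             (comul H f)) w) z),
       one = kpure K L H \<one>\<^bsub>L\<^esub> \<one>\<^bsub>H\<^esub>,
       ring.zero = ring.zero T,
       add = add T,
       smult = lact T,
       src = (\<lambda>l. kpure K L H l \<one>\<^bsub>H\<^esub>),
       tgt = (\<lambda>l. tensor_lift T (\<lambda>p m. kpure K L H m (antipode_inv H p)) (coact L l)) \<rparr>)"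

definition smash ::
  "'k ring \<Rightarrow> ('k, 'h, 'x) hopf_scheme \<Rightarrow> ('k, 'h, 'l, 'y) base_alg_scheme
   \<Rightarrow> ('k, 'l, ('l \<times> 'h \<Rightarrow>\<^sub>0 int) set) bialgebroid" where
  "smash K H L = (let S = smash_algebra K H L in
     st_algebra.extend S
       \<lparr> cop = tensor_lift (st_tensor L S) (\<lambda>l h.
           tensor_lift (st_tensor L S) (\<lambda>h1 h2.
             st_pure L S (kpure K L H l h1) (kpure K L H \<one>\<^bsub>L\<^esub> h2))
           (comul H h)),
         cou = tensor_lift L (\<lambda>l h. counit H h \<odot>\<^bsub>L\<^esub> l) \<rparr>)"

definition zeta ::
  "'k ring \<Rightarrow> ('k, 'h, 'x) hopf_scheme \<Rightarrow> ('k, 'h, 'l, 'y) base_alg_scheme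
   \<Rightarrow> ('l \<times> 'h \<Rightarrow>\<^sub>0 int) set \<Rightarrow> ('l \<times> 'h \<Rightarrow>\<^sub>0 int) set" where
  "zeta K H L =
     (let T = ktensor K (op_base H L) (op_hopf H)
      in tensor_lift T (\<lambda>l h.
           tensor_lift T (\<lambda>p m.
             kpure K (op_base H L) (op_hopf H) m (antipode H p \<otimes>\<^bsub>op_hopf H\<^esub> antipode H h))
           (coact L l)))"

end

theory Submission
  imports Defs
begin

text \<open>An expression in Sweedler notation is the lift of a multilinear map, and the Hopf and base algebra
  axioms become identities between iterated lifts.

  Braided commutativity, read through the inverse antipode, says
  \<open>\<lambda>\<^sup>[\<^sup>2\<^sup>] (\<gamma>\<^sup>-\<^sup>1(\<lambda>\<^sup>(\<^sup>1\<^sup>)) \<rhd> \<mu>) = \<mu> \<lambda>\<close>, and hence \<open>t(\<lambda>) (\<mu> \<otimes> h) = \<mu> \<lambda>\<^sup>[\<^sup>2\<^sup>] \<otimes> \<gamma>\<^sup>-\<^sup>1(\<lambda>\<^sup>(\<^sup>1\<^sup>)) h\<close>. This controls the target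
  map of \<open>L \<rtimes> H\<close> and also makes \<open>L\<close> with the opposite product a base algebra over \<open>H\<close> with the opposite
  product, so that both bialgebroids come from one theorem on smash products.

  In terms of the product of \<open>H\<close> one has \<open>\<zeta>(\<lambda> \<otimes> h) = \<lambda>\<^sup>[\<^sup>2\<^sup>] \<otimes> \<gamma>(\<lambda>\<^sup>(\<^sup>1\<^sup>) h)\<close>. The compatibility of the
  coaction with the action and braided commutativity make \<open>\<zeta>\<close> multiplicative; it exchanges source and target
  maps, and its inverse is \<open>\<lambda> \<otimes> h \<mapsto> \<lambda>\<^sup>[\<^sup>2\<^sup>] \<otimes> \<gamma>\<^sup>-\<^sup>1(\<lambda>\<^sup>(\<^sup>1\<^sup>)) \<gamma>\<^sup>-\<^sup>1(h)\<close>. The coproducts agree because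
  \<open>\<zeta>(\<lambda> \<otimes> h) = t'(\<lambda>) \<zeta>(1 \<otimes> h)\<close> and \<open>t'(\<lambda>)\<close> can be moved across the tensor sign as \<open>s'(\<lambda>)\<close>.\<close>

section \<open>Additive maps and balanced tensor products\<close>

text \<open>The obstacle that shapes the proof is that \<open>tensor_lift\<close> evaluates a map on
  a chosen representative. Two lifts over the same tensor are finite sums over the same pairs and
  can be compared for arbitrary maps; once the tensor itself changes, by coassociativity, a product
  or a relation, the map has to be balanced. Multilinearity is therefore proved by syntax-directed
  rules, and Sweedler sums take values in \<open>K\<close>-modules. Tensor products over the
  noncommutative \<open>L\<close> fit in because scalars act on them through multiples of the unit
  of \<open>L\<close>.

  A second obstacle is the componentwise product over \<open>L\<close>: it is additive in its right
  factor once the left factor lies in the Takeuchi product. The Takeuchi condition for the coproduct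
  thus precedes multiplicativity. It rests on the commutation rule
  \<open>(m \<sharp> h) t(l) = t(h2 \<rhd> l) (m \<sharp> h1)\<close>, which is the compatibility of
  coaction and action read through the inverse antipode.

  That the antipode reverses products and coproducts is not an axiom here; both facts come from
  uniqueness of convolution inverses.\<close>

definition additive_map :: "('a, 'x) ring_scheme \<Rightarrow> ('b, 'y) ring_scheme \<Rightarrow> ('a \<Rightarrow> 'b) \<Rightarrow> bool" where
  "additive_map A B f \<longleftrightarrow> f \<in> carrier A \<rightarrow> carrier B \<and>
     (\<forall>x\<in>carrier A. \<forall>y\<in>carrier A. f (x \<oplus>\<^bsub>A\<^esub> y) = f x \<oplus>\<^bsub>B\<^esub> f y)"

lemma additive_mapI:
  assumes "\<And>x. x \<in> carrier A \<Longrightarrow> f x \<in> carrier B"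
    and "\<And>x y. x \<in> carrier A \<Longrightarrow> y \<in> carrier A \<Longrightarrow> f (x \<oplus>\<^bsub>A\<^esub> y) = f x \<oplus>\<^bsub>B\<^esub> f y"
  shows "additive_map A B f"
  using assms by (auto simp: additive_map_def)

lemma additive_map_closed: "additive_map A B f \<Longrightarrow> x \<in> carrier A \<Longrightarrow> f x \<in> carrier B"
  by (auto simp: additive_map_def)

lemma additive_map_add: "additive_map A B f \<Longrightarrow> x \<in> carrier A \<Longrightarrow> y \<in> carrier A \<Longrightarrow> f (x \<oplus>\<^bsub>A\<^esub> y) = f x \<oplus>\<^bsub>B\<^esub> f y"
  by (auto simp: additive_map_def)

lemma additive_map_group_hom:
  assumes "abelian_group A" "abelian_group B" "additive_map A B f"
  shows "group_hom (add_monoid A) (add_monoid B) f"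
  using assms
  by (auto simp: group_hom_def group_hom_axioms_def hom_def additive_map_def abelian_group.a_group)

lemma additive_map_zero:
  assumes "abelian_group A" "abelian_group B" "additive_map A B f"
  shows "f \<zero>\<^bsub>A\<^esub> = \<zero>\<^bsub>B\<^esub>"
  using group_hom.hom_one[OF additive_map_group_hom[OF assms]] by simp

lemma additive_map_minus:
  assumes "abelian_group A" "abelian_group B" "additive_map A B f" "x \<in> carrier A"
  shows "f (\<ominus>\<^bsub>A\<^esub> x) = \<ominus>\<^bsub>B\<^esub> f x"
  using group_hom.hom_inv[OF additive_map_group_hom[OF assms(1-3)]] assms(4) by (simp add: a_inv_def)

lemma additive_map_add_pow:
  fixes k :: int
  assumes "abelian_group A" "abelian_group B" "additive_map A B f" "x \<in> carrier A"
  shows "f (add_pow A k x) = add_pow B k (f x)"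
  using group_hom.hom_int_pow[OF additive_map_group_hom[OF assms(1-3)]] assms(4) by (simp add: add_pow_def)

lemma additive_map_finsum:
  assumes "abelian_group A" "abelian_group B" "additive_map A B f" "g \<in> S \<rightarrow> carrier A"
  shows "f (finsum A g S) = finsum B (\<lambda>p. f (g p)) S"
proof -
  interpret A: abelian_group A by fact
  interpret B: abelian_group B by fact
  show ?thesis
    using assms(4)
  proof (induction S rule: infinite_finite_induct)
    case (infinite S)
    then show ?case by (simp add: additive_map_zero[OF assms(1-3)])
  next
    case empty
    then show ?case by (simp add: additive_map_zero[OF assms(1-3)])
  next
    case (insert x F)
    then show ?case
      by (simp add: additive_map_add[OF assms(3)] additive_map_closed[OF assms(3)] Pi_iff)
  qed
qed

text \<open>Finite sums and integer multiples see only the additive fields of a record. The same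
  abelian group occurs as \<open>tensor_group\<close>, \<open>tensor\<close>,
  \<open>ktensor_module\<close> and \<open>smash_algebra\<close>, and this lemma lets a lift change
  between them.\<close>

lemma tensor_lift_cong_target:
  assumes "carrier A = carrier B" "add A = add B" "ring.zero A = ring.zero B"
  shows "tensor_lift A = tensor_lift B"
proof -
  have *: "finprod (add_monoid A) = finprod (add_monoid B)"
    by (intro ext) (simp add: finprod_def assms)
  have **: "add_pow A = (add_pow B :: int \<Rightarrow> _)"
  proof (intro ext)
    fix k :: int and a
    have "a [^]\<^bsub>add_monoid A\<^esub> n = a [^]\<^bsub>add_monoid B\<^esub> n" for n :: nat
      by (simp add: nat_pow_def assms)
    note nat = this[unfolded nat_pow_def]
    moreover have "m_inv (add_monoid A) = m_inv (add_monoid B)"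
      by (intro ext) (simp add: m_inv_def assms)
    ultimately show "add_pow A k a = add_pow B k a"
      using nat by (simp add: add_pow_def int_pow_def Let_def nat_pow_def)
  qed
  show ?thesis
    by (intro ext) (simp add: tensor_lift_def finsum_def * ** del: )
qed

text \<open>The weak notion is deliberate: two commuting additive actions suffice to form balanced
  tensor products, and the notion passes to \<open>tensor\<close> and, later, to
  \<open>flip\<close>. Unit and associativity of the left action are added in
  \<open>central_bimod\<close>.\<close>

locale bimod = M: abelian_group M
  for R :: "('r, 'x) ring_scheme" and M :: "('r, 'm, 'y) bimodule_scheme" +
  assumes lact_closed: "\<lbrakk>r \<in> carrier R; x \<in> carrier M\<rbrakk> \<Longrightarrow> lact M r x \<in> carrier M"
    and ract_closed: "\<lbrakk>r \<in> carrier R; x \<in> carrier M\<rbrakk> \<Longrightarrow> ract M x r \<in> carrier M"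
    and lact_add: "\<lbrakk>r \<in> carrier R; x \<in> carrier M; y \<in> carrier M\<rbrakk>
      \<Longrightarrow> lact M r (x \<oplus>\<^bsub>M\<^esub> y) = lact M r x \<oplus>\<^bsub>M\<^esub> lact M r y"
    and ract_add: "\<lbrakk>r \<in> carrier R; x \<in> carrier M; y \<in> carrier M\<rbrakk>
      \<Longrightarrow> ract M (x \<oplus>\<^bsub>M\<^esub> y) r = ract M x r \<oplus>\<^bsub>M\<^esub> ract M y r"
    and lact_ract: "\<lbrakk>r \<in> carrier R; s \<in> carrier R; x \<in> carrier M\<rbrakk>
      \<Longrightarrow> lact M r (ract M x s) = ract M (lact M r x) s"

definition balanced ::
  "('r, 'x) ring_scheme \<Rightarrow> ('r, 'm, 'y) bimodule_scheme \<Rightarrow> ('r, 'n, 'z) bimodule_scheme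
   \<Rightarrow> ('a, 'w) ring_scheme \<Rightarrow> ('m \<Rightarrow> 'n \<Rightarrow> 'a) \<Rightarrow> bool" where
  "balanced R M N A f \<longleftrightarrow>
     (\<forall>y\<in>carrier N. additive_map M A (\<lambda>x. f x y)) \<and> (\<forall>x\<in>carrier M. additive_map N A (f x)) \<and>
     (\<forall>x\<in>carrier M. \<forall>r\<in>carrier R. \<forall>y\<in>carrier N. f (ract M x r) y = f x (lact N r y))"

lemma balancedI:
  assumes "\<And>y. y \<in> carrier N \<Longrightarrow> additive_map M A (\<lambda>x. f x y)"
    and "\<And>x. x \<in> carrier M \<Longrightarrow> additive_map N A (\<lambda>y. f x y)"
    and "\<And>x r y. x \<in> carrier M \<Longrightarrow> r \<in> carrier R \<Longrightarrow> y \<in> carrier N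
      \<Longrightarrow> f (ract M x r) y = f x (lact N r y)"
  shows "balanced R M N A f"
  using assms by (auto simp: balanced_def)

lemma balancedD:
  assumes "balanced R M N A f"
  shows "\<And>x y. x \<in> carrier M \<Longrightarrow> y \<in> carrier N \<Longrightarrow> f x y \<in> carrier A"
    and "\<And>y. y \<in> carrier N \<Longrightarrow> additive_map M A (\<lambda>x. f x y)"
    and "\<And>x. x \<in> carrier M \<Longrightarrow> additive_map N A (\<lambda>y. f x y)"
    and "\<And>x r y. x \<in> carrier M \<Longrightarrow> r \<in> carrier R \<Longrightarrow> y \<in> carrier N
      \<Longrightarrow> f (ract M x r) y = f x (lact N r y)"
  using assms by (auto simp: balanced_def additive_map_def)

locale tensor_pair = M: bimod R M + N: bimod R N
  for R :: "('r, 'x) ring_scheme" and M :: "('r, 'm, 'y) bimodule_scheme"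
    and N :: "('r, 'n, 'z) bimodule_scheme"
begin

abbreviation "G \<equiv> pairs_group M N"
abbreviation "W \<equiv> tensor_relations R M N"
abbreviation "T \<equiv> tensor R M N"

sublocale G: comm_group G
  by (rule abelian_free_Abelian_group)

definition relators :: "('m \<times> 'n \<Rightarrow>\<^sub>0 int) set" where
  "relators =
     {frag_of (x \<oplus>\<^bsub>M\<^esub> x', y) - frag_of (x, y) - frag_of (x', y) | x x' y.
         x \<in> carrier M \<and> x' \<in> carrier M \<and> y \<in> carrier N} \<union>
      {frag_of (x, y \<oplus>\<^bsub>N\<^esub> y') - frag_of (x, y) - frag_of (x, y') | x y y'.
         x \<in> carrier M \<and> y \<in> carrier N \<and> y' \<in> carrier N} \<union>
      {frag_of (ract M x r, y) - frag_of (x, lact N r y) | x r y.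
         x \<in> carrier M \<and> r \<in> carrier R \<and> y \<in> carrier N}"

lemma W_eq: "W = generate G relators"
  by (simp add: tensor_relations_def relators_def)

lemma frag_in [simp]: "x \<in> carrier M \<Longrightarrow> y \<in> carrier N \<Longrightarrow> frag_of (x, y) \<in> carrier G"
  by (simp add: keys_frag_of)

lemma diff_in: "a \<in> carrier G \<Longrightarrow> b \<in> carrier G \<Longrightarrow> a - b \<in> carrier G"
  using keys_diff[of a b] by auto

lemma relators_subset: "relators \<subseteq> carrier G"
  unfolding relators_def
  by (auto simp del: carrier_free_Abelian_group_iff intro!: diff_in
      simp: M.ract_closed N.lact_closed)

lemma W_subgroup: "subgroup W G"
  unfolding W_eq by (rule G.generate_is_subgroup[OF relators_subset])

lemma W_normal: "W \<lhd> G"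
  by (rule G.subgroup_imp_normal[OF W_subgroup])

lemma Q_comm_group: "comm_group (G Mod W)"
  by (rule G.abelian_FactGroup[OF W_subgroup])

lemma T_sel: "carrier T = carrier (G Mod W)" "add T = monoid.mult (G Mod W)" "ring.zero T = one (G Mod W)"
  by (simp_all add: tensor_def Let_def tensor_group_def)

lemma T_group_sel: "carrier (tensor_group R M N) = carrier T" "add (tensor_group R M N) = add T"
  "ring.zero (tensor_group R M N) = ring.zero T"
  by (simp_all add: tensor_def Let_def tensor_group_def)

sublocale T: abelian_group T
proof -
  interpret Q: comm_group "G Mod W" by (rule Q_comm_group)
  show "abelian_group T"
  proof (rule abelian_groupI, unfold T_sel)
    fix x assume "x \<in> carrier (G Mod W)"
    then show "\<exists>y\<in>carrier (G Mod W). y \<otimes>\<^bsub>G Mod W\<^esub> x = \<one>\<^bsub>G Mod W\<^esub>"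
      using Q.l_inv Q.inv_closed by blast
  qed (fact Q.m_closed Q.one_closed Q.m_assoc Q.m_comm Q.l_one)+
qed

lemma T_abelian: "abelian_group T"
  by (rule T.abelian_group_axioms)

definition proj :: "('m \<times> 'n \<Rightarrow>\<^sub>0 int) \<Rightarrow> ('m \<times> 'n \<Rightarrow>\<^sub>0 int) set" where
  "proj c = W #>\<^bsub>G\<^esub> c"

lemma proj_hom: "proj \<in> hom G (add_monoid T)"
  using normal.r_coset_hom_Mod[OF W_normal]
  by (simp add: hom_def proj_def[abs_def] T_sel)

lemma proj_group_hom: "group_hom G (add_monoid T) proj"
  by (simp add: group_hom_def group_hom_axioms_def proj_hom T.a_group)

lemma proj_closed: "c \<in> carrier G \<Longrightarrow> proj c \<in> carrier T"
  using hom_in_carrier[OF proj_hom] by simp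

lemma proj_diff: "a \<in> carrier G \<Longrightarrow> b \<in> carrier G \<Longrightarrow> proj (a - b) = proj a \<ominus>\<^bsub>T\<^esub> proj b"
  using group_hom.hom_mult[OF proj_group_hom, of a "-b"] group_hom.hom_inv[OF proj_group_hom, of b]
  by (simp add: a_minus_def a_inv_def)

lemma proj_W: "c \<in> W \<Longrightarrow> proj c = \<zero>\<^bsub>T\<^esub>"
  unfolding proj_def T_sel
  using G.coset_join2[OF _ W_subgroup] subgroup.mem_carrier[OF W_subgroup]
  by (simp add: one_FactGroup)

lemma pure_proj: "pure R M N x y = proj (frag_of (x, y))"
  by (simp add: pure_def proj_def)

lemma pure_closed [simp, intro]:
  "x \<in> carrier M \<Longrightarrow> y \<in> carrier N \<Longrightarrow> pure R M N x y \<in> carrier T"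
  by (simp add: pure_proj proj_closed del: carrier_free_Abelian_group_iff)

lemma relator_zero: "c \<in> relators \<Longrightarrow> proj c = \<zero>\<^bsub>T\<^esub>"
  by (rule proj_W) (auto simp: W_eq intro: generate.incl)

lemma T_diff_eq: "\<lbrakk>a \<in> carrier T; b \<in> carrier T; a \<ominus>\<^bsub>T\<^esub> b = \<zero>\<^bsub>T\<^esub>\<rbrakk> \<Longrightarrow> a = b"
  by (metis T.minus_equality T.minus_minus a_minus_def T.a_inv_closed T.a_comm)

lemma T_diff_eq2: "\<lbrakk>a \<in> carrier T; b \<in> carrier T; c \<in> carrier T; (a \<ominus>\<^bsub>T\<^esub> b) \<ominus>\<^bsub>T\<^esub> c = \<zero>\<^bsub>T\<^esub>\<rbrakk> \<Longrightarrow> a = b \<oplus>\<^bsub>T\<^esub> c"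
  by (rule T_diff_eq) (auto simp: a_minus_def T.minus_add T.a_assoc)

lemma pure_add_left:
  assumes "x \<in> carrier M" "x' \<in> carrier M" "y \<in> carrier N"
  shows "pure R M N (x \<oplus>\<^bsub>M\<^esub> x') y = pure R M N x y \<oplus>\<^bsub>T\<^esub> pure R M N x' y"
proof (rule T_diff_eq2)
  have "frag_of (x \<oplus>\<^bsub>M\<^esub> x', y) - frag_of (x, y) - frag_of (x', y) \<in> relators"
    using assms by (auto simp: relators_def)
  from relator_zero[OF this]
  show "(pure R M N (x \<oplus>\<^bsub>M\<^esub> x') y \<ominus>\<^bsub>T\<^esub> pure R M N x y) \<ominus>\<^bsub>T\<^esub> pure R M N x' y = \<zero>\<^bsub>T\<^esub>"
    using assms by (simp add: proj_diff diff_in pure_proj del: carrier_free_Abelian_group_iff)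
qed (use assms in auto)

lemma pure_add_right:
  assumes "x \<in> carrier M" "y \<in> carrier N" "y' \<in> carrier N"
  shows "pure R M N x (y \<oplus>\<^bsub>N\<^esub> y') = pure R M N x y \<oplus>\<^bsub>T\<^esub> pure R M N x y'"
proof (rule T_diff_eq2)
  have "frag_of (x, y \<oplus>\<^bsub>N\<^esub> y') - frag_of (x, y) - frag_of (x, y') \<in> relators"
    using assms by (auto simp: relators_def)
  from relator_zero[OF this]
  show "(pure R M N x (y \<oplus>\<^bsub>N\<^esub> y') \<ominus>\<^bsub>T\<^esub> pure R M N x y) \<ominus>\<^bsub>T\<^esub> pure R M N x y' = \<zero>\<^bsub>T\<^esub>"
    using assms by (simp add: proj_diff diff_in pure_proj del: carrier_free_Abelian_group_iff)
qed (use assms in auto)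

lemma pure_balanced:
  assumes "x \<in> carrier M" "r \<in> carrier R" "y \<in> carrier N"
  shows "pure R M N (ract M x r) y = pure R M N x (lact N r y)"
proof (rule T_diff_eq)
  have "frag_of (ract M x r, y) - frag_of (x, lact N r y) \<in> relators"
    using assms by (auto simp: relators_def)
  from relator_zero[OF this]
  show "pure R M N (ract M x r) y \<ominus>\<^bsub>T\<^esub> pure R M N x (lact N r y) = \<zero>\<^bsub>T\<^esub>"
    using assms by (simp add: proj_diff diff_in pure_proj N.lact_closed M.ract_closed del: carrier_free_Abelian_group_iff)
qed (use assms N.lact_closed M.ract_closed in auto)

lemma pure_additive_map_left: "y \<in> carrier N \<Longrightarrow> additive_map M T (\<lambda>x. pure R M N x y)"
  by (rule additive_mapI) (auto simp: pure_add_left)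

lemma pure_additive_map_right: "x \<in> carrier M \<Longrightarrow> additive_map N T (\<lambda>y. pure R M N x y)"
  by (rule additive_mapI) (auto simp: pure_add_right)

lemma pure_is_balanced: "balanced R M N T (pure R M N)"
  by (rule balancedI) (auto simp: pure_additive_map_left pure_additive_map_right pure_balanced)

lemma T_rep:
  assumes "z \<in> carrier T"
  obtains c where "c \<in> carrier G" "z = proj c"
  using assms unfolding T_sel FactGroup_def RCOSETS_def proj_def by auto

text \<open>A negative of a pure tensor is again pure, with the sign moved into the left factor, so
  sums of pure tensors exhaust the group. Induction on the free abelian group produces differences,
  hence the property is carried for an element and its negative together.\<close>

lemma T_induct [consumes 1, case_names pure add]:
  assumes z: "z \<in> carrier T"
    and pure: "\<And>x y. x \<in> carrier M \<Longrightarrow> y \<in> carrier N \<Longrightarrow> P (pure R M N x y)"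
    and add: "\<And>z w. z \<in> carrier T \<Longrightarrow> w \<in> carrier T \<Longrightarrow> P z \<Longrightarrow> P w \<Longrightarrow> P (z \<oplus>\<^bsub>T\<^esub> w)"
  shows "P z"
proof -
  let ?P = "\<lambda>z. P z \<and> P (\<ominus>\<^bsub>T\<^esub> z)"
  have zero: "P \<zero>\<^bsub>T\<^esub>"
    using pure[of "\<zero>\<^bsub>M\<^esub>" "\<zero>\<^bsub>N\<^esub>"] additive_map_zero[OF M.M.abelian_group_axioms T.abelian_group_axioms pure_additive_map_left]
    by simp
  obtain c where c: "c \<in> carrier G" "z = proj c" using T_rep[OF z] .
  have "Poly_Mapping.keys c \<subseteq> carrier M \<times> carrier N"
    using c(1) by simp
  then have "?P (proj c)"
  proof (induction c rule: free_Abelian_group_induct[consumes 1])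
    case 1
    then show ?case
      using zero group_hom.hom_one[OF proj_group_hom]
      by (simp add: T.minus_equality[of "\<zero>\<^bsub>T\<^esub>" "\<zero>\<^bsub>T\<^esub>"])
  next
    case (2 x y)
    then have [simp]: "proj x \<in> carrier T" "proj y \<in> carrier T"
      by (simp_all add: proj_closed)
    show ?case
      using 2 add[of "proj x" "\<ominus>\<^bsub>T\<^esub> proj y"] add[of "proj y" "\<ominus>\<^bsub>T\<^esub> proj x"]
      by (simp add: proj_diff a_minus_def T.minus_add T.a_comm)
  next
    case (3 a)
    then obtain x y where a: "a = (x, y)" "x \<in> carrier M" "y \<in> carrier N" by auto
    show ?case
      using a pure[of x y] pure[of "\<ominus>\<^bsub>M\<^esub> x" y]
        additive_map_minus[OF M.M.abelian_group_axioms T.abelian_group_axioms pure_additive_map_left, of y x]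
      by (simp add: pure_proj)
  qed
  then show ?thesis using c by simp
qed

lemma additive_map_eqI:
  assumes "additive_map T A f" "additive_map T A g"
    and "\<And>x y. x \<in> carrier M \<Longrightarrow> y \<in> carrier N \<Longrightarrow> f (pure R M N x y) = g (pure R M N x y)"
    and "z \<in> carrier T"
  shows "f z = g z"
  using assms(4)
  by (induction rule: T_induct) (auto simp: assms additive_map_add[OF assms(1)] additive_map_add[OF assms(2)])

section \<open>Evaluation of lifts on chosen representatives\<close>

definition choose_rep :: "('m \<times> 'n \<Rightarrow>\<^sub>0 int) set \<Rightarrow> ('m \<times> 'n \<Rightarrow>\<^sub>0 int)" where
  "choose_rep z = (SOME c. c \<in> z)"

lemma choose_rep:
  assumes "z \<in> carrier T"
  shows "choose_rep z \<in> z" "choose_rep z \<in> carrier G" "proj (choose_rep z) = z"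
    "Poly_Mapping.keys (choose_rep z) \<subseteq> carrier M \<times> carrier N"
proof -
  obtain c where c: "c \<in> carrier G" "z = proj c" using T_rep[OF assms] .
  have "c \<in> z"
    using G.rcos_self[OF c(1) W_subgroup] c(2) by (simp add: proj_def)
  then show *: "choose_rep z \<in> z"
    unfolding choose_rep_def by (rule someI)
  then show **: "choose_rep z \<in> carrier G"
    using G.r_coset_subset_G[OF subgroup.subset[OF W_subgroup] c(1)] c(2) unfolding proj_def by blast
  then show "Poly_Mapping.keys (choose_rep z) \<subseteq> carrier M \<times> carrier N" by simp
  show "proj (choose_rep z) = z"
    using G.repr_independence[OF *[unfolded c(2) proj_def] c(1) W_subgroup] c(2)
    by (simp add: proj_def)
qed

lemma choose_rep_keys:
  "z \<in> carrier T \<Longrightarrow> p \<in> Poly_Mapping.keys (choose_rep z) \<Longrightarrow> fst p \<in> carrier M \<and> snd p \<in> carrier N"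
  using choose_rep(4)[of z] by auto

definition frag_eval :: "('a, 'w) ring_scheme \<Rightarrow> ('m \<Rightarrow> 'n \<Rightarrow> 'a) \<Rightarrow> ('m \<times> 'n \<Rightarrow>\<^sub>0 int) \<Rightarrow> 'a" where
  "frag_eval A f c = (\<Oplus>\<^bsub>A\<^esub>p\<in>Poly_Mapping.keys c. add_pow A (Poly_Mapping.lookup c p) (f (fst p) (snd p)))"

lemma lift_frag_eval: "tensor_lift A f z = frag_eval A f (choose_rep z)"
  by (simp add: tensor_lift_def frag_eval_def choose_rep_def Let_def)

text \<open>From here to \<open>lift_finsum_fun\<close> the maps are not assumed balanced: both
  sides are finite sums over the same representative, so only their values on the carriers matter.
  Balancing enters when the value on a given tensor is computed.\<close>

lemma lift_cong:
  assumes "z \<in> carrier T" "abelian_group A"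
    and "\<And>x y. x \<in> carrier M \<Longrightarrow> y \<in> carrier N \<Longrightarrow> g x y \<in> carrier A"
    and "\<And>x y. x \<in> carrier M \<Longrightarrow> y \<in> carrier N \<Longrightarrow> f x y = g x y"
  shows "tensor_lift A f z = tensor_lift A g z"
proof -
  interpret A: abelian_group A by fact
  show ?thesis
    unfolding lift_frag_eval frag_eval_def
    using choose_rep_keys[OF assms(1)] assms(3,4)
    by (intro A.finsum_cong') auto
qed

lemma lift_closed:
  assumes "z \<in> carrier T" "abelian_group A"
    and "\<And>x y. x \<in> carrier M \<Longrightarrow> y \<in> carrier N \<Longrightarrow> f x y \<in> carrier A"
  shows "tensor_lift A f z \<in> carrier A"
proof -
  interpret A: abelian_group A by fact
  show ?thesis
    unfolding lift_frag_eval frag_eval_def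
    using choose_rep_keys[OF assms(1)] assms(3)
    by (intro A.finsum_closed) auto
qed

lemma lift_hom:
  assumes "z \<in> carrier T" "abelian_group A" "abelian_group B" "additive_map A B \<phi>"
    and "\<And>x y. x \<in> carrier M \<Longrightarrow> y \<in> carrier N \<Longrightarrow> f x y \<in> carrier A"
  shows "\<phi> (tensor_lift A f z) = tensor_lift B (\<lambda>x y. \<phi> (f x y)) z"
proof -
  interpret A: abelian_group A by fact
  interpret B: abelian_group B by fact
  have "\<phi> (tensor_lift A f z) = (\<Oplus>\<^bsub>B\<^esub>p\<in>Poly_Mapping.keys (choose_rep z). \<phi> (add_pow A (Poly_Mapping.lookup (choose_rep z) p) (f (fst p) (snd p))))"
    unfolding lift_frag_eval frag_eval_def
    using choose_rep_keys[OF assms(1)] assms(5)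
    by (intro additive_map_finsum[OF assms(2-4)]) auto
  also have "\<dots> = tensor_lift B (\<lambda>x y. \<phi> (f x y)) z"
    unfolding lift_frag_eval frag_eval_def
    using choose_rep_keys[OF assms(1)] assms(5)
    by (intro B.finsum_cong') (auto simp: additive_map_add_pow[OF assms(2-4)] additive_map_closed[OF assms(4)])
  finally show ?thesis .
qed

lemma lift_add_fun:
  assumes "z \<in> carrier T" "abelian_group A"
    and "\<And>x y. x \<in> carrier M \<Longrightarrow> y \<in> carrier N \<Longrightarrow> f x y \<in> carrier A"
    and "\<And>x y. x \<in> carrier M \<Longrightarrow> y \<in> carrier N \<Longrightarrow> g x y \<in> carrier A"
  shows "tensor_lift A (\<lambda>x y. f x y \<oplus>\<^bsub>A\<^esub> g x y) z = tensor_lift A f z \<oplus>\<^bsub>A\<^esub> tensor_lift A g z"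
proof -
  interpret A: abelian_group A by fact
  have *: "add_pow A k (a \<oplus>\<^bsub>A\<^esub> b) = add_pow A k a \<oplus>\<^bsub>A\<^esub> add_pow A k b"
    if "a \<in> carrier A" "b \<in> carrier A" for a b and k :: int
    using A.add.int_pow_distrib[OF that] by simp
  have "tensor_lift A (\<lambda>x y. f x y \<oplus>\<^bsub>A\<^esub> g x y) z =
    (\<Oplus>\<^bsub>A\<^esub>p\<in>Poly_Mapping.keys (choose_rep z).
      add_pow A (Poly_Mapping.lookup (choose_rep z) p) (f (fst p) (snd p)) \<oplus>\<^bsub>A\<^esub>
      add_pow A (Poly_Mapping.lookup (choose_rep z) p) (g (fst p) (snd p)))"
    unfolding lift_frag_eval frag_eval_def
    by (rule A.finsum_cong') (use choose_rep_keys[OF assms(1)] assms(3,4) in \<open>auto simp: *\<close>)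
  also have "\<dots> = tensor_lift A f z \<oplus>\<^bsub>A\<^esub> tensor_lift A g z"
    unfolding lift_frag_eval frag_eval_def
    by (rule A.finsum_addf) (use choose_rep_keys[OF assms(1)] assms(3,4) in auto)
  finally show ?thesis .
qed

lemma lift_zero_fun:
  assumes "z \<in> carrier T" "abelian_group A"
  shows "tensor_lift A (\<lambda>x y. \<zero>\<^bsub>A\<^esub>) z = \<zero>\<^bsub>A\<^esub>"
proof -
  interpret A: abelian_group A by fact
  show ?thesis unfolding lift_frag_eval frag_eval_def by simp
qed

lemma lift_finsum_fun:
  assumes "z \<in> carrier T" "abelian_group A"
    and "\<And>p x y. p \<in> S \<Longrightarrow> x \<in> carrier M \<Longrightarrow> y \<in> carrier N \<Longrightarrow> f p x y \<in> carrier A"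
  shows "tensor_lift A (\<lambda>x y. \<Oplus>\<^bsub>A\<^esub>p\<in>S. f p x y) z = (\<Oplus>\<^bsub>A\<^esub>p\<in>S. tensor_lift A (f p) z)"
proof -
  interpret A: abelian_group A by fact
  show ?thesis
    using assms(3)
  proof (induction S rule: infinite_finite_induct)
    case (infinite S)
    then show ?case by (simp add: lift_zero_fun assms)
  next
    case empty
    then show ?case by (simp add: lift_zero_fun assms)
  next
    case (insert p F)
    have "tensor_lift A (\<lambda>x y. \<Oplus>\<^bsub>A\<^esub>p\<in>insert p F. f p x y) z
        = tensor_lift A (\<lambda>x y. f p x y \<oplus>\<^bsub>A\<^esub> (\<Oplus>\<^bsub>A\<^esub>p\<in>F. f p x y)) z"
      by (rule lift_cong[OF assms(1,2)]) (use insert in \<open>auto intro!: A.finsum_insert A.finsum_closed\<close>)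
    also have "\<dots> = tensor_lift A (f p) z \<oplus>\<^bsub>A\<^esub> (\<Oplus>\<^bsub>A\<^esub>p\<in>F. tensor_lift A (f p) z)"
      using insert by (subst lift_add_fun[OF assms(1,2)]) (auto intro!: A.finsum_closed)
    also have "\<dots> = (\<Oplus>\<^bsub>A\<^esub>p\<in>insert p F. tensor_lift A (f p) z)"
      using insert by (subst A.finsum_insert) (auto intro!: lift_closed assms(1,2))
    finally show ?case .
  qed
qed

context
  fixes A :: "('a, 'w) ring_scheme" and f
  assumes A: "abelian_group A" and f: "balanced R M N A f"
begin

interpretation A: abelian_group A by (rule A)

text \<open>The universal property of the free abelian group supplies a homomorphism with the right
  values on generators; \<open>frag_eval\<close> agrees with it because every element is the integer
  combination of its keys.\<close>

lemma frag_eval_hom: "frag_eval A f \<in> hom G (add_monoid A)"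
  and frag_eval_frag_of: "x \<in> carrier M \<Longrightarrow> y \<in> carrier N \<Longrightarrow> frag_eval A f (frag_of (x, y)) = f x y"
proof -
  let ?S = "carrier M \<times> carrier N"
  have sub: "(\<lambda>p. f (fst p) (snd p)) ` ?S \<subseteq> carrier (add_monoid A)"
    using balancedD(1)[OF f] by auto
  obtain h where h: "h \<in> hom G (add_monoid A)"
    "\<And>p. p \<in> ?S \<Longrightarrow> h (frag_of p) = f (fst p) (snd p)"
    using comm_group.free_Abelian_group_universal[OF A.a_comm_group sub] by blast
  have hg: "group_hom G (add_monoid A) h"
    using h(1) by (simp add: group_hom_def group_hom_axioms_def A.a_group)
  have frag_eval: "frag_eval A f c = h c" if "c \<in> carrier G" for c
  proof -
    have keys: "Poly_Mapping.keys c \<subseteq> ?S" using that by simp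
    have c: "c = (\<Sum>p\<in>Poly_Mapping.keys c. frag_cmul (Poly_Mapping.lookup c p) (frag_of p))"
      using frag_expansion[of c] by (simp add: frag_extend_def)
    \<comment> \<open>Stated for an arbitrary finite \<open>V\<close> with the coefficients of the
      fixed \<open>c\<close>, so that the induction shrinks the index set without changing the
      coefficients.\<close>
    have "h (\<Sum>p\<in>V. frag_cmul (Poly_Mapping.lookup c p) (frag_of p))
      = finsum A (\<lambda>p. add_pow A (Poly_Mapping.lookup c p) (f (fst p) (snd p))) V"
      if "finite V" "V \<subseteq> ?S" for V
      using that
    proof (induction V)
      case empty
      then show ?case using group_hom.hom_one[OF hg] by simp
    next
      case (insert p V)
      have p: "frag_of p \<in> carrier G" using insert by (simp add: keys_frag_of)
      have in1: "frag_cmul (Poly_Mapping.lookup c p) (frag_of p) \<in> carrier G"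
        using insert keys_cmul[of _ "frag_of p"] by (auto simp: keys_frag_of)
      have in2: "(\<Sum>p\<in>V. frag_cmul (Poly_Mapping.lookup c p) (frag_of p)) \<in> carrier G"
        using insert keys_cmul keys_frag_of
        by (intro sum_closed_free_Abelian_group) (auto simp del: keys_cmul_iff simp: keys_frag_of)
      have "h (frag_cmul (Poly_Mapping.lookup c p) (frag_of p)) = add_pow A (Poly_Mapping.lookup c p) (h (frag_of p))"
        using group_hom.hom_int_pow[OF hg p, of "Poly_Mapping.lookup c p"] p by (simp add: add_pow_def)
      then show ?case
      proof -
        have S: "fst q \<in> carrier M" "snd q \<in> carrier N" if "q \<in> insert p V" for q
          using insert(4) that by auto
        have pS: "p \<in> ?S" using insert(4) by auto
        show ?thesis
          using insert(1,2,3) insert(4) group_hom.hom_mult[OF hg in1 in2] h(2)[OF pS] S balancedD(1)[OF f]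
            \<open>h (frag_cmul _ _) = _\<close>
          by (subst A.finsum_insert) auto
      qed
    qed
    from this[OF _ keys] show ?thesis
      using c by (simp add: frag_eval_def)
  qed
  show "frag_eval A f \<in> hom G (add_monoid A)"
  proof (rule homI)
    fix a b assume ab: "a \<in> carrier G" "b \<in> carrier G"
    then have "a \<otimes>\<^bsub>G\<^esub> b \<in> carrier G" by (rule G.m_closed)
    then show "frag_eval A f (a \<otimes>\<^bsub>G\<^esub> b) = frag_eval A f a \<otimes>\<^bsub>add_monoid A\<^esub> frag_eval A f b"
      using ab hom_mult[OF h(1) ab] by (simp add: frag_eval del: mult_free_Abelian_group carrier_free_Abelian_group_iff)
  qed (use hom_in_carrier[OF h(1)] frag_eval in auto)
  show "frag_eval A f (frag_of (x, y)) = f x y" if "x \<in> carrier M" "y \<in> carrier N" for x y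
    using frag_eval[of "frag_of (x, y)"] h(2)[of "(x, y)"] that by (simp add: keys_frag_of)
qed

lemma frag_eval_group_hom: "group_hom G (add_monoid A) (frag_eval A f)"
  using frag_eval_hom by (simp add: group_hom_def group_hom_axioms_def A.a_group)

lemma frag_eval_diff: "a \<in> carrier G \<Longrightarrow> b \<in> carrier G \<Longrightarrow> frag_eval A f (a - b) = frag_eval A f a \<ominus>\<^bsub>A\<^esub> frag_eval A f b"
  using group_hom.hom_mult[OF frag_eval_group_hom, of a "-b"] group_hom.hom_inv[OF frag_eval_group_hom, of b]
  by (simp add: a_minus_def a_inv_def)

text \<open>The kernel is a subgroup, so it is enough that the three kinds of relators vanish; these
  are exactly the three clauses of \<open>balanced\<close>.\<close>

lemma frag_eval_W:
  assumes "c \<in> W"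
  shows "frag_eval A f c = \<zero>\<^bsub>A\<^esub>"
proof -
  let ?Z = "{c \<in> carrier G. frag_eval A f c = \<zero>\<^bsub>A\<^esub>}"
  have "relators \<subseteq> ?Z"
  proof
    fix c assume c: "c \<in> relators"
    note simps = frag_eval_diff diff_in frag_eval_frag_of M.ract_closed N.lact_closed balancedD(1)[OF f]
    have cancel: "((a \<oplus>\<^bsub>A\<^esub> b) \<ominus>\<^bsub>A\<^esub> a) \<ominus>\<^bsub>A\<^esub> b = \<zero>\<^bsub>A\<^esub>" if "a \<in> carrier A" "b \<in> carrier A" for a b
      using that by (metis A.a_assoc A.a_comm A.add.inv_closed A.add.m_closed A.r_neg A.r_neg2 a_minus_def)
    consider (1) x x' y where "c = frag_of (x \<oplus>\<^bsub>M\<^esub> x', y) - frag_of (x, y) - frag_of (x', y)"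
        "x \<in> carrier M" "x' \<in> carrier M" "y \<in> carrier N"
      | (2) x y y' where "c = frag_of (x, y \<oplus>\<^bsub>N\<^esub> y') - frag_of (x, y) - frag_of (x, y')"
        "x \<in> carrier M" "y \<in> carrier N" "y' \<in> carrier N"
      | (3) x r y where "c = frag_of (ract M x r, y) - frag_of (x, lact N r y)"
         "x \<in> carrier M" "r \<in> carrier R" "y \<in> carrier N"
      using c unfolding relators_def by blast
    then have "frag_eval A f c = \<zero>\<^bsub>A\<^esub>"
    proof cases
      case 1
      then show ?thesis
        by (simp add: simps cancel additive_map_add[OF balancedD(2)[OF f]] del: carrier_free_Abelian_group_iff)
    next
      case 2
      then show ?thesis
        by (simp add: simps cancel additive_map_add[OF balancedD(3)[OF f]] del: carrier_free_Abelian_group_iff)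
    next
      case 3
      then show ?thesis
        by (simp add: simps balancedD(4)[OF f] A.r_neg a_minus_def del: carrier_free_Abelian_group_iff)
    qed
    then show "c \<in> ?Z" using subsetD[OF relators_subset c] by blast
  qed
  moreover have "subgroup ?Z G"
    using group_hom.subgroup_kernel[OF frag_eval_group_hom] by (simp add: kernel_def)
  ultimately have "W \<subseteq> ?Z"
    unfolding W_eq by (rule G.generate_subgroup_incl)
  then show ?thesis using assms by auto
qed

lemma frag_eval_coset:
  assumes "c \<in> carrier G" "c' \<in> carrier G" "proj c = proj c'"
  shows "frag_eval A f c = frag_eval A f c'"
proof -
  have "c \<in> W #>\<^bsub>G\<^esub> c'"
    using G.rcos_self[OF assms(1) W_subgroup] assms(3) by (simp add: proj_def)
  then obtain w where w: "w \<in> W" "c = w \<otimes>\<^bsub>G\<^esub> c'" by (auto simp: r_coset_def)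
  have "w \<in> carrier G" using w subgroup.subset[OF W_subgroup] by blast
  then have "frag_eval A f c = frag_eval A f w \<oplus>\<^bsub>A\<^esub> frag_eval A f c'"
    using group_hom.hom_mult[OF frag_eval_group_hom _ assms(2)] w(2) by simp
  then show ?thesis
    using frag_eval_W[OF w(1)] group_hom.hom_closed[OF frag_eval_group_hom assms(2)] by simp
qed

lemma lift_proj: "c \<in> carrier G \<Longrightarrow> tensor_lift A f (proj c) = frag_eval A f c"
  unfolding lift_frag_eval
  by (rule frag_eval_coset) (auto simp only: choose_rep proj_closed)

lemma lift_pure: "x \<in> carrier M \<Longrightarrow> y \<in> carrier N \<Longrightarrow> tensor_lift A f (pure R M N x y) = f x y"
  unfolding pure_proj by (simp add: lift_proj frag_eval_frag_of del: carrier_free_Abelian_group_iff)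

lemma lift_additive_map: "additive_map T A (tensor_lift A f)"
proof (rule additive_mapI)
  show "tensor_lift A f z \<in> carrier A" if "z \<in> carrier T" for z
    using lift_closed[OF that A] balancedD(1)[OF f] by blast
  fix z w assume zw: "z \<in> carrier T" "w \<in> carrier T"
  have "z \<oplus>\<^bsub>T\<^esub> w = proj (choose_rep z \<otimes>\<^bsub>G\<^esub> choose_rep w)"
    using group_hom.hom_mult[OF proj_group_hom choose_rep(2)[OF zw(1)] choose_rep(2)[OF zw(2)]]
    by (simp add: choose_rep(3)[OF zw(1)] choose_rep(3)[OF zw(2)])
  then show "tensor_lift A f (z \<oplus>\<^bsub>T\<^esub> w) = tensor_lift A f z \<oplus>\<^bsub>A\<^esub> tensor_lift A f w"
    using choose_rep(2)[OF zw(1)] choose_rep(2)[OF zw(2)]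
      group_hom.hom_mult[OF frag_eval_group_hom choose_rep(2)[OF zw(1)] choose_rep(2)[OF zw(2)]]
    by (simp only: lift_proj G.m_closed lift_frag_eval[of A f z] lift_frag_eval[of A f w]) simp
qed

end

lemma lift_pure_id: "z \<in> carrier T \<Longrightarrow> tensor_lift T (pure R M N) z = z"
  by (rule additive_map_eqI[of T _ "\<lambda>z. z"])
    (auto simp: lift_additive_map lift_pure pure_is_balanced T.abelian_group_axioms intro!: additive_mapI)

lemma lact_pure_balanced:
  assumes "r \<in> carrier R"
  shows "balanced R M N T (\<lambda>x y. pure R M N (lact M r x) y)"
  by (rule balancedI)
    (use assms in \<open>auto intro!: additive_mapI simp: pure_add_left pure_add_right M.lact_add M.lact_closed
      M.ract_closed M.lact_ract pure_balanced\<close>)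

lemma ract_pure_balanced:
  assumes "r \<in> carrier R"
  shows "balanced R M N T (\<lambda>x y. pure R M N x (ract N y r))"
  by (rule balancedI)
    (use assms in \<open>auto intro!: additive_mapI simp: pure_add_left pure_add_right N.ract_add N.lact_closed
      N.ract_closed N.lact_ract[symmetric] pure_balanced\<close>)

text \<open>The record \<open>tensor\<close> is defined by lifts into \<open>tensor_group\<close>;
  these formulas replace that target by the tensor product itself, where the universal property is
  available.\<close>

lemma lact_T: "lact T r z = tensor_lift T (\<lambda>x y. pure R M N (lact M r x) y) z"
  and ract_T: "ract T z r = tensor_lift T (\<lambda>x y. pure R M N x (ract N y r)) z"
  unfolding tensor_lift_cong_target[OF T_group_sel, symmetric]
  by (simp_all only: tensor_def Let_def bimodule.simps)

lemma lact_pure: "\<lbrakk>r \<in> carrier R; x \<in> carrier M; y \<in> carrier N\<rbrakk>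
    \<Longrightarrow> lact T r (pure R M N x y) = pure R M N (lact M r x) y"
  unfolding lact_T by (simp add: lift_pure lact_pure_balanced T.abelian_group_axioms)

lemma ract_pure: "\<lbrakk>r \<in> carrier R; x \<in> carrier M; y \<in> carrier N\<rbrakk>
    \<Longrightarrow> ract T (pure R M N x y) r = pure R M N x (ract N y r)"
  unfolding ract_T by (simp add: lift_pure ract_pure_balanced T.abelian_group_axioms)

lemma lact_T_additive_map: "r \<in> carrier R \<Longrightarrow> additive_map T T (lact T r)"
  unfolding lact_T using lift_additive_map[OF T.abelian_group_axioms lact_pure_balanced] .

lemma ract_T_additive_map: "r \<in> carrier R \<Longrightarrow> additive_map T T (\<lambda>z. ract T z r)"
  unfolding ract_T using lift_additive_map[OF T.abelian_group_axioms ract_pure_balanced] .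

sublocale T: bimod R T
proof unfold_locales
  show "lact T r (ract T x s) = ract T (lact T r x) s"
    if "r \<in> carrier R" "s \<in> carrier R" "x \<in> carrier T" for r s x
    using that(3)
    by (induction rule: T_induct)
      (use that in \<open>auto simp: lact_pure ract_pure additive_map_add[OF lact_T_additive_map] additive_map_add[OF ract_T_additive_map]
        additive_map_closed[OF lact_T_additive_map] additive_map_closed[OF ract_T_additive_map] M.lact_closed N.ract_closed\<close>)
qed (auto simp: additive_map_add[OF lact_T_additive_map] additive_map_add[OF ract_T_additive_map]
        additive_map_closed[OF lact_T_additive_map] additive_map_closed[OF ract_T_additive_map])

end

text \<open>One lift is written as a finite sum and moved through the other by additivity. As no
  balancing is involved, the two tensor products may belong to different base rings and different
  modules.\<close>

lemma (in tensor_pair) lift_fubini: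
  assumes "tensor_pair R' M' N'" "abelian_group A" "z \<in> carrier T" "w \<in> carrier (tensor R' M' N')"
    and cl: "\<And>x y u v. \<lbrakk>x \<in> carrier M; y \<in> carrier N; u \<in> carrier M'; v \<in> carrier N'\<rbrakk> \<Longrightarrow> f x y u v \<in> carrier A"
  shows "tensor_lift A (\<lambda>x y. tensor_lift A (\<lambda>u v. f x y u v) w) z =
    tensor_lift A (\<lambda>u v. tensor_lift A (\<lambda>x y. f x y u v) z) w"
proof -
  interpret W: tensor_pair R' M' N' by fact
  interpret A: abelian_group A by fact
  let ?c = "W.choose_rep w"
  have k: "fst p \<in> carrier M' \<and> snd p \<in> carrier N'" if "p \<in> Poly_Mapping.keys ?c" for p
    using W.choose_rep_keys[OF assms(4) that] .
  have pow: "additive_map A A (add_pow A k)" for k :: int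
    by (rule additive_mapI) (auto simp: A.add.int_pow_distrib)
  have "tensor_lift A (\<lambda>x y. tensor_lift A (\<lambda>u v. f x y u v) w) z =
     (\<Oplus>\<^bsub>A\<^esub>p\<in>Poly_Mapping.keys ?c. tensor_lift A (\<lambda>x y. add_pow A (Poly_Mapping.lookup ?c p) (f x y (fst p) (snd p))) z)"
    unfolding W.lift_frag_eval W.frag_eval_def
    by (rule lift_finsum_fun) (use assms k in auto)
  also have "\<dots> = (\<Oplus>\<^bsub>A\<^esub>p\<in>Poly_Mapping.keys ?c. add_pow A (Poly_Mapping.lookup ?c p) (tensor_lift A (\<lambda>x y. f x y (fst p) (snd p)) z))"
    by (rule A.finsum_cong')
      (use assms k in \<open>auto simp: lift_hom[OF assms(3,2,2) pow] intro!: lift_closed A.add.int_pow_closed\<close>)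
  finally show ?thesis unfolding W.lift_frag_eval W.frag_eval_def .
qed

section \<open>Linear maps and tensor products over the ground ring\<close>

lemma foldSetD_cong:
  assumes "(B, y) \<in> foldSetD D f e" "\<And>x. x \<in> B \<Longrightarrow> f x = g x"
  shows "(B, y) \<in> foldSetD D g e"
  using assms
proof (induction rule: foldSetD.induct)
  case emptyI
  then show ?case by (simp add: foldSetD.emptyI)
next
  case (insertI x A y)
  then have "f x y = g x y" by auto
  then show ?case
    using foldSetD.insertI[of x A g y D e] insertI by auto
qed

text \<open>Holds without closure conditions because \<open>foldSetD\<close> evaluates the summand
  only at members of the index set. This is what later allows congruence rules whose only hypotheses
  are equalities on the carriers.\<close>

lemma finprod_cong_strong:
  assumes "\<And>x. x \<in> S \<Longrightarrow> f x = g x"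
  shows "finprod G f S = finprod G g S"
proof -
  have "(S, y) \<in> foldSetD (carrier G) (monoid.mult G \<circ> f) \<one>\<^bsub>G\<^esub> \<longleftrightarrow>
    (S, y) \<in> foldSetD (carrier G) (monoid.mult G \<circ> g) \<one>\<^bsub>G\<^esub>" for y
    using assms by (auto elim!: foldSetD_cong)
  then show ?thesis
    by (simp add: finprod_def foldD_def)
qed

lemma (in tensor_pair) lift_cong_strong:
  assumes "z \<in> carrier T" "\<And>x y. x \<in> carrier M \<Longrightarrow> y \<in> carrier N \<Longrightarrow> f x y = g x y"
  shows "tensor_lift A f z = tensor_lift A g z"
  unfolding lift_frag_eval frag_eval_def finsum_def
  using choose_rep_keys[OF assms(1)] assms(2)
  by (intro finprod_cong_strong) auto

text \<open>A tensor product of maps needs right linearity of its first factor and left linearity of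
  its second. \<open>bimodule_hom\<close> is split accordingly, since coassociativity puts the
  coproduct once into each leg.\<close>

definition right_lin :: "('r, 'x) ring_scheme \<Rightarrow> ('r, 'm, 'y) bimodule_scheme \<Rightarrow> ('r, 'n, 'z) bimodule_scheme
   \<Rightarrow> ('m \<Rightarrow> 'n) \<Rightarrow> bool" where
  "right_lin R M N f \<longleftrightarrow> additive_map M N f \<and> (\<forall>x\<in>carrier M. \<forall>r\<in>carrier R. f (ract M x r) = ract N (f x) r)"

definition left_lin :: "('r, 'x) ring_scheme \<Rightarrow> ('r, 'm, 'y) bimodule_scheme \<Rightarrow> ('r, 'n, 'z) bimodule_scheme
   \<Rightarrow> ('m \<Rightarrow> 'n) \<Rightarrow> bool" where
  "left_lin R M N f \<longleftrightarrow> additive_map M N f \<and> (\<forall>x\<in>carrier M. \<forall>r\<in>carrier R. f (lact M r x) = lact N r (f x))"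

lemma bimodule_hom_iff: "f \<in> bimodule_hom R M N \<longleftrightarrow> left_lin R M N f \<and> right_lin R M N f"
  by (auto simp: bimodule_hom_def left_lin_def right_lin_def additive_map_def)

lemma left_lin_id: "left_lin R M M id" and right_lin_id: "right_lin R M M id"
  by (auto simp: left_lin_def right_lin_def additive_map_def)

context
  fixes R :: "('r, 'x) ring_scheme"
    and M :: "('r, 'm, 'y) bimodule_scheme" and N :: "('r, 'n, 'z) bimodule_scheme"
    and M' :: "('r, 'm1, 'y1) bimodule_scheme" and N' :: "('r, 'n1, 'z1) bimodule_scheme"
    and f g
  assumes P: "tensor_pair R M N" and P': "tensor_pair R M' N'"
    and f: "right_lin R M M' f" and g: "left_lin R N N' g"
begin

interpretation P: tensor_pair R M N by (rule P)
interpretation P': tensor_pair R M' N' by (rule P')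

lemma tensor_map_balanced: "balanced R M N (tensor R M' N') (\<lambda>x y. pure R M' N' (f x) (g y))"
proof (rule balancedI)
  note fD = f[unfolded right_lin_def, THEN conjunct1]
  note gD = g[unfolded left_lin_def, THEN conjunct1]
  note [simp] = additive_map_closed[OF fD] additive_map_closed[OF gD] additive_map_add[OF fD] additive_map_add[OF gD]
  show "additive_map M (tensor R M' N') (\<lambda>x. pure R M' N' (f x) (g y))" if "y \<in> carrier N" for y
    using that by (intro additive_mapI) (auto simp: P'.pure_add_left)
  show "additive_map N (tensor R M' N') (\<lambda>y. pure R M' N' (f x) (g y))" if "x \<in> carrier M" for x
    using that by (intro additive_mapI) (auto simp: P'.pure_add_right)
  show "pure R M' N' (f (ract M x r)) (g y) = pure R M' N' (f x) (g (lact N r y))"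
    if "x \<in> carrier M" "r \<in> carrier R" "y \<in> carrier N" for x r y
    using that f g by (simp add: right_lin_def left_lin_def P'.pure_balanced)
qed

lemma tensor_map_additive_map: "additive_map (tensor R M N) (tensor R M' N') (tensor_map R M' N' f g)"
  unfolding tensor_map_def by (rule P.lift_additive_map[OF P'.T_abelian tensor_map_balanced])

lemma tensor_map_pure:
  "x \<in> carrier M \<Longrightarrow> y \<in> carrier N \<Longrightarrow> tensor_map R M' N' f g (pure R M N x y) = pure R M' N' (f x) (g y)"
  unfolding tensor_map_def by (rule P.lift_pure[OF P'.T_abelian tensor_map_balanced])

end

section \<open>Associativity of the balanced tensor product\<close>

locale tensor_triple = M: bimod R M + N: bimod R N + P: bimod R P
  for R :: "('r, 'x) ring_scheme" and M :: "('r, 'm, 'y) bimodule_scheme"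
    and N :: "('r, 'n, 'z) bimodule_scheme" and P :: "('r, 'p, 'w) bimodule_scheme"
begin

sublocale MN: tensor_pair R M N ..
sublocale NP: tensor_pair R N P ..
sublocale MN_P: tensor_pair R "tensor R M N" P ..
sublocale M_NP: tensor_pair R M "tensor R N P" ..

lemma assoc_inner_balanced:
  assumes "z \<in> carrier P"
  shows "balanced R M N (tensor R M (tensor R N P)) (\<lambda>x y. pure R M (tensor R N P) x (pure R N P y z))"
  by (rule balancedI)
    (use assms in \<open>auto intro!: additive_mapI simp: NP.pure_add_left M_NP.pure_add_left M_NP.pure_add_right
      M_NP.pure_balanced NP.lact_pure M.ract_closed\<close>)

definition assoc_inner where
  "assoc_inner u z = tensor_lift (tensor R M (tensor R N P)) (\<lambda>x y. pure R M (tensor R N P) x (pure R N P y z)) u"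

lemma assoc_inner_additive_map: "z \<in> carrier P \<Longrightarrow> additive_map (tensor R M N) (tensor R M (tensor R N P)) (\<lambda>u. assoc_inner u z)"
  unfolding assoc_inner_def
  by (rule MN.lift_additive_map[OF M_NP.T_abelian assoc_inner_balanced])

lemma assoc_inner_pure:
  "\<lbrakk>x \<in> carrier M; y \<in> carrier N; z \<in> carrier P\<rbrakk>
    \<Longrightarrow> assoc_inner (pure R M N x y) z = pure R M (tensor R N P) x (pure R N P y z)"
  unfolding assoc_inner_def
  by (rule MN.lift_pure[OF M_NP.T_abelian assoc_inner_balanced])

text \<open>In the variable from \<open>P\<close> the tensor \<open>u\<close> stays fixed while the
  lifted map changes, so additivity and balancing there are checked on pure \<open>u\<close> and
  extended by induction.\<close>

lemma assoc_balanced: "balanced R (tensor R M N) P (tensor R M (tensor R N P)) assoc_inner"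
proof (rule balancedI)
  show "additive_map (tensor R M N) (tensor R M (tensor R N P)) (\<lambda>x. assoc_inner x y)" if "y \<in> carrier P" for y
    by (rule assoc_inner_additive_map[OF that])
  show "additive_map P (tensor R M (tensor R N P)) (assoc_inner u)" if u: "u \<in> carrier (tensor R M N)" for u
  proof (rule additive_mapI)
    show cl: "assoc_inner u z \<in> carrier (tensor R M (tensor R N P))" if "z \<in> carrier P" for z
      using additive_map_closed[OF assoc_inner_additive_map[OF that] u] .
    fix z w assume zw: "z \<in> carrier P" "w \<in> carrier P"
    show "assoc_inner u (z \<oplus>\<^bsub>P\<^esub> w) = assoc_inner u z \<oplus>\<^bsub>tensor R M (tensor R N P)\<^esub> assoc_inner u w"
      using u
    proof (induction rule: MN.T_induct)
      case (pure x y)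
      then show ?case
        using zw by (simp add: assoc_inner_pure NP.pure_add_right M_NP.pure_add_right)
    next
      case (add u v)
      then show ?case
        using zw additive_map_closed[OF assoc_inner_additive_map]
        by (simp add: additive_map_add[OF assoc_inner_additive_map] M_NP.T.a_ac)
    qed
  qed
  fix u r z assume h: "u \<in> carrier (tensor R M N)" "r \<in> carrier R" "z \<in> carrier P"
  show "assoc_inner (ract (tensor R M N) u r) z = assoc_inner u (lact P r z)"
    using h(1)
  proof (induction rule: MN.T_induct)
    case (pure x y)
    then show ?case
      using h by (simp add: MN.ract_pure assoc_inner_pure N.ract_closed P.lact_closed NP.pure_balanced)
  next
    case (add u v)
    then show ?case
      using h by (simp add: additive_map_add[OF assoc_inner_additive_map] MN.T.ract_add MN.T.ract_closed P.lact_closed)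
  qed
qed

lemma tensor_assoc_eq: "tensor_assoc R M N P = tensor_lift (tensor R M (tensor R N P)) assoc_inner"
  by (simp add: tensor_assoc_def Let_def assoc_inner_def[abs_def])

lemma tensor_assoc_additive_map:
  "additive_map (tensor R (tensor R M N) P) (tensor R M (tensor R N P)) (tensor_assoc R M N P)"
  unfolding tensor_assoc_eq by (rule MN_P.lift_additive_map[OF M_NP.T_abelian assoc_balanced])

lemma tensor_assoc_pure1:
  "u \<in> carrier (tensor R M N) \<Longrightarrow> z \<in> carrier P \<Longrightarrow>
   tensor_assoc R M N P (pure R (tensor R M N) P u z) = assoc_inner u z"
  unfolding tensor_assoc_eq by (simp add: MN_P.lift_pure[OF M_NP.T_abelian assoc_balanced])

lemma tensor_assoc_pure:
  "\<lbrakk>x \<in> carrier M; y \<in> carrier N; z \<in> carrier P\<rbrakk> \<Longrightarrow>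
   tensor_assoc R M N P (pure R (tensor R M N) P (pure R M N x y) z) = pure R M (tensor R N P) x (pure R N P y z)"
  by (simp add: tensor_assoc_pure1 assoc_inner_pure)

end

section \<open>Linear, bilinear and trilinear maps over the ground ring\<close>

definition lin :: "('k, 'r) ring_scheme \<Rightarrow> ('k, 'm, 'x) module_scheme \<Rightarrow> ('k, 'n, 'y) module_scheme
    \<Rightarrow> ('m \<Rightarrow> 'n) \<Rightarrow> bool" where
  "lin K M N f \<longleftrightarrow> additive_map M N f \<and> (\<forall>c\<in>carrier K. \<forall>x\<in>carrier M. f (c \<odot>\<^bsub>M\<^esub> x) = c \<odot>\<^bsub>N\<^esub> f x)"

definition bilin :: "('k, 'r) ring_scheme \<Rightarrow> ('k, 'l, 'x) module_scheme \<Rightarrow> ('k, 'm, 'y) module_scheme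
    \<Rightarrow> ('k, 'n, 'z) module_scheme \<Rightarrow> ('l \<Rightarrow> 'm \<Rightarrow> 'n) \<Rightarrow> bool" where
  "bilin K A B N f \<longleftrightarrow> (\<forall>y\<in>carrier B. lin K A N (\<lambda>x. f x y)) \<and> (\<forall>x\<in>carrier A. lin K B N (\<lambda>y. f x y))"

definition trilin :: "('k, 'r) ring_scheme \<Rightarrow> ('k, 'a, 'x) module_scheme \<Rightarrow> ('k, 'b, 'y) module_scheme
    \<Rightarrow> ('k, 'c, 'w) module_scheme \<Rightarrow> ('k, 'n, 'z) module_scheme \<Rightarrow> ('a \<Rightarrow> 'b \<Rightarrow> 'c \<Rightarrow> 'n) \<Rightarrow> bool" where
  "trilin K A B C N f \<longleftrightarrow>
     (\<forall>y\<in>carrier B. \<forall>z\<in>carrier C. lin K A N (\<lambda>x. f x y z)) \<and>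
     (\<forall>x\<in>carrier A. \<forall>z\<in>carrier C. lin K B N (\<lambda>y. f x y z)) \<and>
     (\<forall>x\<in>carrier A. \<forall>y\<in>carrier B. lin K C N (\<lambda>z. f x y z))"

text \<open>Each rule removes one operation from the body of an abstraction, so iterating the
  collection together with simplification proves the multilinearity side conditions of the Sweedler
  identities.\<close>

named_theorems lin_intro

lemma linI:
  assumes "\<And>x. x \<in> carrier M \<Longrightarrow> f x \<in> carrier N"
    and "\<And>x y. x \<in> carrier M \<Longrightarrow> y \<in> carrier M \<Longrightarrow> f (x \<oplus>\<^bsub>M\<^esub> y) = f x \<oplus>\<^bsub>N\<^esub> f y"
    and "\<And>c x. c \<in> carrier K \<Longrightarrow> x \<in> carrier M \<Longrightarrow> f (c \<odot>\<^bsub>M\<^esub> x) = c \<odot>\<^bsub>N\<^esub> f x"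
  shows "lin K M N f"
  using assms by (auto simp: lin_def additive_map_def)

lemma linD:
  assumes "lin K M N f"
  shows "\<And>x. x \<in> carrier M \<Longrightarrow> f x \<in> carrier N"
    and "\<And>x y. x \<in> carrier M \<Longrightarrow> y \<in> carrier M \<Longrightarrow> f (x \<oplus>\<^bsub>M\<^esub> y) = f x \<oplus>\<^bsub>N\<^esub> f y"
    and "\<And>c x. c \<in> carrier K \<Longrightarrow> x \<in> carrier M \<Longrightarrow> f (c \<odot>\<^bsub>M\<^esub> x) = c \<odot>\<^bsub>N\<^esub> f x"
    and "additive_map M N f"
  using assms by (auto simp: lin_def additive_map_def)

lemma bilinI [lin_intro]:
  assumes "\<And>y. y \<in> carrier B \<Longrightarrow> lin K A N (\<lambda>x. f x y)"
    and "\<And>x. x \<in> carrier A \<Longrightarrow> lin K B N (\<lambda>y. f x y)"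
  shows "bilin K A B N f"
  using assms by (auto simp: bilin_def)

lemma bilinD:
  assumes "bilin K A B N f"
  shows "\<And>y. y \<in> carrier B \<Longrightarrow> lin K A N (\<lambda>x. f x y)"
    and "\<And>x. x \<in> carrier A \<Longrightarrow> lin K B N (\<lambda>y. f x y)"
    and "\<And>x y. x \<in> carrier A \<Longrightarrow> y \<in> carrier B \<Longrightarrow> f x y \<in> carrier N"
  using assms by (auto simp: bilin_def lin_def additive_map_def)

lemma trilinI [lin_intro]:
  assumes "\<And>y z. y \<in> carrier B \<Longrightarrow> z \<in> carrier C \<Longrightarrow> lin K A N (\<lambda>x. f x y z)"
    and "\<And>x z. x \<in> carrier A \<Longrightarrow> z \<in> carrier C \<Longrightarrow> lin K B N (\<lambda>y. f x y z)"
    and "\<And>x y. x \<in> carrier A \<Longrightarrow> y \<in> carrier B \<Longrightarrow> lin K C N (\<lambda>z. f x y z)"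
  shows "trilin K A B C N f"
  using assms by (auto simp: trilin_def)

lemma trilinD:
  assumes "trilin K A B C N f"
  shows "\<And>y z. y \<in> carrier B \<Longrightarrow> z \<in> carrier C \<Longrightarrow> lin K A N (\<lambda>x. f x y z)"
    and "\<And>x z. x \<in> carrier A \<Longrightarrow> z \<in> carrier C \<Longrightarrow> lin K B N (\<lambda>y. f x y z)"
    and "\<And>x y. x \<in> carrier A \<Longrightarrow> y \<in> carrier B \<Longrightarrow> lin K C N (\<lambda>z. f x y z)"
    and "\<And>x y z. x \<in> carrier A \<Longrightarrow> y \<in> carrier B \<Longrightarrow> z \<in> carrier C \<Longrightarrow> f x y z \<in> carrier N"
    and "\<And>x. x \<in> carrier A \<Longrightarrow> bilin K B C N (f x)"
    and "\<And>z. z \<in> carrier C \<Longrightarrow> bilin K A B N (\<lambda>x y. f x y z)"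
proof -
  note f = assms[unfolded trilin_def]
  show "\<And>y z. y \<in> carrier B \<Longrightarrow> z \<in> carrier C \<Longrightarrow> lin K A N (\<lambda>x. f x y z)"
    and "\<And>x z. x \<in> carrier A \<Longrightarrow> z \<in> carrier C \<Longrightarrow> lin K B N (\<lambda>y. f x y z)"
    and "\<And>x y. x \<in> carrier A \<Longrightarrow> y \<in> carrier B \<Longrightarrow> lin K C N (\<lambda>z. f x y z)"
    using f by blast+
  then show "\<And>x y z. x \<in> carrier A \<Longrightarrow> y \<in> carrier B \<Longrightarrow> z \<in> carrier C \<Longrightarrow> f x y z \<in> carrier N"
    and "\<And>x. x \<in> carrier A \<Longrightarrow> bilin K B C N (f x)"
    and "\<And>z. z \<in> carrier C \<Longrightarrow> bilin K A B N (\<lambda>x y. f x y z)"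
    by (auto intro!: bilinI dest: linD(1))
qed

lemma lin_id [lin_intro]: "lin K M M (\<lambda>x. x)"
  by (rule linI) auto

lemma lin_comp:
  assumes "lin K M N f" "lin K P M t"
  shows "lin K P N (\<lambda>x. f (t x))"
  using assms by (auto simp: lin_def additive_map_def Pi_iff)

lemma lin_cong:
  assumes "module K M" "\<And>x. x \<in> carrier M \<Longrightarrow> f x = g x" "lin K M N g"
  shows "lin K M N f"
proof -
  interpret module K M by fact
  show ?thesis by (rule linI) (auto simp: assms(2) linD[OF assms(3)])
qed

text \<open>\<open>tensor\<close> returns a bimodule record. Reading its left action as scalar
  multiplication turns it into a module record, which is the kind of target that \<open>lin\<close>
  speaks about.\<close>

definition ktensor_module :: "'k ring \<Rightarrow> ('k, 'a, 'x) module_scheme \<Rightarrow> ('k, 'b, 'y) module_scheme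
   \<Rightarrow> ('k, ('a \<times> 'b \<Rightarrow>\<^sub>0 int) set) module" where
  "ktensor_module K A B = \<lparr>carrier = carrier (ktensor K A B), monoid.mult = monoid.mult (ktensor K A B), one = one (ktensor K A B),
     ring.zero = ring.zero (ktensor K A B), add = add (ktensor K A B), smult = lact (ktensor K A B)\<rparr>"

lemma sym_bimodule_sel [simp]:
  "carrier (sym_bimodule A) = carrier A" "monoid.mult (sym_bimodule A) = monoid.mult A"
  "one (sym_bimodule A) = one A" "add (sym_bimodule A) = add A" "ring.zero (sym_bimodule A) = ring.zero A"
  "lact (sym_bimodule A) = smult A" "ract (sym_bimodule A) x c = c \<odot>\<^bsub>A\<^esub> x"
  by (simp_all add: sym_bimodule_def)

lemma abelian_group_cong:
  assumes "abelian_group A" "carrier B = carrier A" "add B = add A" "ring.zero B = ring.zero A"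
  shows "abelian_group B"
proof -
  interpret A: abelian_group A by fact
  show ?thesis
  proof (rule abelian_groupI, unfold assms(2-))
    fix x assume "x \<in> carrier A"
    then show "\<exists>y\<in>carrier A. y \<oplus>\<^bsub>A\<^esub> x = \<zero>\<^bsub>A\<^esub>"
      using A.l_neg A.a_inv_closed by blast
  qed (auto simp: A.a_ac)
qed

lemma bimod_sym:
  assumes "module K A"
  shows "bimod K (sym_bimodule A)"
proof -
  interpret module K A by fact
  interpret s: abelian_group "sym_bimodule A"
    by (rule abelian_group_cong[OF M.abelian_group_axioms]) auto
  show ?thesis
    by unfold_locales
      (simp_all add: smult_r_distr smult_assoc1[symmetric] R.m_comm)
qed

text \<open>\<open>Z\<close> is any module record carried by \<open>A \<otimes> B\<close>: the multiplicative fields are left open because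
  the smash product puts a second algebra structure on \<open>L \<otimes> H\<close>.\<close>

locale ktensor_pair = A: module K A + B: module K B
  for K :: "'k ring" and A :: "('k, 'a, 'x) module_scheme" and B :: "('k, 'b, 'y) module_scheme" +
  fixes Z :: "('k, ('a \<times> 'b \<Rightarrow>\<^sub>0 int) set, 'z) module_scheme"
  assumes Z_sel: "carrier Z = carrier (ktensor K A B)" "add Z = add (ktensor K A B)"
    "ring.zero Z = ring.zero (ktensor K A B)" "smult Z = lact (ktensor K A B)"
begin

sublocale P: tensor_pair K "sym_bimodule A" "sym_bimodule B"
  by (simp add: tensor_pair_def bimod_sym A.module_axioms B.module_axioms)

lemma lift_target: "tensor_lift (ktensor K A B) = tensor_lift Z"
  by (rule tensor_lift_cong_target) (auto simp: Z_sel)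

lemma additive_map_T: "additive_map M (ktensor K A B) f = additive_map M Z f"
  and additive_map_T': "additive_map (ktensor K A B) M' f' = additive_map Z M' f'"
  by (simp_all add: additive_map_def Z_sel)

lemma Z_abelian: "abelian_group Z"
  by (rule abelian_group_cong[OF P.T_abelian]) (auto simp: Z_sel)

lemma pure_in [simp, intro]: "x \<in> carrier A \<Longrightarrow> y \<in> carrier B \<Longrightarrow> kpure K A B x y \<in> carrier Z"
  using P.pure_closed by (simp add: Z_sel)

lemma smult_pure_left: "\<lbrakk>c \<in> carrier K; x \<in> carrier A; y \<in> carrier B\<rbrakk>
    \<Longrightarrow> kpure K A B (c \<odot>\<^bsub>A\<^esub> x) y = c \<odot>\<^bsub>Z\<^esub> kpure K A B x y"
  using P.lact_pure by (simp add: Z_sel)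

lemma smult_pure_right: "\<lbrakk>c \<in> carrier K; x \<in> carrier A; y \<in> carrier B\<rbrakk>
    \<Longrightarrow> kpure K A B x (c \<odot>\<^bsub>B\<^esub> y) = c \<odot>\<^bsub>Z\<^esub> kpure K A B x y"
  using P.lact_pure P.pure_balanced by (simp add: Z_sel)

lemma smult_additive_map: "c \<in> carrier K \<Longrightarrow> additive_map Z Z (smult Z c)"
  using P.lact_T_additive_map by (simp add: Z_sel(4) additive_map_T additive_map_T')

lemma Z_induct [consumes 1, case_names pure add]:
  assumes "z \<in> carrier Z"
    and "\<And>x y. x \<in> carrier A \<Longrightarrow> y \<in> carrier B \<Longrightarrow> P (kpure K A B x y)"
    and "\<And>z w. z \<in> carrier Z \<Longrightarrow> w \<in> carrier Z \<Longrightarrow> P z \<Longrightarrow> P w \<Longrightarrow> P (z \<oplus>\<^bsub>Z\<^esub> w)"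
  shows "P z"
  using P.T_induct[of z P] assms by (simp add: Z_sel)

lemma pure_add_l: "\<lbrakk>x \<in> carrier A; x' \<in> carrier A; y \<in> carrier B\<rbrakk>
    \<Longrightarrow> kpure K A B (x \<oplus>\<^bsub>A\<^esub> x') y = kpure K A B x y \<oplus>\<^bsub>Z\<^esub> kpure K A B x' y"
  using P.pure_add_left by (simp add: Z_sel)

lemma pure_add_r: "\<lbrakk>x \<in> carrier A; y \<in> carrier B; y' \<in> carrier B\<rbrakk>
    \<Longrightarrow> kpure K A B x (y \<oplus>\<^bsub>B\<^esub> y') = kpure K A B x y \<oplus>\<^bsub>Z\<^esub> kpure K A B x y'"
  using P.pure_add_right by (simp add: Z_sel)

lemma Z_module: "module K Z"
proof (rule moduleI)
  interpret Z: abelian_group Z by (rule Z_abelian)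
  note cl = additive_map_closed[OF smult_additive_map]
  note ad = additive_map_add[OF smult_additive_map]
  show "cring K" by (rule A.R.cring_axioms)
  show "abelian_group Z" by (rule Z_abelian)
  show "\<one>\<^bsub>K\<^esub> \<odot>\<^bsub>Z\<^esub> x = x" if x: "x \<in> carrier Z" for x
    using x by (induction rule: Z_induct) (simp_all add: smult_pure_left[symmetric] ad)
  fix a x assume a: "a \<in> carrier K" and x: "x \<in> carrier Z"
  show "a \<odot>\<^bsub>Z\<^esub> x \<in> carrier Z" using a x by (rule cl)
  fix b assume b: "b \<in> carrier K"
  show "(a \<oplus>\<^bsub>K\<^esub> b) \<odot>\<^bsub>Z\<^esub> x = a \<odot>\<^bsub>Z\<^esub> x \<oplus>\<^bsub>Z\<^esub> b \<odot>\<^bsub>Z\<^esub> x"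
    using x
    by (induction rule: Z_induct)
      (use a b in \<open>simp_all add: smult_pure_left[symmetric] ad cl A.smult_l_distr pure_add_l Z.a_ac\<close>)
  show "(a \<otimes>\<^bsub>K\<^esub> b) \<odot>\<^bsub>Z\<^esub> x = a \<odot>\<^bsub>Z\<^esub> (b \<odot>\<^bsub>Z\<^esub> x)"
    using x
    by (induction rule: Z_induct)
      (use a b in \<open>simp_all add: smult_pure_left[symmetric] ad cl A.smult_assoc1\<close>)
next
  fix a x y assume "a \<in> carrier K" "x \<in> carrier Z" "y \<in> carrier Z"
  then show "a \<odot>\<^bsub>Z\<^esub> (x \<oplus>\<^bsub>Z\<^esub> y) = a \<odot>\<^bsub>Z\<^esub> x \<oplus>\<^bsub>Z\<^esub> a \<odot>\<^bsub>Z\<^esub> y"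
    by (rule additive_map_add[OF smult_additive_map])
qed

sublocale Z: module K Z by (rule Z_module)

lemma lin_pure1: "y \<in> carrier B \<Longrightarrow> lin K A Z (\<lambda>x. kpure K A B x y)"
  by (rule linI) (auto simp: pure_add_l smult_pure_left)

lemma lin_pure2: "x \<in> carrier A \<Longrightarrow> lin K B Z (\<lambda>y. kpure K A B x y)"
  by (rule linI) (auto simp: pure_add_r smult_pure_right)

lemma lin_pure_left [lin_intro]:
  "lin K M A t \<Longrightarrow> y \<in> carrier B \<Longrightarrow> lin K M Z (\<lambda>x. kpure K A B (t x) y)"
  by (rule lin_comp[OF lin_pure1])

lemma lin_pure_right [lin_intro]:
  "lin K M B t \<Longrightarrow> x \<in> carrier A \<Longrightarrow> lin K M Z (\<lambda>y. kpure K A B x (t y))"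
  by (rule lin_comp[OF lin_pure2])

lemma bilin_balanced:
  assumes "bilin K A B N f"
  shows "balanced K (sym_bimodule A) (sym_bimodule B) N f"
  by (rule balancedI) (use bilinD[OF assms] in \<open>auto simp: additive_map_def lin_def\<close>)

lemma lift_pure:
  "\<lbrakk>module K N; bilin K A B N f; x \<in> carrier A; y \<in> carrier B\<rbrakk> \<Longrightarrow> tensor_lift N f (kpure K A B x y) = f x y"
  using P.lift_pure[OF module.axioms(2) bilin_balanced] by simp

lemma lift_additive_map: "\<lbrakk>module K N; bilin K A B N f\<rbrakk> \<Longrightarrow> additive_map Z N (tensor_lift N f)"
  using P.lift_additive_map[OF module.axioms(2) bilin_balanced] by (simp add: additive_map_T')

lemma lift_lin:
  assumes "module K N" "bilin K A B N f"
  shows "lin K Z N (tensor_lift N f)"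
proof (rule linI)
  interpret N: module K N by fact
  note ad = lift_additive_map[OF assms]
  show "tensor_lift N f (c \<odot>\<^bsub>Z\<^esub> x) = c \<odot>\<^bsub>N\<^esub> tensor_lift N f x" if "c \<in> carrier K" "x \<in> carrier Z" for c x
    using that(2)
  proof (induction rule: Z_induct)
    case (pure x y)
    have "tensor_lift N f (c \<odot>\<^bsub>Z\<^esub> kpure K A B x y) = tensor_lift N f (kpure K A B (c \<odot>\<^bsub>A\<^esub> x) y)"
      using pure that(1) by (simp add: smult_pure_left)
    also have "\<dots> = c \<odot>\<^bsub>N\<^esub> f x y"
      using pure that(1) linD(3)[OF bilinD(1)[OF assms(2)]] by (simp add: lift_pure[OF assms])
    finally show ?case
      using pure by (simp add: lift_pure[OF assms])
  next
    case (add z w)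
    then show ?case
      using that(1) additive_map_closed[OF ad]
      by (simp add: Z.smult_r_distr N.smult_r_distr additive_map_add[OF ad])
  qed
qed (use additive_map_add[OF lift_additive_map[OF assms]] additive_map_closed[OF lift_additive_map[OF assms]] in auto)

lemma lin_eqI:
  assumes "lin K Z N f" "lin K Z N g"
    and "\<And>x y. x \<in> carrier A \<Longrightarrow> y \<in> carrier B \<Longrightarrow> f (kpure K A B x y) = g (kpure K A B x y)"
    and "z \<in> carrier Z"
  shows "f z = g z"
  using assms(4)
  by (induction rule: Z_induct) (auto simp: assms(3) linD(2)[OF assms(1)] linD(2)[OF assms(2)])

text \<open>The right factor gives the outer sum because \<open>tensor\<close> defines the product
  as a lift over \<open>w\<close> whose body, \<open>tensor_rmult\<close>, is a lift over
  \<open>z\<close>.\<close>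

lemma lift_mult:
  assumes "module K N" "bilin K A B N f" "z \<in> carrier Z" "w \<in> carrier Z"
    and "\<And>a c. a \<in> carrier A \<Longrightarrow> c \<in> carrier A \<Longrightarrow> a \<otimes>\<^bsub>A\<^esub> c \<in> carrier A"
    and "\<And>a c. a \<in> carrier B \<Longrightarrow> c \<in> carrier B \<Longrightarrow> a \<otimes>\<^bsub>B\<^esub> c \<in> carrier B"
  shows "tensor_lift N f (z \<otimes>\<^bsub>ktensor K A B\<^esub> w) =
    tensor_lift N (\<lambda>c d. tensor_lift N (\<lambda>a b. f (a \<otimes>\<^bsub>A\<^esub> c) (b \<otimes>\<^bsub>B\<^esub> d)) z) w"
proof -
  interpret N: module K N by fact
  let ?T = "ktensor K A B"
  let ?r = "\<lambda>c d. tensor_lift ?T (\<lambda>a b. kpure K A B (a \<otimes>\<^bsub>A\<^esub> c) (b \<otimes>\<^bsub>B\<^esub> d)) z"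
  have z: "z \<in> carrier ?T" "w \<in> carrier ?T" using assms(3,4) by (simp_all add: Z_sel)
  have eq: "tensor_lift (tensor_group K (sym_bimodule A) (sym_bimodule B)) = tensor_lift ?T"
    by (rule tensor_lift_cong_target[OF P.T_group_sel])
  have "z \<otimes>\<^bsub>?T\<^esub> w = tensor_lift (tensor_group K (sym_bimodule A) (sym_bimodule B))
      (tensor_rmult K (sym_bimodule A) (sym_bimodule B) z) w"
    by (simp add: tensor_def Let_def)
  also have "\<dots> = tensor_lift ?T ?r w"
    unfolding eq tensor_rmult_def by simp
  finally have m: "z \<otimes>\<^bsub>?T\<^esub> w = tensor_lift ?T ?r w" .
  have ad: "additive_map ?T N (tensor_lift N f)"
    using lift_additive_map[OF assms(1,2)] by (simp add: additive_map_T')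
  have r: "?r c d \<in> carrier ?T" if "c \<in> carrier A" "d \<in> carrier B" for c d
    using that assms(5,6) by (intro P.lift_closed[OF z(1) P.T_abelian] P.pure_closed) auto
  have "tensor_lift N f (?r c d) = tensor_lift N (\<lambda>a b. f (a \<otimes>\<^bsub>A\<^esub> c) (b \<otimes>\<^bsub>B\<^esub> d)) z"
    if "c \<in> carrier A" "d \<in> carrier B" for c d
    by (subst P.lift_hom[OF z(1) P.T_abelian N.M.abelian_group_axioms ad],
        use that assms(5,6) in force, rule P.lift_cong_strong[OF z(1)])
      (use that assms(5,6) in \<open>simp add: lift_pure[OF assms(1,2)]\<close>)
  then show ?thesis
    unfolding m
    by (subst P.lift_hom[OF z(2) P.T_abelian N.M.abelian_group_axioms ad])
      (auto intro!: r P.lift_cong_strong[OF z(2)])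
qed

end

lemma ktensor_pair_ktensor_module:
  assumes "module K A" "module K B"
  shows "ktensor_pair K A B (ktensor_module K A B)"
  using assms by (simp add: ktensor_pair_def ktensor_pair_axioms_def ktensor_module_def)

lemma bimodule_hom_lin:
  assumes "f \<in> bimodule_hom K (sym_bimodule A) (ktensor K B C)" "module K B" "module K C"
  shows "lin K A (ktensor_module K B C) f"
  using assms(1)
  by (auto simp: bimodule_hom_def intro!: linI simp: ktensor_module_def)

text \<open>Stated for five modules so that it covers both coassociativity of the comultiplication,
  with all of them equal to \<open>H\<close>, and that of the coaction, with \<open>C\<close> and
  \<open>Q\<close> equal to \<open>L\<close>. The two tensors \<open>z\<close> and \<open>z'\<close>
  have different types in general and coincide in both uses.\<close>

lemma coassoc_lift:
  fixes K :: "'k ring"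
  assumes mods: "module K A" "module K B" "module K C" "module K P" "module K Q" "module K N"
    and D1: "lin K P (ktensor_module K A B) D1" and D2: "lin K Q (ktensor_module K B C) D2"
    and z: "z \<in> carrier (ktensor K P C)" and z': "z' \<in> carrier (ktensor K A Q)"
    and eq: "tensor_assoc K (sym_bimodule A) (sym_bimodule B) (sym_bimodule C)
        (tensor_map K (ktensor K A B) (sym_bimodule C) D1 id z) =
      tensor_map K (sym_bimodule A) (ktensor K B C) id D2 z'"
    and f: "trilin K A B C N f"
  shows "tensor_lift N (\<lambda>p c. tensor_lift N (\<lambda>a b. f a b c) (D1 p)) z =
    tensor_lift N (\<lambda>a q. tensor_lift N (f a) (D2 q)) z'"
proof -
  interpret N: module K N by fact
  interpret AB: ktensor_pair K A B "ktensor_module K A B" by (rule ktensor_pair_ktensor_module[OF mods(1,2)])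
  interpret BC: ktensor_pair K B C "ktensor_module K B C" by (rule ktensor_pair_ktensor_module[OF mods(2,3)])
  interpret PC: ktensor_pair K P C "ktensor_module K P C" by (rule ktensor_pair_ktensor_module[OF mods(4,3)])
  interpret AQ: ktensor_pair K A Q "ktensor_module K A Q" by (rule ktensor_pair_ktensor_module[OF mods(1,5)])
  interpret t: tensor_triple K "sym_bimodule A" "sym_bimodule B" "sym_bimodule C"
    by (simp add: tensor_triple_def bimod_sym mods)
  let ?T3 = "tensor K (sym_bimodule A) (ktensor K B C)"
  \<comment> \<open>The additive map on the threefold tensor product induced by \<open>f\<close>.
    Applying it to both sides of \<open>eq\<close> turns the equation of tensors into the equation
    of iterated sums.\<close>
  let ?\<Phi> = "tensor_lift N (\<lambda>a w. tensor_lift N (f a) w)"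
  have ab: "abelian_group N" by (rule N.M.abelian_group_axioms)
  have linA: "additive_map (sym_bimodule A) N (\<lambda>a. tensor_lift N (f a) w)" if w: "w \<in> carrier (ktensor K B C)" for w
  proof (rule additive_mapI)
    fix x y assume xy: "x \<in> carrier (sym_bimodule A)" "y \<in> carrier (sym_bimodule A)"
    have "tensor_lift N (f (x \<oplus>\<^bsub>sym_bimodule A\<^esub> y)) w = tensor_lift N (\<lambda>b c. f x b c \<oplus>\<^bsub>N\<^esub> f y b c) w"
      by (rule BC.P.lift_cong_strong[OF w]) (use xy linD(2)[OF trilinD(1)[OF f]] in auto)
    also have "\<dots> = tensor_lift N (f x) w \<oplus>\<^bsub>N\<^esub> tensor_lift N (f y) w"
      by (rule BC.P.lift_add_fun[OF w ab]) (use xy trilinD(4)[OF f] in auto)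
    finally show "tensor_lift N (f (x \<oplus>\<^bsub>sym_bimodule A\<^esub> y)) w = tensor_lift N (f x) w \<oplus>\<^bsub>N\<^esub> tensor_lift N (f y) w" .
  qed (use BC.P.lift_closed[OF w ab] trilinD(4)[OF f] in auto)
  have bal: "balanced K (sym_bimodule A) (ktensor K B C) N (\<lambda>a w. tensor_lift N (f a) w)"
  proof (rule balancedI)
    show "additive_map (ktensor K B C) N (tensor_lift N (f x))" if "x \<in> carrier (sym_bimodule A)" for x
      using BC.lift_additive_map[OF mods(6) trilinD(5)[OF f]] that by (simp add: BC.additive_map_T')
    show "tensor_lift N (f (ract (sym_bimodule A) x r)) w = tensor_lift N (f x) (lact (ktensor K B C) r w)"
      if h: "x \<in> carrier (sym_bimodule A)" "r \<in> carrier K" "w \<in> carrier (ktensor K B C)" for x r w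
    proof -
      have "tensor_lift N (f (ract (sym_bimodule A) x r)) w = tensor_lift N (\<lambda>b c. r \<odot>\<^bsub>N\<^esub> f x b c) w"
        by (rule BC.P.lift_cong_strong[OF h(3)]) (use h linD(3)[OF trilinD(1)[OF f]] in auto)
      also have "\<dots> = r \<odot>\<^bsub>N\<^esub> tensor_lift N (f x) w"
        by (rule BC.P.lift_hom[OF h(3) ab ab, symmetric])
          (use h trilinD(4)[OF f] in \<open>auto intro!: additive_mapI simp: N.smult_r_distr\<close>)
      also have "\<dots> = tensor_lift N (f x) (lact (ktensor K B C) r w)"
        using linD(3)[OF BC.lift_lin[OF mods(6) trilinD(5)[OF f]]] h by (simp add: ktensor_module_def)
      finally show ?thesis .
    qed
  qed (rule linA)
  have Phi: "additive_map ?T3 N ?\<Phi>"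
    by (rule t.M_NP.lift_additive_map[OF ab bal])
  have Phi_pure: "?\<Phi> (pure K (sym_bimodule A) (ktensor K B C) a w) = tensor_lift N (f a) w"
    if "a \<in> carrier A" "w \<in> carrier (ktensor K B C)" for a w
    using t.M_NP.lift_pure[OF ab bal, of a w] that by simp
  have T3ab: "abelian_group ?T3" by (rule t.M_NP.T_abelian)
  have D1c: "D1 p \<in> carrier (ktensor K A B)" if "p \<in> carrier P" for p
    using linD(1)[OF D1 that] by (simp add: ktensor_module_def)
  have D2c: "D2 q \<in> carrier (ktensor K B C)" if "q \<in> carrier Q" for q
    using linD(1)[OF D2 that] by (simp add: ktensor_module_def)
  have "?\<Phi> (tensor_map K (sym_bimodule A) (ktensor K B C) id D2 z') =
     tensor_lift N (\<lambda>a q. tensor_lift N (f a) (D2 q)) z'"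
    unfolding tensor_map_def
    by (subst AQ.P.lift_hom[OF z' T3ab ab Phi])
      (auto intro!: t.M_NP.pure_closed D2c AQ.P.lift_cong_strong[OF z'] Phi_pure)
  moreover have "?\<Phi> (tensor_assoc K (sym_bimodule A) (sym_bimodule B) (sym_bimodule C)
        (tensor_map K (ktensor K A B) (sym_bimodule C) D1 id z)) =
     tensor_lift N (\<lambda>p c. tensor_lift N (\<lambda>a b. f a b c) (D1 p)) z"
  proof -
    have "tensor_assoc K (sym_bimodule A) (sym_bimodule B) (sym_bimodule C)
        (tensor_map K (ktensor K A B) (sym_bimodule C) D1 id z) =
       tensor_lift ?T3 (\<lambda>p c. t.assoc_inner (D1 p) c) z"
      unfolding tensor_map_def
      by (subst PC.P.lift_hom[OF z t.MN_P.T_abelian T3ab t.tensor_assoc_additive_map])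
        (auto intro!: t.MN_P.pure_closed D1c PC.P.lift_cong_strong[OF z] t.tensor_assoc_pure1)
    moreover have "?\<Phi> (tensor_lift ?T3 (\<lambda>p c. t.assoc_inner (D1 p) c) z) =
       tensor_lift N (\<lambda>p c. tensor_lift N (\<lambda>a b. f a b c) (D1 p)) z"
    proof (subst PC.P.lift_hom[OF z T3ab ab Phi])
      show "t.assoc_inner (D1 p) c \<in> carrier ?T3"
        if "p \<in> carrier (sym_bimodule P)" "c \<in> carrier (sym_bimodule C)" for p c
        using that by (intro additive_map_closed[OF t.assoc_inner_additive_map] D1c) auto
      show "tensor_lift N (\<lambda>p c. ?\<Phi> (t.assoc_inner (D1 p) c)) z =
        tensor_lift N (\<lambda>p c. tensor_lift N (\<lambda>a b. f a b c) (D1 p)) z"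
      proof (rule PC.P.lift_cong_strong[OF z])
        fix p c assume pc: "p \<in> carrier (sym_bimodule P)" "c \<in> carrier (sym_bimodule C)"
        then have p: "D1 p \<in> carrier (ktensor K A B)" by (auto intro: D1c)
        show "?\<Phi> (t.assoc_inner (D1 p) c) = tensor_lift N (\<lambda>a b. f a b c) (D1 p)"
          unfolding t.assoc_inner_def
          by (subst AB.P.lift_hom[OF p T3ab ab Phi])
            (use pc in \<open>auto intro!: t.M_NP.pure_closed BC.P.pure_closed AB.P.lift_cong_strong[OF p]
               simp: Phi_pure BC.lift_pure[OF mods(6) trilinD(5)[OF f]]\<close>)
      qed
    qed
    ultimately show ?thesis by simp
  qed
  ultimately show ?thesis using eq by simp
qed

section \<open>Sweedler calculus in a Hopf algebra\<close>

text \<open>The value outside the carrier is zero, so that linear maps and further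
  sums can be moved across without a hypothesis on the summed element.\<close>

definition comul_lift :: "('k, 'h, 'x) hopf_scheme \<Rightarrow> ('a, 'w) ring_scheme \<Rightarrow> 'h \<Rightarrow> ('h \<Rightarrow> 'h \<Rightarrow> 'a) \<Rightarrow> 'a" where
  "comul_lift H A h f = (if h \<in> carrier H then tensor_lift A f (comul H h) else \<zero>\<^bsub>A\<^esub>)"

lemma (in module) lin_smult [lin_intro]:
  "lin R N M t \<Longrightarrow> c \<in> carrier R \<Longrightarrow> lin R N M (\<lambda>x. c \<odot>\<^bsub>M\<^esub> t x)"
  by (rule linI) (auto simp: linD smult_r_distr smult_assoc1[symmetric] R.m_comm)

context assoc_algebra
begin

lemma lin_mult1: "y \<in> carrier A \<Longrightarrow> lin K A A (\<lambda>x. x \<otimes> y)"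
  by (rule linI) (auto simp: l_distr smult_mult_left)

lemma lin_mult2: "x \<in> carrier A \<Longrightarrow> lin K A A (\<lambda>y. x \<otimes> y)"
  by (rule linI) (auto simp: r_distr smult_mult_right)

lemma lin_mult_left [lin_intro]: "lin K N A t \<Longrightarrow> y \<in> carrier A \<Longrightarrow> lin K N A (\<lambda>x. t x \<otimes> y)"
  by (rule lin_comp[OF lin_mult1])

lemma lin_mult_right [lin_intro]: "lin K N A t \<Longrightarrow> x \<in> carrier A \<Longrightarrow> lin K N A (\<lambda>y. x \<otimes> t y)"
  by (rule lin_comp[OF lin_mult2])

end

context hopf_algebra
begin

sublocale HH: ktensor_pair K H H "ktensor_module K H H"
  by (rule ktensor_pair_ktensor_module) (rule module_axioms)+

abbreviation "\<Delta> \<equiv> comul_lift H"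
abbreviation "\<epsilon> \<equiv> counit H"
abbreviation "\<gamma> \<equiv> antipode H"

lemma module_H [simp]: "module K H" by (rule module_axioms)
lemma module_HH [simp]: "module K (ktensor_module K H H)" by (rule HH.Z_module)

lemma comul_lin: "lin K H (ktensor_module K H H) (comul H)"
  by (rule bimodule_hom_lin[OF comul_linear]) simp_all

lemma comul_in: "h \<in> carrier H \<Longrightarrow> comul H h \<in> carrier (ktensor K H H)"
  using linD(1)[OF comul_lin] by (simp add: HH.Z_sel)

lemma counit_closed [simp]: "h \<in> carrier H \<Longrightarrow> \<epsilon> h \<in> carrier K"
  and counit_add: "h \<in> carrier H \<Longrightarrow> g \<in> carrier H \<Longrightarrow> \<epsilon> (h \<oplus> g) = \<epsilon> h \<oplus>\<^bsub>K\<^esub> \<epsilon> g"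
  and counit_smult: "c \<in> carrier K \<Longrightarrow> h \<in> carrier H \<Longrightarrow> \<epsilon> (c \<odot> h) = c \<otimes>\<^bsub>K\<^esub> \<epsilon> h"
  using counit_linear by (auto simp: bimodule_hom_def regular_bimodule_def)

lemma counit_mult: "h \<in> carrier H \<Longrightarrow> g \<in> carrier H \<Longrightarrow> \<epsilon> (h \<otimes> g) = \<epsilon> h \<otimes>\<^bsub>K\<^esub> \<epsilon> g"
  and counit_one: "\<epsilon> \<one> = \<one>\<^bsub>K\<^esub>"
  using counit_ring_hom by (auto simp: ring_hom_def)

lemma lin_antipode1: "lin K H H \<gamma>"
  using antipode_linear by (auto simp: bimodule_hom_def lin_def additive_map_def)

lemma antipode_closed [simp]: "h \<in> carrier H \<Longrightarrow> \<gamma> h \<in> carrier H"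
  by (rule linD(1)[OF lin_antipode1])

lemma lin_antipode [lin_intro]: "lin K N H t \<Longrightarrow> lin K N H (\<lambda>x. \<gamma> (t x))"
  by (rule lin_comp[OF lin_antipode1])

lemma lin_counit1: "module K N \<Longrightarrow> n \<in> carrier N \<Longrightarrow> lin K H N (\<lambda>x. \<epsilon> x \<odot>\<^bsub>N\<^esub> n)"
proof -
  assume "module K N" and n: "n \<in> carrier N"
  then interpret N: module K N by simp
  show ?thesis
    by (rule linI) (auto simp: n counit_add counit_smult N.smult_l_distr N.smult_assoc1)
qed

lemma lin_counit [lin_intro]:
  "lin K M H t \<Longrightarrow> n \<in> carrier N \<Longrightarrow> module K N \<Longrightarrow> lin K M N (\<lambda>x. \<epsilon> (t x) \<odot>\<^bsub>N\<^esub> n)"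
  by (rule lin_comp[OF lin_counit1])

lemma comul_lift_cong:
  assumes "\<And>x y. x \<in> carrier H \<Longrightarrow> y \<in> carrier H \<Longrightarrow> f x y = g x y"
  shows "\<Delta> A h f = \<Delta> A h g"
  unfolding comul_lift_def using HH.P.lift_cong_strong[OF comul_in, of h f g A] assms by simp

text \<open>As a congruence rule it tells the simplifier, inside a Sweedler sum, that both
  components lie in the carrier.\<close>

lemma comul_lift_cong_simp [cong]:
  "\<lbrakk>h = h'; \<And>x y. x \<in> carrier H \<Longrightarrow> y \<in> carrier H \<Longrightarrow> f x y = g x y\<rbrakk> \<Longrightarrow> \<Delta> A h f = \<Delta> A h' g"
  by (hypsubst, rule comul_lift_cong)

context
  fixes N :: "('k, 'n, 'z) module_scheme"
  assumes N: "module K N"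
begin

interpretation N: module K N by (rule N)

lemma comul_lift_closed [simp, intro]:
  "(\<And>x y. x \<in> carrier H \<Longrightarrow> y \<in> carrier H \<Longrightarrow> f x y \<in> carrier N) \<Longrightarrow> \<Delta> N h f \<in> carrier N"
  unfolding comul_lift_def using HH.P.lift_closed[OF comul_in N.M.abelian_group_axioms, of h f] by simp

lemma comul_lift_hom:
  assumes "lin K N B \<phi>" "module K B"
    and "\<And>x y. x \<in> carrier H \<Longrightarrow> y \<in> carrier H \<Longrightarrow> f x y \<in> carrier N"
  shows "\<phi> (\<Delta> N h f) = \<Delta> B h (\<lambda>x y. \<phi> (f x y))"
proof -
  interpret B: module K B by fact
  show ?thesis
    unfolding comul_lift_def
    using HH.P.lift_hom[OF comul_in N.M.abelian_group_axioms B.M.abelian_group_axioms linD(4)[OF assms(1)], of h f]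
      additive_map_zero[OF N.M.abelian_group_axioms B.M.abelian_group_axioms linD(4)[OF assms(1)]] assms(3)
    by simp
qed

lemma comul_lift_smult:
  assumes "\<And>x y. x \<in> carrier H \<Longrightarrow> y \<in> carrier H \<Longrightarrow> f x y \<in> carrier N" "c \<in> carrier K"
  shows "c \<odot>\<^bsub>N\<^esub> \<Delta> N h f = \<Delta> N h (\<lambda>x y. c \<odot>\<^bsub>N\<^esub> f x y)"
  by (rule comul_lift_hom[OF N.lin_smult[OF lin_id assms(2)] N assms(1)])

lemma lin_comul_lift_body [lin_intro]:
  assumes "\<And>a b. a \<in> carrier H \<Longrightarrow> b \<in> carrier H \<Longrightarrow> lin K M N (\<lambda>x. f x a b)"
  shows "lin K M N (\<lambda>x. \<Delta> N h (\<lambda>a b. f x a b))"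
proof (rule linI)
  fix x y assume xy: "x \<in> carrier M" "y \<in> carrier M"
  have "\<Delta> N h (f (x \<oplus>\<^bsub>M\<^esub> y)) = \<Delta> N h (\<lambda>a b. f x a b \<oplus>\<^bsub>N\<^esub> f y a b)"
    using linD(2)[OF assms] xy by (intro comul_lift_cong) auto
  also have "\<dots> = \<Delta> N h (f x) \<oplus>\<^bsub>N\<^esub> \<Delta> N h (f y)"
    unfolding comul_lift_def
    using HH.P.lift_add_fun[OF comul_in N.M.abelian_group_axioms, of h "f x" "f y"] linD(1)[OF assms] xy
    by simp
  finally show "\<Delta> N h (f (x \<oplus>\<^bsub>M\<^esub> y)) = \<Delta> N h (f x) \<oplus>\<^bsub>N\<^esub> \<Delta> N h (f y)" .
next
  fix c x assume cx: "c \<in> carrier K" "x \<in> carrier M"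
  have "\<Delta> N h (f (c \<odot>\<^bsub>M\<^esub> x)) = \<Delta> N h (\<lambda>a b. c \<odot>\<^bsub>N\<^esub> f x a b)"
    using linD(3)[OF assms] cx by (intro comul_lift_cong) auto
  then show "\<Delta> N h (f (c \<odot>\<^bsub>M\<^esub> x)) = c \<odot>\<^bsub>N\<^esub> \<Delta> N h (f x)"
    using comul_lift_smult[of "f x" c h] cx linD(1)[OF assms] by simp
qed (use linD(1)[OF assms] in auto)

lemma lin_comul_lift_arg1: "bilin K H H N f \<Longrightarrow> lin K H N (\<lambda>h. \<Delta> N h f)"
proof -
  assume f: "bilin K H H N f"
  have "lin K H N (\<lambda>h. tensor_lift N f (comul H h))"
    by (rule lin_comp[OF HH.lift_lin[OF N f] comul_lin])
  then show ?thesis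
    by (auto simp: lin_def additive_map_def comul_lift_def)
qed

lemma lin_comul_lift_arg [lin_intro]:
  "lin K M H t \<Longrightarrow> bilin K H H N f \<Longrightarrow> lin K M N (\<lambda>x. \<Delta> N (t x) f)"
  by (rule lin_comp[OF lin_comul_lift_arg1])

lemma comul_lift_fubini:
  assumes "\<And>x y u v. \<lbrakk>x \<in> carrier H; y \<in> carrier H; u \<in> carrier H; v \<in> carrier H\<rbrakk> \<Longrightarrow> f x y u v \<in> carrier N"
  shows "\<Delta> N g (\<lambda>x y. \<Delta> N h (\<lambda>u v. f x y u v)) = \<Delta> N h (\<lambda>u v. \<Delta> N g (\<lambda>x y. f x y u v))"
  unfolding comul_lift_def
  using HH.P.lift_fubini[OF HH.P.tensor_pair_axioms N.M.abelian_group_axioms comul_in comul_in, of g h f] assms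
    HH.P.lift_zero_fun[OF comul_in N.M.abelian_group_axioms]
  by simp

lemma comul_lift_mult:
  assumes "bilin K H H N f" "g \<in> carrier H" "h \<in> carrier H"
  shows "\<Delta> N (g \<otimes> h) f = \<Delta> N g (\<lambda>g1 g2. \<Delta> N h (\<lambda>h1 h2. f (g1 \<otimes> h1) (g2 \<otimes> h2)))"
proof -
  have c: "comul H g \<in> carrier (ktensor_module K H H)" "comul H h \<in> carrier (ktensor_module K H H)"
    using linD(1)[OF comul_lin] assms(2,3) by auto
  have "comul H (g \<otimes> h) = comul H g \<otimes>\<^bsub>ktensor K H H\<^esub> comul H h"
    using comul_ring_hom assms by (auto simp: ring_hom_def)
  then have "\<Delta> N (g \<otimes> h) f = \<Delta> N h (\<lambda>h1 h2. \<Delta> N g (\<lambda>g1 g2. f (g1 \<otimes> h1) (g2 \<otimes> h2)))"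
    using assms by (simp add: comul_lift_def HH.lift_mult[OF N assms(1) c])
  also have "\<dots> = \<Delta> N g (\<lambda>g1 g2. \<Delta> N h (\<lambda>h1 h2. f (g1 \<otimes> h1) (g2 \<otimes> h2)))"
    by (rule comul_lift_fubini) (auto intro!: bilinD(3)[OF assms(1)])
  finally show ?thesis .
qed

lemma comul_lift_one:
  assumes "bilin K H H N f"
  shows "\<Delta> N \<one> f = f \<one> \<one>"
proof -
  have "comul H \<one> = kpure K H H \<one> \<one>"
    using comul_ring_hom by (auto simp: ring_hom_def tensor_def Let_def)
  then show ?thesis by (simp add: comul_lift_def HH.lift_pure[OF N assms])
qed

lemma comul_lift_coassoc:
  assumes "trilin K H H H N f"
  shows "\<Delta> N h (\<lambda>x y. \<Delta> N x (\<lambda>u v. f u v y)) = \<Delta> N h (\<lambda>x y. \<Delta> N y (\<lambda>u v. f x u v))"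
proof (cases "h \<in> carrier H")
  case True
  have "\<Delta> N h (\<lambda>x y. \<Delta> N x (\<lambda>u v. f u v y)) =
      tensor_lift N (\<lambda>p c. tensor_lift N (\<lambda>a b. f a b c) (comul H p)) (comul H h)"
    using True HH.P.lift_cong_strong[OF comul_in] by (simp add: comul_lift_def cong: HH.P.lift_cong_strong[OF comul_in])
  also have "\<dots> = tensor_lift N (\<lambda>a q. tensor_lift N (f a) (comul H q)) (comul H h)"
    by (rule coassoc_lift[OF module_H module_H module_H module_H module_H N comul_lin comul_lin
        comul_in[OF True] comul_in[OF True] coassoc[OF True] assms])
  also have "\<dots> = \<Delta> N h (\<lambda>x y. \<Delta> N y (\<lambda>u v. f x u v))"
    using True HH.P.lift_cong_strong[OF comul_in] by (simp add: comul_lift_def cong: HH.P.lift_cong_strong[OF comul_in])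
  finally show ?thesis .
qed (simp add: comul_lift_def)

lemma comul_lift_counit_left:
  assumes "lin K H N f" "h \<in> carrier H"
  shows "\<Delta> N h (\<lambda>x y. \<epsilon> x \<odot>\<^bsub>N\<^esub> f y) = f h"
proof -
  have "h = \<Delta> H h (\<lambda>x y. \<epsilon> x \<odot> y)"
    using counit_left assms by (simp add: comul_lift_def)
  then have "f h = f (\<Delta> H h (\<lambda>x y. \<epsilon> x \<odot> y))" by simp
  also have "\<dots> = \<Delta> N h (\<lambda>x y. f (\<epsilon> x \<odot> y))"
    by (rule hopf_algebra.comul_lift_hom[OF hopf_algebra_axioms module_H assms(1) N]) auto
  also have "\<dots> = \<Delta> N h (\<lambda>x y. \<epsilon> x \<odot>\<^bsub>N\<^esub> f y)"
    using linD(3)[OF assms(1)] by (intro comul_lift_cong) auto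
  finally show ?thesis by simp
qed

lemma comul_lift_counit_right:
  assumes "lin K H N f" "h \<in> carrier H"
  shows "\<Delta> N h (\<lambda>x y. \<epsilon> y \<odot>\<^bsub>N\<^esub> f x) = f h"
proof -
  have "h = \<Delta> H h (\<lambda>x y. \<epsilon> y \<odot> x)"
    using counit_right assms by (simp add: comul_lift_def)
  then have "f h = f (\<Delta> H h (\<lambda>x y. \<epsilon> y \<odot> x))" by simp
  also have "\<dots> = \<Delta> N h (\<lambda>x y. f (\<epsilon> y \<odot> x))"
    by (rule hopf_algebra.comul_lift_hom[OF hopf_algebra_axioms module_H assms(1) N]) auto
  also have "\<dots> = \<Delta> N h (\<lambda>x y. \<epsilon> y \<odot>\<^bsub>N\<^esub> f x)"
    using linD(3)[OF assms(1)] by (intro comul_lift_cong) auto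
  finally show ?thesis by simp
qed

lemma comul_lift_antipode_left:
  assumes "lin K H N f" "h \<in> carrier H"
  shows "\<Delta> N h (\<lambda>x y. f (\<gamma> x \<otimes> y)) = \<epsilon> h \<odot>\<^bsub>N\<^esub> f \<one>"
proof -
  have "\<Delta> N h (\<lambda>x y. f (\<gamma> x \<otimes> y)) = f (\<Delta> H h (\<lambda>x y. \<gamma> x \<otimes> y))"
    by (rule hopf_algebra.comul_lift_hom[OF hopf_algebra_axioms module_H assms(1) N, symmetric]) auto
  also have "\<dots> = f (\<epsilon> h \<odot> \<one>)" using antipode_left assms by (simp add: comul_lift_def)
  finally show ?thesis using linD(3)[OF assms(1)] assms(2) by simp
qed

lemma comul_lift_antipode_right:
  assumes "lin K H N f" "h \<in> carrier H"
  shows "\<Delta> N h (\<lambda>x y. f (x \<otimes> \<gamma> y)) = \<epsilon> h \<odot>\<^bsub>N\<^esub> f \<one>"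
proof -
  have "\<Delta> N h (\<lambda>x y. f (x \<otimes> \<gamma> y)) = f (\<Delta> H h (\<lambda>x y. x \<otimes> \<gamma> y))"
    by (rule hopf_algebra.comul_lift_hom[OF hopf_algebra_axioms module_H assms(1) N, symmetric]) auto
  also have "\<dots> = f (\<epsilon> h \<odot> \<one>)" using antipode_right assms by (simp add: comul_lift_def)
  finally show ?thesis using linD(3)[OF assms(1)] assms(2) by simp
qed

end

context
  fixes N :: "('k, 'n, 'z) module_scheme"
  assumes N [simp]: "module K N"
begin

interpretation N: module K N by (rule N)

text \<open>In Sweedler notation this is \<open>G(h1 \<gamma>(h2), h3) = G(1, h)\<close>: regroup
  the first two legs, cancel them, absorb the counit.\<close>

lemma comul_lift_antipode_right3:
  assumes G: "bilin K H H N G" and h: "h \<in> carrier H"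
  shows "\<Delta> N h (\<lambda>a r. \<Delta> N r (\<lambda>b c. G (a \<otimes> \<gamma> b) c)) = G \<one> h"
proof -
  note [simp] = bilinD(3)[OF G]
  note G_lin = lin_comp[OF bilinD(1)[OF G]] lin_comp[OF bilinD(2)[OF G]]
  have "\<Delta> N h (\<lambda>a r. \<Delta> N r (\<lambda>b c. G (a \<otimes> \<gamma> b) c)) = \<Delta> N h (\<lambda>r c. \<Delta> N r (\<lambda>a b. G (a \<otimes> \<gamma> b) c))"
    by (rule comul_lift_coassoc[OF N, symmetric]) (rule lin_intro G_lin | simp)+
  also have "\<dots> = \<Delta> N h (\<lambda>r c. \<epsilon> r \<odot>\<^bsub>N\<^esub> G \<one> c)"
    by (intro comul_lift_cong comul_lift_antipode_right[OF N bilinD(1)[OF G]]) auto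
  also have "\<dots> = G \<one> h"
    by (rule comul_lift_counit_left[OF N]) (use h bilinD(2)[OF G] in auto)
  finally show ?thesis .
qed

end

section \<open>The antipode on products, counits and coproducts\<close>

lemma antipode_one: "\<gamma> \<one> = \<one>"
proof -
  have "\<Delta> H \<one> (\<lambda>x y. \<gamma> x \<otimes> y) = \<epsilon> \<one> \<odot> \<one>"
    using antipode_left by (simp add: comul_lift_def)
  moreover have "\<Delta> H \<one> (\<lambda>x y. \<gamma> x \<otimes> y) = \<gamma> \<one> \<otimes> \<one>"
    by (rule comul_lift_one[OF module_H]) (rule lin_intro | simp)+
  ultimately show ?thesis by (simp add: counit_one)
qed

text \<open>Both sides are convolution inverses of the multiplication, regarded as a map on pairs
  \<open>g\<close>, \<open>h\<close>. The usual uniqueness argument is written out: one threefold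
  convolution product is evaluated in two ways.\<close>

lemma antipode_mult:
  assumes g: "g \<in> carrier H" and h: "h \<in> carrier H"
  shows "\<gamma> (g \<otimes> h) = \<gamma> h \<otimes> \<gamma> g"
proof -
  let ?F = "\<lambda>g1 g2 g3 h1 h2 h3. \<gamma> (g1 \<otimes> h1) \<otimes> (g2 \<otimes> h2) \<otimes> (\<gamma> h3 \<otimes> \<gamma> g3)"
  \<comment> \<open>The convolution product of \<open>\<gamma>(g h)\<close>, \<open>g h\<close> and
    \<open>\<gamma>(h) \<gamma>(g)\<close>. Facts 1 to 4 cancel the last two factors, from the
    inside out, and leave \<open>\<gamma>(g h)\<close>.\<close>
  let ?E = "\<Delta> H g (\<lambda>g1 s. \<Delta> H s (\<lambda>g2 g3. \<Delta> H h (\<lambda>h1 r. \<Delta> H r (\<lambda>h2 h3. ?F g1 g2 g3 h1 h2 h3))))"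
  have 1: "\<Delta> H r (\<lambda>h2 h3. ?F g1 g2 g3 h1 h2 h3) = \<epsilon> r \<odot> (\<gamma> (g1 \<otimes> h1) \<otimes> (g2 \<otimes> \<gamma> g3))"
    if "g1 \<in> carrier H" "g2 \<in> carrier H" "g3 \<in> carrier H" "h1 \<in> carrier H" "r \<in> carrier H" for g1 g2 g3 h1 r
  proof -
    have "\<Delta> H r (\<lambda>h2 h3. ?F g1 g2 g3 h1 h2 h3)
      = \<Delta> H r (\<lambda>h2 h3. \<gamma> (g1 \<otimes> h1) \<otimes> (g2 \<otimes> ((h2 \<otimes> \<gamma> h3) \<otimes> \<gamma> g3)))"
      using that by (intro comul_lift_cong) (simp add: m_assoc)
    also have "\<dots> = \<epsilon> r \<odot> (\<gamma> (g1 \<otimes> h1) \<otimes> (g2 \<otimes> (\<one> \<otimes> \<gamma> g3)))"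
      by (rule comul_lift_antipode_right[OF module_H]) (rule lin_intro | simp add: that)+
    finally show ?thesis using that by simp
  qed
  have 2: "\<Delta> H h (\<lambda>h1 r. \<epsilon> r \<odot> (\<gamma> (g1 \<otimes> h1) \<otimes> (g2 \<otimes> \<gamma> g3))) = \<gamma> (g1 \<otimes> h) \<otimes> (g2 \<otimes> \<gamma> g3)"
    if "g1 \<in> carrier H" "g2 \<in> carrier H" "g3 \<in> carrier H" for g1 g2 g3
    by (rule comul_lift_counit_right[OF module_H _ h]) (rule lin_intro | simp add: that)+
  have 3: "\<Delta> H s (\<lambda>g2 g3. \<gamma> (g1 \<otimes> h) \<otimes> (g2 \<otimes> \<gamma> g3)) = \<epsilon> s \<odot> \<gamma> (g1 \<otimes> h)"
    if "g1 \<in> carrier H" "s \<in> carrier H" for g1 s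
    by (subst comul_lift_antipode_right[OF module_H]) (rule lin_intro | simp add: that h)+
  have 4: "\<Delta> H g (\<lambda>g1 s. \<epsilon> s \<odot> \<gamma> (g1 \<otimes> h)) = \<gamma> (g \<otimes> h)"
    by (rule comul_lift_counit_right[OF module_H _ g]) (rule lin_intro | simp add: h)+
  have "?E = \<gamma> (g \<otimes> h)"
    using g h by (simp add: 1 2 3 4)
  \<comment> \<open>Now the first two factors are grouped: multiplicativity of the comultiplication
    makes them the two legs of the single element \<open>s \<otimes> r\<close>, to which the left
    antipode axiom applies.\<close>
  have "?E = \<Delta> H g (\<lambda>s g3. \<Delta> H s (\<lambda>g1 g2. \<Delta> H h (\<lambda>h1 r. \<Delta> H r (\<lambda>h2 h3. ?F g1 g2 g3 h1 h2 h3))))"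
    by (rule comul_lift_coassoc[OF module_H, symmetric]) (rule lin_intro | simp)+
  also have "\<dots> = \<Delta> H g (\<lambda>s g3. \<Delta> H s (\<lambda>g1 g2. \<Delta> H h (\<lambda>r h3. \<Delta> H r (\<lambda>h1 h2. ?F g1 g2 g3 h1 h2 h3))))"
    by (intro comul_lift_cong comul_lift_coassoc[OF module_H, symmetric]) (rule lin_intro | simp)+
  also have "\<dots> = \<Delta> H g (\<lambda>s g3. \<Delta> H h (\<lambda>r h3. \<Delta> H s (\<lambda>g1 g2. \<Delta> H r (\<lambda>h1 h2. ?F g1 g2 g3 h1 h2 h3))))"
    by (intro comul_lift_cong comul_lift_fubini[OF module_H]) simp_all
  also have "\<dots> = \<Delta> H g (\<lambda>s g3. \<Delta> H h (\<lambda>r h3. \<Delta> H (s \<otimes> r) (\<lambda>x y. \<gamma> x \<otimes> y \<otimes> (\<gamma> h3 \<otimes> \<gamma> g3))))"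
    by (intro comul_lift_cong comul_lift_mult[OF module_H, symmetric]) (rule lin_intro | simp)+
  also have "\<dots> = \<Delta> H g (\<lambda>s g3. \<Delta> H h (\<lambda>r h3. \<epsilon> (s \<otimes> r) \<odot> (\<one> \<otimes> (\<gamma> h3 \<otimes> \<gamma> g3))))"
    by (intro comul_lift_cong comul_lift_antipode_left[OF module_H]) (rule lin_intro | simp)+
  also have "\<dots> = \<Delta> H g (\<lambda>s g3. \<Delta> H h (\<lambda>r h3. \<epsilon> r \<odot> (\<epsilon> s \<odot> (\<gamma> h3 \<otimes> \<gamma> g3))))"
    by (intro comul_lift_cong) (simp add: counit_mult smult_assoc1[symmetric] R.m_comm)
  also have "\<dots> = \<Delta> H g (\<lambda>s g3. \<epsilon> s \<odot> (\<gamma> h \<otimes> \<gamma> g3))"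
    by (intro comul_lift_cong comul_lift_counit_left[OF module_H _ h]) (rule lin_intro | simp)+
  also have "\<dots> = \<gamma> h \<otimes> \<gamma> g"
    by (rule comul_lift_counit_left[OF module_H _ g]) (rule lin_intro | simp add: h)+
  finally show ?thesis using \<open>?E = \<gamma> (g \<otimes> h)\<close> by simp
qed

lemma antipode_counit:
  assumes h: "h \<in> carrier H"
  shows "\<epsilon> (\<gamma> h) = \<epsilon> h"
proof -
  \<comment> \<open>The ground ring as a module over itself, so that the scalar-valued counit can be
    moved through a Sweedler sum.\<close>
  define N :: "('k, 'k) module" where
    "N = \<lparr>carrier = carrier K, monoid.mult = monoid.mult K, one = \<one>\<^bsub>K\<^esub>,
      ring.zero = \<zero>\<^bsub>K\<^esub>, add = add K, smult = monoid.mult K\<rparr>"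
  have sel: "carrier N = carrier K" "add N = add K" "ring.zero N = ring.zero K" "smult N = monoid.mult K"
    by (simp_all add: N_def)
  have N: "module K N"
    by (rule moduleI[OF R.cring_axioms abelian_group_cong[OF R.abelian_group_axioms]])
      (simp_all add: sel R.l_distr R.r_distr R.m_assoc)
  have lin: "lin K H N \<epsilon>"
    by (rule linI) (simp_all add: sel counit_add counit_smult)
  have "\<Delta> H h (\<lambda>x y. \<gamma> x \<otimes> y) = \<epsilon> h \<odot> \<one>"
    using antipode_left h by (simp add: comul_lift_def)
  then have "\<epsilon> h = \<epsilon> (\<Delta> H h (\<lambda>x y. \<gamma> x \<otimes> y))"
    using h by (simp add: counit_smult counit_one)
  also have "\<dots> = \<Delta> N h (\<lambda>x y. \<epsilon> (\<gamma> x \<otimes> y))"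
    by (rule comul_lift_hom[OF module_H lin N]) simp
  also have "\<dots> = \<Delta> N h (\<lambda>x y. \<epsilon> y \<odot>\<^bsub>N\<^esub> \<epsilon> (\<gamma> x))"
    by (intro comul_lift_cong) (simp add: counit_mult sel R.m_comm)
  also have "\<dots> = \<epsilon> (\<gamma> h)"
    by (rule comul_lift_counit_right[OF N lin_comp[OF lin lin_antipode1] h])
  finally show ?thesis by simp
qed

text \<open>Comultiplication after the antipode, and the antipode applied to the interchanged legs,
  are both convolution inverses of the comultiplication. Again one threefold product is evaluated in
  two ways, with the values paired through \<open>f\<close>.\<close>

lemma antipode_comul:
  assumes N [simp]: "module K N" and f: "bilin K H H N f" and h: "h \<in> carrier H"
  shows "\<Delta> N (\<gamma> h) f = \<Delta> N h (\<lambda>x y. f (\<gamma> y) (\<gamma> x))"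
proof -
  interpret N: module K N by fact
  note [simp] = bilinD(3)[OF f]
  note f_lin = lin_comp[OF bilinD(1)[OF f]] lin_comp[OF bilinD(2)[OF f]]
  let ?Q = "\<lambda>h1 h2 h3 t. \<Delta> N t (\<lambda>h4 h5. \<Delta> N (\<gamma> h1) (\<lambda>a b. f (a \<otimes> (h2 \<otimes> \<gamma> h5)) (b \<otimes> (h3 \<otimes> \<gamma> h4))))"
  \<comment> \<open>In components: the coproduct of \<open>\<gamma>(h1)\<close>, times
    \<open>(h2, h3)\<close>, times \<open>(\<gamma>(h5), \<gamma>(h4))\<close>. Cancelling from the
    right removes \<open>h3 \<gamma>(h4)\<close> first and then
    \<open>h2 \<gamma>(h5)\<close>.\<close>
  let ?E = "\<Delta> N h (\<lambda>h1 r. \<Delta> N r (\<lambda>h2 s. \<Delta> N s (\<lambda>h3 t. ?Q h1 h2 h3 t)))"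
  have "?E = \<Delta> N h (\<lambda>h1 r. \<Delta> N r (\<lambda>h2 s. \<Delta> N (\<gamma> h1) (\<lambda>a b. f (a \<otimes> (h2 \<otimes> \<gamma> s)) (b \<otimes> \<one>))))"
    by (intro comul_lift_cong comul_lift_antipode_right3[OF N, where G="\<lambda>x c. \<Delta> N (\<gamma> _) (\<lambda>a b. f (a \<otimes> (_ \<otimes> \<gamma> c)) (b \<otimes> x))"])
      (rule lin_intro f_lin | simp)+
  also have "\<dots> = \<Delta> N h (\<lambda>h1 r. \<epsilon> r \<odot>\<^bsub>N\<^esub> \<Delta> N (\<gamma> h1) (\<lambda>a b. f (a \<otimes> \<one>) (b \<otimes> \<one>)))"
    by (intro comul_lift_cong comul_lift_antipode_right[OF N, where f="\<lambda>x. \<Delta> N (\<gamma> _) (\<lambda>a b. f (a \<otimes> x) (b \<otimes> \<one>))"])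
      (rule lin_intro f_lin | simp)+
  also have "\<dots> = \<Delta> N (\<gamma> h) (\<lambda>a b. f (a \<otimes> \<one>) (b \<otimes> \<one>))"
    by (rule comul_lift_counit_right[OF N _ h]) (rule lin_intro f_lin | simp)+
  also have "\<dots> = \<Delta> N (\<gamma> h) f"
    by (intro comul_lift_cong) simp
  finally have 1: "?E = \<Delta> N (\<gamma> h) f" .
  \<comment> \<open>The second evaluation regroups so that \<open>h2\<close> and \<open>h3\<close>
    are the legs of one element \<open>s\<close>; the first two factors then merge into the
    coproduct of \<open>\<gamma>(h1) s\<close>, and the left antipode axiom removes it.\<close>
  have "?E = \<Delta> N h (\<lambda>h1 r. \<Delta> N r (\<lambda>s t. \<Delta> N s (\<lambda>h2 h3. ?Q h1 h2 h3 t)))"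
    by (intro comul_lift_cong comul_lift_coassoc[OF N, symmetric]) (rule lin_intro f_lin | simp)+
  also have "\<dots> = \<Delta> N h (\<lambda>u t. \<Delta> N u (\<lambda>h1 s. \<Delta> N s (\<lambda>h2 h3. ?Q h1 h2 h3 t)))"
    by (rule comul_lift_coassoc[OF N, symmetric]) (rule lin_intro f_lin | simp)+
  also have "\<dots> = \<Delta> N h (\<lambda>u t. \<Delta> N u (\<lambda>h1 s. \<Delta> N t (\<lambda>h4 h5. \<Delta> N s (\<lambda>h2 h3.
      \<Delta> N (\<gamma> h1) (\<lambda>a b. f (a \<otimes> (h2 \<otimes> \<gamma> h5)) (b \<otimes> (h3 \<otimes> \<gamma> h4)))))))"
    by (intro comul_lift_cong comul_lift_fubini[OF N]) simp
  also have "\<dots> = \<Delta> N h (\<lambda>u t. \<Delta> N u (\<lambda>h1 s. \<Delta> N t (\<lambda>h4 h5. \<Delta> N (\<gamma> h1) (\<lambda>a b.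
      \<Delta> N s (\<lambda>h2 h3. f ((a \<otimes> h2) \<otimes> \<gamma> h5) ((b \<otimes> h3) \<otimes> \<gamma> h4))))))"
    by (intro comul_lift_cong, subst comul_lift_fubini[OF N]) (simp_all add: m_assoc)
  also have "\<dots> = \<Delta> N h (\<lambda>u t. \<Delta> N u (\<lambda>h1 s. \<Delta> N t (\<lambda>h4 h5. \<Delta> N (\<gamma> h1 \<otimes> s)
      (\<lambda>x y. f (x \<otimes> \<gamma> h5) (y \<otimes> \<gamma> h4)))))"
    by (intro comul_lift_cong comul_lift_mult[OF N, symmetric]) (rule lin_intro f_lin | simp)+
  also have "\<dots> = \<Delta> N h (\<lambda>u t. \<epsilon> u \<odot>\<^bsub>N\<^esub> \<Delta> N t (\<lambda>h4 h5. \<Delta> N \<one>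
      (\<lambda>x y. f (x \<otimes> \<gamma> h5) (y \<otimes> \<gamma> h4))))"
    by (intro comul_lift_cong comul_lift_antipode_left[OF N, where f="\<lambda>z. \<Delta> N _ (\<lambda>h4 h5. \<Delta> N z
      (\<lambda>x y. f (x \<otimes> \<gamma> h5) (y \<otimes> \<gamma> h4)))"]) (rule lin_intro f_lin | simp)+
  also have "\<dots> = \<Delta> N h (\<lambda>h4 h5. \<Delta> N \<one> (\<lambda>x y. f (x \<otimes> \<gamma> h5) (y \<otimes> \<gamma> h4)))"
    by (rule comul_lift_counit_left[OF N _ h]) (rule lin_intro f_lin | simp)+
  also have "\<dots> = \<Delta> N h (\<lambda>h4 h5. f (\<one> \<otimes> \<gamma> h5) (\<one> \<otimes> \<gamma> h4))"
    by (intro comul_lift_cong comul_lift_one[OF N]) (rule lin_intro f_lin | simp)+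
  also have "\<dots> = \<Delta> N h (\<lambda>x y. f (\<gamma> y) (\<gamma> x))"
    by (intro comul_lift_cong) simp
  finally show ?thesis using 1 by simp
qed

end

section \<open>Sweedler calculus in a base algebra\<close>

text \<open>Here the tensor is fixed and linearity is in a parameter of the body. In contrast to
  \<open>lift_lin\<close>, the body need not be bilinear in the two summed variables.\<close>

lemma (in ktensor_pair) lin_lift_body:
  assumes N: "module K N" and z: "z \<in> carrier Z"
    and f: "\<And>a b. a \<in> carrier A \<Longrightarrow> b \<in> carrier B \<Longrightarrow> lin K M N (\<lambda>x. f x a b)"
  shows "lin K M N (\<lambda>x. tensor_lift N (f x) z)"
proof (rule linI)
  interpret N: module K N by fact
  have z': "z \<in> carrier (ktensor K A B)" using z by (simp add: Z_sel)
  note ab = N.M.abelian_group_axioms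
  show "tensor_lift N (f x) z \<in> carrier N" if "x \<in> carrier M" for x
    using linD(1)[OF f] that by (intro P.lift_closed[OF z' ab]) auto
  show "tensor_lift N (f (x \<oplus>\<^bsub>M\<^esub> y)) z = tensor_lift N (f x) z \<oplus>\<^bsub>N\<^esub> tensor_lift N (f y) z"
    if "x \<in> carrier M" "y \<in> carrier M" for x y
  proof -
    have "tensor_lift N (f (x \<oplus>\<^bsub>M\<^esub> y)) z = tensor_lift N (\<lambda>a b. f x a b \<oplus>\<^bsub>N\<^esub> f y a b) z"
      by (rule P.lift_cong_strong[OF z']) (use linD(2)[OF f] that in auto)
    also have "\<dots> = tensor_lift N (f x) z \<oplus>\<^bsub>N\<^esub> tensor_lift N (f y) z"
      by (rule P.lift_add_fun[OF z' ab]) (use linD(1)[OF f] that in auto)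
    finally show ?thesis .
  qed
  show "tensor_lift N (f (c \<odot>\<^bsub>M\<^esub> x)) z = c \<odot>\<^bsub>N\<^esub> tensor_lift N (f x) z"
    if "c \<in> carrier K" "x \<in> carrier M" for c x
  proof -
    have "tensor_lift N (f (c \<odot>\<^bsub>M\<^esub> x)) z = tensor_lift N (\<lambda>a b. c \<odot>\<^bsub>N\<^esub> f x a b) z"
      by (rule P.lift_cong_strong[OF z']) (use linD(3)[OF f] that in auto)
    also have "\<dots> = c \<odot>\<^bsub>N\<^esub> tensor_lift N (f x) z"
      by (rule P.lift_hom[OF z' ab ab, symmetric])
        (use linD(1)[OF f] that in \<open>auto intro!: additive_mapI simp: N.smult_r_distr\<close>)
    finally show ?thesis .
  qed
qed

section \<open>Hopf algebras with bijective antipode\<close>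

locale bij_hopf = hopf_algebra K H
  for K :: "'k ring" and H :: "('k, 'h, 'x) hopf_scheme" (structure) +
  assumes antipode_bij: "bij_betw (antipode H) (carrier H) (carrier H)"
begin

abbreviation "\<iota> \<equiv> antipode_inv H"

lemma antipode_inv_closed [simp]: "h \<in> carrier H \<Longrightarrow> \<iota> h \<in> carrier H"
  using antipode_bij by (metis bij_betw_def inv_into_into)

lemma antipode_antipode_inv [simp]: "h \<in> carrier H \<Longrightarrow> \<gamma> (\<iota> h) = h"
  using antipode_bij by (simp add: bij_betw_def f_inv_into_f)

lemma antipode_inv_antipode [simp]: "h \<in> carrier H \<Longrightarrow> \<iota> (\<gamma> h) = h"
  using antipode_bij by (simp add: bij_betw_def)

lemma antipode_inv_eqI: "\<lbrakk>x \<in> carrier H; y \<in> carrier H; \<gamma> y = x\<rbrakk> \<Longrightarrow> \<iota> x = y"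
  by auto

lemma lin_antipode_inv1: "lin K H H \<iota>"
proof (rule linI)
  show "\<iota> (x \<oplus> y) = \<iota> x \<oplus> \<iota> y" if "x \<in> carrier H" "y \<in> carrier H" for x y
    by (rule antipode_inv_eqI) (use that linD(2)[OF lin_antipode1] in auto)
  show "\<iota> (c \<odot> x) = c \<odot> \<iota> x" if "c \<in> carrier K" "x \<in> carrier H" for c x
    by (rule antipode_inv_eqI) (use that linD(3)[OF lin_antipode1] in auto)
qed simp

lemma lin_antipode_inv [lin_intro]: "lin K N H t \<Longrightarrow> lin K N H (\<lambda>x. \<iota> (t x))"
  by (rule lin_comp[OF lin_antipode_inv1])

lemma antipode_inv_mult: "\<lbrakk>g \<in> carrier H; h \<in> carrier H\<rbrakk> \<Longrightarrow> \<iota> (g \<otimes> h) = \<iota> h \<otimes> \<iota> g"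
  by (rule antipode_inv_eqI) (auto simp: antipode_mult)

lemma antipode_inv_one: "\<iota> \<one> = \<one>"
  by (rule antipode_inv_eqI) (auto simp: antipode_one)

lemma antipode_inv_counit: "h \<in> carrier H \<Longrightarrow> \<epsilon> (\<iota> h) = \<epsilon> h"
  using antipode_counit[of "\<iota> h"] by simp

lemma antipode_inv_comul:
  assumes N [simp]: "module K N" and f: "bilin K H H N f" and h: "h \<in> carrier H"
  shows "\<Delta> N (\<iota> h) f = \<Delta> N h (\<lambda>x y. f (\<iota> y) (\<iota> x))"
proof -
  note f_lin = lin_comp[OF bilinD(1)[OF f]] lin_comp[OF bilinD(2)[OF f]]
  have "\<Delta> N (\<gamma> (\<iota> h)) (\<lambda>x y. f (\<iota> y) (\<iota> x)) = \<Delta> N (\<iota> h) (\<lambda>x y. f (\<iota> (\<gamma> x)) (\<iota> (\<gamma> y)))"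
    by (rule antipode_comul[OF N]) (rule lin_intro f_lin | simp add: h)+
  then show ?thesis using h by simp
qed

text \<open>Applying the antihomomorphism \<open>\<iota>\<close> to
  \<open>h1 \<gamma>(h2) = \<epsilon>(h)\<close> gives
  \<open>h2 \<iota>(h1) = \<epsilon>(h)\<close>. This and the next lemma are at once cancellation
  rules and the antipode axioms of the opposite Hopf algebra.\<close>

lemma comul_lift_antipode_inv_left:
  assumes N: "module K N" and f: "lin K H N f" and h: "h \<in> carrier H"
  shows "\<Delta> N h (\<lambda>x y. f (y \<otimes> \<iota> x)) = \<epsilon> h \<odot>\<^bsub>N\<^esub> f \<one>"
proof -
  have "\<Delta> N h (\<lambda>x y. f (y \<otimes> \<iota> x)) = \<Delta> N h (\<lambda>x y. f (\<iota> (x \<otimes> \<gamma> y)))"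
    by (intro comul_lift_cong) (simp add: antipode_inv_mult)
  then show ?thesis
    using comul_lift_antipode_right[OF N lin_comp[OF f lin_antipode_inv1] h] by (simp add: antipode_inv_one)
qed

lemma comul_lift_antipode_inv_right:
  assumes N: "module K N" and f: "lin K H N f" and h: "h \<in> carrier H"
  shows "\<Delta> N h (\<lambda>x y. f (\<iota> y \<otimes> x)) = \<epsilon> h \<odot>\<^bsub>N\<^esub> f \<one>"
proof -
  have "\<Delta> N h (\<lambda>x y. f (\<iota> y \<otimes> x)) = \<Delta> N h (\<lambda>x y. f (\<iota> (\<gamma> x \<otimes> y)))"
    by (intro comul_lift_cong) (simp add: antipode_inv_mult)
  then show ?thesis
    using comul_lift_antipode_left[OF N lin_comp[OF f lin_antipode_inv1] h] by (simp add: antipode_inv_one)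
qed

context
  fixes N :: "('k, 'n, 'z) module_scheme" and G
  assumes N [simp]: "module K N" and G: "bilin K H H N G"
begin

interpretation N: module K N by (rule N)

lemma comul_lift_antipode_inv_right3:
  assumes h: "h \<in> carrier H"
  shows "\<Delta> N h (\<lambda>a r. \<Delta> N r (\<lambda>b c. G (\<iota> b \<otimes> a) c)) = G \<one> h"
proof -
  note [simp] = bilinD(3)[OF G]
  note G_lin = lin_comp[OF bilinD(1)[OF G]] lin_comp[OF bilinD(2)[OF G]]
  have "\<Delta> N h (\<lambda>a r. \<Delta> N r (\<lambda>b c. G (\<iota> b \<otimes> a) c)) = \<Delta> N h (\<lambda>r c. \<Delta> N r (\<lambda>a b. G (\<iota> b \<otimes> a) c))"
    by (rule comul_lift_coassoc[OF N, symmetric]) (rule lin_intro G_lin | simp)+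
  also have "\<dots> = \<Delta> N h (\<lambda>r c. \<epsilon> r \<odot>\<^bsub>N\<^esub> G \<one> c)"
    by (intro comul_lift_cong comul_lift_antipode_inv_right[OF N bilinD(1)[OF G]]) auto
  also have "\<dots> = G \<one> h"
    by (rule comul_lift_counit_left[OF N]) (use h bilinD(2)[OF G] in auto)
  finally show ?thesis .
qed

end

end

text \<open>The counterpart of \<open>comul_lift\<close> for the coaction, with the same value zero
  outside the carrier and for the same reason.\<close>

definition coact_lift :: "('k, 'h, 'l, 'x) base_alg_scheme \<Rightarrow> ('a, 'w) ring_scheme \<Rightarrow> 'l \<Rightarrow> ('h \<Rightarrow> 'l \<Rightarrow> 'a) \<Rightarrow> 'a" where
  "coact_lift L A l f = (if l \<in> carrier L then tensor_lift A f (coact L l) else \<zero>\<^bsub>A\<^esub>)"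

context base_algebra
begin

sublocale HL: ktensor_pair K H L "ktensor_module K H L"
  by (rule ktensor_pair_ktensor_module) (rule H.module_axioms L.module_axioms)+

sublocale LH: ktensor_pair K L H "smash_algebra K H L"
  by unfold_locales (simp_all add: smash_algebra_def Let_def)

abbreviation "\<Delta> \<equiv> comul_lift H"
abbreviation "\<epsilon> \<equiv> counit H"
abbreviation "\<gamma> \<equiv> antipode H"
abbreviation "\<delta> \<equiv> coact_lift L"
abbreviation act_syn (infixr "\<rhd>" 73) where "h \<rhd> l \<equiv> act L h l"
abbreviation "S \<equiv> smash_algebra K H L"
abbreviation sm (infix "\<sharp>" 67) where "l \<sharp> h \<equiv> kpure K L H l h"

lemma module_L [simp]: "module K L" by (rule L.module_axioms)
lemma module_S [simp]: "module K S" by (rule LH.Z_module)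
lemma module_HL [simp]: "module K (ktensor_module K H L)" by (rule HL.Z_module)

lemma act_in [simp, intro]: "h \<in> carrier H \<Longrightarrow> l \<in> carrier L \<Longrightarrow> h \<rhd> l \<in> carrier L"
  by (rule act_closed)

lemma lin_act1: "l \<in> carrier L \<Longrightarrow> lin K H L (\<lambda>h. h \<rhd> l)"
  by (rule linI) (auto simp: act_add_left act_smult_left)

lemma lin_act2: "h \<in> carrier H \<Longrightarrow> lin K L L (\<lambda>l. h \<rhd> l)"
  by (rule linI) (auto simp: act_add_right act_smult_right)

lemma lin_act_left [lin_intro]: "lin K N H t \<Longrightarrow> l \<in> carrier L \<Longrightarrow> lin K N L (\<lambda>x. t x \<rhd> l)"
  by (rule lin_comp[OF lin_act1])

lemma lin_act_right [lin_intro]: "lin K N L t \<Longrightarrow> h \<in> carrier H \<Longrightarrow> lin K N L (\<lambda>x. h \<rhd> t x)"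
  by (rule lin_comp[OF lin_act2])

lemma coact_lin: "lin K L (ktensor_module K H L) (coact L)"
  by (rule bimodule_hom_lin[OF coact_linear]) simp_all

lemma coact_in: "l \<in> carrier L \<Longrightarrow> coact L l \<in> carrier (ktensor K H L)"
  using linD(1)[OF coact_lin] by (simp add: HL.Z_sel)

lemma coact_lift_cong:
  assumes "\<And>x y. x \<in> carrier H \<Longrightarrow> y \<in> carrier L \<Longrightarrow> f x y = g x y"
  shows "\<delta> A l f = \<delta> A l g"
  unfolding coact_lift_def using HL.P.lift_cong_strong[OF coact_in, of l f g A] assms by simp

lemma coact_lift_cong_simp [cong]:
  "\<lbrakk>l = l'; \<And>x y. x \<in> carrier H \<Longrightarrow> y \<in> carrier L \<Longrightarrow> f x y = g x y\<rbrakk> \<Longrightarrow> \<delta> A l f = \<delta> A l' g"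
  by (hypsubst, rule coact_lift_cong)

context
  fixes N :: "('k, 'n, 'z) module_scheme"
  assumes N: "module K N"
begin

interpretation N: module K N by (rule N)

lemma coact_lift_closed [simp, intro]:
  "(\<And>x y. x \<in> carrier H \<Longrightarrow> y \<in> carrier L \<Longrightarrow> f x y \<in> carrier N) \<Longrightarrow> \<delta> N l f \<in> carrier N"
  unfolding coact_lift_def using HL.P.lift_closed[OF coact_in N.M.abelian_group_axioms, of l f] by simp

lemma coact_lift_hom:
  assumes "lin K N B \<phi>" "module K B"
    and "\<And>x y. x \<in> carrier H \<Longrightarrow> y \<in> carrier L \<Longrightarrow> f x y \<in> carrier N"
  shows "\<phi> (\<delta> N l f) = \<delta> B l (\<lambda>x y. \<phi> (f x y))"
proof -
  interpret B: module K B by fact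
  show ?thesis
    unfolding coact_lift_def
    using HL.P.lift_hom[OF coact_in N.M.abelian_group_axioms B.M.abelian_group_axioms linD(4)[OF assms(1)], of l f]
      additive_map_zero[OF N.M.abelian_group_axioms B.M.abelian_group_axioms linD(4)[OF assms(1)]] assms(3)
    by simp
qed

lemma lin_coact_lift_body [lin_intro]:
  assumes "\<And>a b. a \<in> carrier H \<Longrightarrow> b \<in> carrier L \<Longrightarrow> lin K M N (\<lambda>x. f x a b)"
  shows "lin K M N (\<lambda>x. \<delta> N l (\<lambda>a b. f x a b))"
proof (cases "l \<in> carrier L")
  case True
  then have "coact L l \<in> carrier (ktensor_module K H L)" using linD(1)[OF coact_lin] by simp
  from HL.lin_lift_body[OF N this assms] True show ?thesis by (simp add: coact_lift_def)
qed (simp add: coact_lift_def lin_def additive_map_def)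

lemma lin_coact_lift_arg1: "bilin K H L N f \<Longrightarrow> lin K L N (\<lambda>l. \<delta> N l f)"
proof -
  assume f: "bilin K H L N f"
  have "lin K L N (\<lambda>l. tensor_lift N f (coact L l))"
    by (rule lin_comp[OF HL.lift_lin[OF N f] coact_lin])
  then show ?thesis
    by (auto simp: lin_def additive_map_def coact_lift_def)
qed

lemma lin_coact_lift_arg [lin_intro]:
  "lin K M L t \<Longrightarrow> bilin K H L N f \<Longrightarrow> lin K M N (\<lambda>x. \<delta> N (t x) f)"
  by (rule lin_comp[OF lin_coact_lift_arg1])

lemma coact_lift_fubini:
  assumes "\<And>x y u v. \<lbrakk>x \<in> carrier H; y \<in> carrier L; u \<in> carrier H; v \<in> carrier L\<rbrakk> \<Longrightarrow> f x y u v \<in> carrier N"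
  shows "\<delta> N l (\<lambda>x y. \<delta> N m (\<lambda>u v. f x y u v)) = \<delta> N m (\<lambda>u v. \<delta> N l (\<lambda>x y. f x y u v))"
  unfolding coact_lift_def
  using HL.P.lift_fubini[OF HL.P.tensor_pair_axioms N.M.abelian_group_axioms coact_in coact_in, of l m f] assms
    HL.P.lift_zero_fun[OF coact_in N.M.abelian_group_axioms]
  by simp

lemma coact_lift_comul_lift_fubini:
  assumes "\<And>x y u v. \<lbrakk>x \<in> carrier H; y \<in> carrier L; u \<in> carrier H; v \<in> carrier H\<rbrakk> \<Longrightarrow> f x y u v \<in> carrier N"
  shows "\<delta> N l (\<lambda>x y. \<Delta> N h (\<lambda>u v. f x y u v)) = \<Delta> N h (\<lambda>u v. \<delta> N l (\<lambda>x y. f x y u v))"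
  unfolding coact_lift_def comul_lift_def
  using HL.P.lift_fubini[OF H.HH.P.tensor_pair_axioms N.M.abelian_group_axioms coact_in H.comul_in, of l h f] assms
    HL.P.lift_zero_fun[OF coact_in N.M.abelian_group_axioms]
    H.HH.P.lift_zero_fun[OF H.comul_in N.M.abelian_group_axioms]
  by simp

lemma coact_lift_mult:
  assumes "bilin K H L N f" "l \<in> carrier L" "m \<in> carrier L"
  shows "\<delta> N (l \<otimes>\<^bsub>L\<^esub> m) f = \<delta> N l (\<lambda>p l'. \<delta> N m (\<lambda>q m'. f (p \<otimes>\<^bsub>H\<^esub> q) (l' \<otimes>\<^bsub>L\<^esub> m')))"
proof -
  have c: "coact L l \<in> carrier (ktensor_module K H L)" "coact L m \<in> carrier (ktensor_module K H L)"
    using linD(1)[OF coact_lin] assms(2,3) by auto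
  have "coact L (l \<otimes>\<^bsub>L\<^esub> m) = coact L l \<otimes>\<^bsub>ktensor K H L\<^esub> coact L m"
    using coact_ring_hom assms by (auto simp: ring_hom_def)
  then have "\<delta> N (l \<otimes>\<^bsub>L\<^esub> m) f = \<delta> N m (\<lambda>q m'. \<delta> N l (\<lambda>p l'. f (p \<otimes>\<^bsub>H\<^esub> q) (l' \<otimes>\<^bsub>L\<^esub> m')))"
    using assms by (simp add: coact_lift_def HL.lift_mult[OF N assms(1) c])
  also have "\<dots> = \<delta> N l (\<lambda>p l'. \<delta> N m (\<lambda>q m'. f (p \<otimes>\<^bsub>H\<^esub> q) (l' \<otimes>\<^bsub>L\<^esub> m')))"
    by (rule coact_lift_fubini) (auto intro!: bilinD(3)[OF assms(1)])
  finally show ?thesis .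
qed

lemma coact_lift_one:
  assumes "bilin K H L N f"
  shows "\<delta> N \<one>\<^bsub>L\<^esub> f = f \<one>\<^bsub>H\<^esub> \<one>\<^bsub>L\<^esub>"
proof -
  have "coact L \<one>\<^bsub>L\<^esub> = kpure K H L \<one>\<^bsub>H\<^esub> \<one>\<^bsub>L\<^esub>"
    using coact_ring_hom by (auto simp: ring_hom_def tensor_def Let_def)
  then show ?thesis by (simp add: coact_lift_def HL.lift_pure[OF N assms])
qed

lemma coact_lift_coassoc:
  assumes "trilin K H H L N f"
  shows "\<delta> N l (\<lambda>p m. \<Delta> N p (\<lambda>u v. f u v m)) = \<delta> N l (\<lambda>p m. \<delta> N m (\<lambda>q n. f p q n))"
proof (cases "l \<in> carrier L")
  case True
  have "\<delta> N l (\<lambda>p m. \<Delta> N p (\<lambda>u v. f u v m)) =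
      tensor_lift N (\<lambda>p c. tensor_lift N (\<lambda>a b. f a b c) (comul H p)) (coact L l)"
    using True by (simp add: coact_lift_def comul_lift_def cong: HL.P.lift_cong_strong[OF coact_in])
  also have "\<dots> = tensor_lift N (\<lambda>a q. tensor_lift N (f a) (coact L q)) (coact L l)"
    by (rule coassoc_lift[OF H.module_H H.module_H module_L H.module_H module_L N H.comul_lin coact_lin
        coact_in[OF True] coact_in[OF True] coact_coassoc[OF True] assms])
  also have "\<dots> = \<delta> N l (\<lambda>p m. \<delta> N m (\<lambda>q n. f p q n))"
    using True by (simp add: coact_lift_def cong: HL.P.lift_cong_strong[OF coact_in])
  finally show ?thesis .
qed (simp add: coact_lift_def)

lemma coact_lift_counit:
  assumes "lin K L N f" "l \<in> carrier L"
  shows "\<delta> N l (\<lambda>p m. \<epsilon> p \<odot>\<^bsub>N\<^esub> f m) = f l"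
proof -
  have "l = \<delta> L l (\<lambda>p m. \<epsilon> p \<odot>\<^bsub>L\<^esub> m)"
    using coact_counit assms by (simp add: coact_lift_def)
  then have "f l = f (\<delta> L l (\<lambda>p m. \<epsilon> p \<odot>\<^bsub>L\<^esub> m))" by simp
  also have "\<dots> = \<delta> N l (\<lambda>p m. f (\<epsilon> p \<odot>\<^bsub>L\<^esub> m))"
    by (rule base_algebra.coact_lift_hom[OF base_algebra_axioms module_L assms(1) N]) auto
  also have "\<dots> = \<delta> N l (\<lambda>p m. \<epsilon> p \<odot>\<^bsub>N\<^esub> f m)"
    using linD(3)[OF assms(1)] by (intro coact_lift_cong) auto
  finally show ?thesis by simp
qed

text \<open>The compatibility axiom is an equation of tensors in \<open>H\<close> and
  \<open>L\<close>; applying the lift of \<open>f\<close> moves it into an arbitrary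
  \<open>K\<close>-module, where it can be used under other sums.\<close>

lemma coact_lift_act:
  assumes f: "bilin K H L N f" and h: "h \<in> carrier H" and l: "l \<in> carrier L"
  shows "\<delta> N (h \<rhd> l) f = \<Delta> N h (\<lambda>h1 w. \<Delta> N w (\<lambda>h2 h3. \<delta> N l (\<lambda>p m.
     f (h1 \<otimes>\<^bsub>H\<^esub> p \<otimes>\<^bsub>H\<^esub> \<gamma> h3) (h2 \<rhd> m))))"
proof -
  let ?T = "ktensor_module K H L"
  have "coact L (h \<rhd> l) = tensor_lift ?T (\<lambda>h1 w. tensor_lift ?T (\<lambda>h2 h3. tensor_lift ?T (\<lambda>p m.
     kpure K H L (h1 \<otimes>\<^bsub>H\<^esub> p \<otimes>\<^bsub>H\<^esub> \<gamma> h3) (h2 \<rhd> m)) (coact L l)) (comul H w)) (comul H h)"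
    using coact_act[OF h l] by (simp add: HL.lift_target)
  also have "\<dots> = \<Delta> ?T h (\<lambda>h1 w. \<Delta> ?T w (\<lambda>h2 h3. \<delta> ?T l (\<lambda>p m.
     kpure K H L (h1 \<otimes>\<^bsub>H\<^esub> p \<otimes>\<^bsub>H\<^esub> \<gamma> h3) (h2 \<rhd> m))))"
    using h l by (simp add: comul_lift_def coact_lift_def cong: H.HH.P.lift_cong_strong[OF H.comul_in])
  finally have "\<delta> N (h \<rhd> l) f = tensor_lift N f (\<Delta> ?T h (\<lambda>h1 w. \<Delta> ?T w (\<lambda>h2 h3. \<delta> ?T l (\<lambda>p m.
     kpure K H L (h1 \<otimes>\<^bsub>H\<^esub> p \<otimes>\<^bsub>H\<^esub> \<gamma> h3) (h2 \<rhd> m)))))"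
    using h l by (simp add: coact_lift_def[of L N])
  also have "\<dots> = \<Delta> N h (\<lambda>h1 w. \<Delta> N w (\<lambda>h2 h3. \<delta> N l (\<lambda>p m.
     f (h1 \<otimes>\<^bsub>H\<^esub> p \<otimes>\<^bsub>H\<^esub> \<gamma> h3) (h2 \<rhd> m))))"
    using HL.lift_lin[OF N f]
    by (simp add: H.comul_lift_hom[OF module_HL _ N] base_algebra.coact_lift_hom[OF base_algebra_axioms module_HL _ N]
        HL.lift_pure[OF N f] H.comul_lift_closed base_algebra.coact_lift_closed[OF base_algebra_axioms])
  finally show ?thesis .
qed

end

lemma comul_lift_act_mult:
  "\<lbrakk>h \<in> carrier H; l \<in> carrier L; m \<in> carrier L\<rbrakk> \<Longrightarrow> h \<rhd> (l \<otimes>\<^bsub>L\<^esub> m) = \<Delta> L h (\<lambda>x y. (x \<rhd> l) \<otimes>\<^bsub>L\<^esub> (y \<rhd> m))"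
  by (simp add: act_on_mult comul_lift_def)

lemma coact_lift_braided:
  "\<lbrakk>l \<in> carrier L; m \<in> carrier L\<rbrakk> \<Longrightarrow> l \<otimes>\<^bsub>L\<^esub> m = \<delta> L l (\<lambda>p n. (p \<rhd> m) \<otimes>\<^bsub>L\<^esub> n)"
  by (subst braided_commutative) (auto simp: coact_lift_def)

section \<open>The product of the smash algebra\<close>

lemma S_sel: "carrier S = carrier (ktensor K L H)" "add S = add (ktensor K L H)"
  "ring.zero S = ring.zero (ktensor K L H)" "smult S = lact (ktensor K L H)"
  "one S = \<one>\<^bsub>L\<^esub> \<sharp> \<one>\<^bsub>H\<^esub>" "src S = (\<lambda>l. l \<sharp> \<one>\<^bsub>H\<^esub>)"
  by (simp_all add: smash_algebra_def Let_def)

lemma S_tgt: "l \<in> carrier L \<Longrightarrow> tgt S l = \<delta> S l (\<lambda>p m. m \<sharp> antipode_inv H p)"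
  unfolding coact_lift_def LH.lift_target[symmetric] by (simp add: smash_algebra_def Let_def)

lemma S_mult: "monoid.mult S = (\<lambda>z w. tensor_lift S (\<lambda>l f. tensor_lift S (\<lambda>m g.
    tensor_lift S (\<lambda>f1 f2. (l \<otimes>\<^bsub>L\<^esub> (f1 \<rhd> m)) \<sharp> (f2 \<otimes>\<^bsub>H\<^esub> g)) (comul H f)) w) z)"
  unfolding LH.lift_target[symmetric] by (simp add: smash_algebra_def Let_def)

lemma S_mult_comul_lift:
  assumes z: "z \<in> carrier S" and w: "w \<in> carrier S"
  shows "z \<otimes>\<^bsub>S\<^esub> w = tensor_lift S (\<lambda>l f. tensor_lift S (\<lambda>m g.
    \<Delta> S f (\<lambda>f1 f2. (l \<otimes>\<^bsub>L\<^esub> (f1 \<rhd> m)) \<sharp> (f2 \<otimes>\<^bsub>H\<^esub> g))) w) z"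
proof -
  note z' = z[unfolded S_sel] and w' = w[unfolded S_sel]
  show ?thesis
    unfolding S_mult
    by (rule LH.P.lift_cong_strong[OF z'], rule LH.P.lift_cong_strong[OF w']) (simp add: comul_lift_def)
qed

lemma S_mult_bilin: "bilin K S S S (monoid.mult S)"
proof (rule bilinI)
  show "lin K S S (\<lambda>z. z \<otimes>\<^bsub>S\<^esub> w)" if w: "w \<in> carrier S" for w
    by (rule lin_cong[OF module_S S_mult_comul_lift[OF _ w]], assumption, rule LH.lift_lin)
      (rule lin_intro LH.lin_lift_body | simp add: w)+
  show "lin K S S (\<lambda>w. z \<otimes>\<^bsub>S\<^esub> w)" if z: "z \<in> carrier S" for z
    by (rule lin_cong[OF module_S S_mult_comul_lift[OF z]], assumption)
      (rule LH.lin_lift_body lin_intro LH.lift_lin | simp add: z)+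
qed

lemma S_mult_pure:
  assumes "l \<in> carrier L" "f \<in> carrier H" "m \<in> carrier L" "g \<in> carrier H"
  shows "(l \<sharp> f) \<otimes>\<^bsub>S\<^esub> (m \<sharp> g) = \<Delta> S f (\<lambda>f1 f2. (l \<otimes>\<^bsub>L\<^esub> (f1 \<rhd> m)) \<sharp> (f2 \<otimes>\<^bsub>H\<^esub> g))"
proof -
  have "(l \<sharp> f) \<otimes>\<^bsub>S\<^esub> (m \<sharp> g) = tensor_lift S (\<lambda>m g.
      \<Delta> S f (\<lambda>f1 f2. (l \<otimes>\<^bsub>L\<^esub> (f1 \<rhd> m)) \<sharp> (f2 \<otimes>\<^bsub>H\<^esub> g))) (m \<sharp> g)"
    unfolding S_mult_comul_lift[OF LH.pure_in[OF assms(1,2)] LH.pure_in[OF assms(3,4)]]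
    by (rule LH.lift_pure) (rule lin_intro LH.lin_lift_body | simp add: assms)+
  also have "\<dots> = \<Delta> S f (\<lambda>f1 f2. (l \<otimes>\<^bsub>L\<^esub> (f1 \<rhd> m)) \<sharp> (f2 \<otimes>\<^bsub>H\<^esub> g))"
    by (rule LH.lift_pure) (rule lin_intro LH.lin_lift_body | simp add: assms)+
  finally show ?thesis .
qed

lemma S_mult_closed [simp]: "z \<in> carrier S \<Longrightarrow> w \<in> carrier S \<Longrightarrow> z \<otimes>\<^bsub>S\<^esub> w \<in> carrier S"
  by (rule bilinD(3)[OF S_mult_bilin])

lemma S_mult_left_lin [lin_intro]: "lin K N S t \<Longrightarrow> w \<in> carrier S \<Longrightarrow> lin K N S (\<lambda>x. t x \<otimes>\<^bsub>S\<^esub> w)"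
  by (rule lin_comp[OF bilinD(1)[OF S_mult_bilin]])

lemma S_mult_right_lin [lin_intro]: "lin K N S t \<Longrightarrow> z \<in> carrier S \<Longrightarrow> lin K N S (\<lambda>x. z \<otimes>\<^bsub>S\<^esub> t x)"
  by (rule lin_comp[OF bilinD(2)[OF S_mult_bilin]])

text \<open>Instances of \<open>comul_lift_hom\<close> that let the simplifier move Sweedler sums
  out of products and out of either slot of a tensor.\<close>

lemmas comul_lift_S_pull = H.comul_lift_hom[OF module_S bilinD(1)[OF S_mult_bilin] module_S]
  H.comul_lift_hom[OF module_S bilinD(2)[OF S_mult_bilin] module_S]
lemmas comul_lift_sm_pull = H.comul_lift_hom[OF H.module_H LH.lin_pure2 module_S]
  H.comul_lift_hom[OF module_L LH.lin_pure1 module_S]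
lemmas comul_lift_L_pull = H.comul_lift_hom[OF module_L L.lin_mult1 module_L] H.comul_lift_hom[OF module_L L.lin_mult2 module_L]

text \<open>Both bracketings reduce to the common summand \<open>?F\<close>. The left one uses that
  comultiplication is multiplicative, the right one that \<open>H\<close> acts on products in
  \<open>L\<close> through its coproduct; coassociativity for \<open>f\<close> and an exchange of
  sums match them.\<close>

lemma S_assoc_pure:
  assumes [simp]: "l \<in> carrier L" "f \<in> carrier H" "m \<in> carrier L" "g \<in> carrier H" "n \<in> carrier L" "h \<in> carrier H"
  shows "((l \<sharp> f) \<otimes>\<^bsub>S\<^esub> (m \<sharp> g)) \<otimes>\<^bsub>S\<^esub> (n \<sharp> h) = (l \<sharp> f) \<otimes>\<^bsub>S\<^esub> ((m \<sharp> g) \<otimes>\<^bsub>S\<^esub> (n \<sharp> h))"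
proof -
  let ?F = "\<lambda>f1 f2 f3 g1 g2. (l \<otimes>\<^bsub>L\<^esub> ((f1 \<rhd> m) \<otimes>\<^bsub>L\<^esub> (f2 \<rhd> g1 \<rhd> n))) \<sharp> (f3 \<otimes>\<^bsub>H\<^esub> (g2 \<otimes>\<^bsub>H\<^esub> h))"
  have "((l \<sharp> f) \<otimes>\<^bsub>S\<^esub> (m \<sharp> g)) \<otimes>\<^bsub>S\<^esub> (n \<sharp> h) =
      \<Delta> S f (\<lambda>f1 r. \<Delta> S (r \<otimes>\<^bsub>H\<^esub> g) (\<lambda>u v. (l \<otimes>\<^bsub>L\<^esub> (f1 \<rhd> m) \<otimes>\<^bsub>L\<^esub> (u \<rhd> n)) \<sharp> (v \<otimes>\<^bsub>H\<^esub> h)))"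
    by (simp add: S_mult_pure comul_lift_S_pull)
  also have "\<dots> = \<Delta> S f (\<lambda>f1 r. \<Delta> S r (\<lambda>f2 f3. \<Delta> S g (\<lambda>g1 g2.
     (l \<otimes>\<^bsub>L\<^esub> (f1 \<rhd> m) \<otimes>\<^bsub>L\<^esub> ((f2 \<otimes>\<^bsub>H\<^esub> g1) \<rhd> n)) \<sharp> ((f3 \<otimes>\<^bsub>H\<^esub> g2) \<otimes>\<^bsub>H\<^esub> h))))"
    by (intro H.comul_lift_cong H.comul_lift_mult[OF module_S]) (rule lin_intro | simp)+
  also have "\<dots> = \<Delta> S f (\<lambda>f1 r. \<Delta> S r (\<lambda>f2 f3. \<Delta> S g (\<lambda>g1 g2. ?F f1 f2 f3 g1 g2)))"
    by (intro H.comul_lift_cong) (simp add: act_mult L.m_assoc H.m_assoc)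
  also have "\<dots> = \<Delta> S f (\<lambda>r f3. \<Delta> S r (\<lambda>f1 f2. \<Delta> S g (\<lambda>g1 g2. ?F f1 f2 f3 g1 g2)))"
    by (rule H.comul_lift_coassoc[OF module_S, symmetric]) (rule lin_intro | simp)+
  also have "\<dots> = \<Delta> S f (\<lambda>r f3. \<Delta> S g (\<lambda>g1 g2. \<Delta> S r (\<lambda>f1 f2. ?F f1 f2 f3 g1 g2)))"
    by (intro H.comul_lift_cong H.comul_lift_fubini[OF module_S]) simp
  also have "\<dots> = \<Delta> S g (\<lambda>g1 g2. \<Delta> S f (\<lambda>r f3. \<Delta> S r (\<lambda>f1 f2. ?F f1 f2 f3 g1 g2)))"
    by (rule H.comul_lift_fubini[OF module_S]) (simp add: H.comul_lift_closed[OF module_S])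
  also have "\<dots> = (l \<sharp> f) \<otimes>\<^bsub>S\<^esub> ((m \<sharp> g) \<otimes>\<^bsub>S\<^esub> (n \<sharp> h))"
    by (simp add: S_mult_pure comul_lift_S_pull comul_lift_act_mult comul_lift_L_pull comul_lift_sm_pull)
  finally show ?thesis .
qed

end

section \<open>The smash product algebra\<close>

text \<open>A bimodule over \<open>A\<close> becomes a \<open>K\<close>-module by letting a scalar
  act as the corresponding multiple of the unit of \<open>A\<close>. This makes tensor products over
  the noncommutative base targets for the Sweedler calculus over \<open>K\<close>.\<close>

definition base_module :: "('k, 'l, 'x) module_scheme \<Rightarrow> ('l, 'm, 'y) bimodule_scheme \<Rightarrow> ('k, 'm) module" where
  "base_module A M = \<lparr>carrier = carrier M, monoid.mult = monoid.mult M, one = one M, ring.zero = ring.zero M, add = add M,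
     smult = (\<lambda>c. lact M (c \<odot>\<^bsub>A\<^esub> \<one>\<^bsub>A\<^esub>))\<rparr>"

lemma base_module_sel [simp]:
  "carrier (base_module A M) = carrier M" "add (base_module A M) = add M" "ring.zero (base_module A M) = ring.zero M"
  "smult (base_module A M) c = lact M (c \<odot>\<^bsub>A\<^esub> \<one>\<^bsub>A\<^esub>)"
  by (simp_all add: base_module_def)

text \<open>The axiom \<open>central\<close> says that scalars act equally from both sides. It is
  needed for linearity of \<open>pure\<close> in its right argument, where the scalar has to cross
  the tensor sign.\<close>

locale central_bimod = A: assoc_algebra K A + bimod A M
  for K :: "'k ring" and A :: "('k, 'a, 'x) module_scheme" and M :: "('a, 'm, 'y) bimodule_scheme" +
  assumes lact_plus: "\<lbrakk>r \<in> carrier A; s \<in> carrier A; x \<in> carrier M\<rbrakk>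
      \<Longrightarrow> lact M (r \<oplus>\<^bsub>A\<^esub> s) x = lact M r x \<oplus>\<^bsub>M\<^esub> lact M s x"
    and lact_mult: "\<lbrakk>r \<in> carrier A; s \<in> carrier A; x \<in> carrier M\<rbrakk>
      \<Longrightarrow> lact M (r \<otimes>\<^bsub>A\<^esub> s) x = lact M r (lact M s x)"
    and lact_one: "x \<in> carrier M \<Longrightarrow> lact M \<one>\<^bsub>A\<^esub> x = x"
    and central: "\<lbrakk>c \<in> carrier K; x \<in> carrier M\<rbrakk>
      \<Longrightarrow> lact M (c \<odot>\<^bsub>A\<^esub> \<one>\<^bsub>A\<^esub>) x = ract M x (c \<odot>\<^bsub>A\<^esub> \<one>\<^bsub>A\<^esub>)"
begin

lemma scal_mult: "\<lbrakk>c \<in> carrier K; r \<in> carrier A\<rbrakk> \<Longrightarrow> (c \<odot>\<^bsub>A\<^esub> \<one>\<^bsub>A\<^esub>) \<otimes>\<^bsub>A\<^esub> r = c \<odot>\<^bsub>A\<^esub> r"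
  "\<lbrakk>c \<in> carrier K; r \<in> carrier A\<rbrakk> \<Longrightarrow> r \<otimes>\<^bsub>A\<^esub> (c \<odot>\<^bsub>A\<^esub> \<one>\<^bsub>A\<^esub>) = c \<odot>\<^bsub>A\<^esub> r"
  by (simp_all add: A.smult_mult_left A.smult_mult_right)

lemma base_module_module: "module K (base_module A M)"
proof (rule moduleI)
  show "abelian_group (base_module A M)"
    by (rule abelian_group_cong[OF M.abelian_group_axioms]) simp_all
qed (auto simp: A.R.cring_axioms lact_closed lact_add lact_one A.smult_l_distr lact_plus
    lact_mult[symmetric] scal_mult A.smult_assoc1[symmetric] A.R.m_comm)

lemma lact_lin: "r \<in> carrier A \<Longrightarrow> lin K (base_module A M) (base_module A M) (lact M r)"
  by (rule linI) (auto simp: lact_closed lact_add lact_mult[symmetric] scal_mult)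

lemma ract_lin: "r \<in> carrier A \<Longrightarrow> lin K (base_module A M) (base_module A M) (\<lambda>x. ract M x r)"
  by (rule linI) (auto simp: ract_closed ract_add lact_ract[symmetric])

end

locale central_pair = M: central_bimod K A M + N: central_bimod K A N
  for K :: "'k ring" and A :: "('k, 'a, 'x) module_scheme" and M :: "('a, 'm, 'y) bimodule_scheme"
    and N :: "('a, 'n, 'z) bimodule_scheme"
begin

sublocale P: tensor_pair A M N ..

text \<open>Stability under tensor products supplies the \<open>K\<close>-module structure on the
  threefold tensor product in which coassociativity of the coproduct is compared.\<close>

lemma T_central: "central_bimod K A (tensor A M N)"
proof unfold_locales
  note [simp] = P.lact_pure P.ract_pure M.lact_closed N.ract_closed M.ract_closed N.lact_closed
    P.T.lact_closed P.T.ract_closed P.T.lact_add P.T.ract_add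
  show "lact (tensor A M N) (r \<oplus>\<^bsub>A\<^esub> s) z = lact (tensor A M N) r z \<oplus>\<^bsub>tensor A M N\<^esub> lact (tensor A M N) s z"
    if "r \<in> carrier A" "s \<in> carrier A" "z \<in> carrier (tensor A M N)" for r s z
    using that(3)
    by (induction rule: P.T_induct) (use that in \<open>simp_all add: M.lact_plus P.pure_add_left P.T.a_ac\<close>)
  show "lact (tensor A M N) (r \<otimes>\<^bsub>A\<^esub> s) z = lact (tensor A M N) r (lact (tensor A M N) s z)"
    if "r \<in> carrier A" "s \<in> carrier A" "z \<in> carrier (tensor A M N)" for r s z
    using that(3) by (induction rule: P.T_induct) (use that in \<open>simp_all add: M.lact_mult\<close>)
  show "lact (tensor A M N) \<one>\<^bsub>A\<^esub> z = z" if "z \<in> carrier (tensor A M N)" for z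
    using that by (induction rule: P.T_induct) (simp_all add: M.lact_one)
  show "lact (tensor A M N) (c \<odot>\<^bsub>A\<^esub> \<one>\<^bsub>A\<^esub>) z = ract (tensor A M N) z (c \<odot>\<^bsub>A\<^esub> \<one>\<^bsub>A\<^esub>)"
    if "c \<in> carrier K" "z \<in> carrier (tensor A M N)" for c z
    using that(2)
    by (induction rule: P.T_induct)
      (use that in \<open>simp_all add: M.central N.central[symmetric] P.pure_balanced\<close>)
qed

lemma lin_pure_left: "lin K Q (base_module A M) t \<Longrightarrow> y \<in> carrier N \<Longrightarrow> lin K Q (base_module A (tensor A M N)) (\<lambda>x. pure A M N (t x) y)"
  by (rule lin_comp, rule linI) (auto simp: P.pure_add_left P.lact_pure)

lemma lin_pure_right: "lin K Q (base_module A N) t \<Longrightarrow> y \<in> carrier M \<Longrightarrow> lin K Q (base_module A (tensor A M N)) (\<lambda>x. pure A M N y (t x))"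
  by (rule lin_comp, rule linI) (auto simp: P.pure_add_right P.lact_pure M.central P.pure_balanced)

end

lemma comul_lift_target:
  "\<lbrakk>carrier A = carrier B; add A = add B; ring.zero A = ring.zero B\<rbrakk> \<Longrightarrow> comul_lift H A = comul_lift H B"
  by (intro ext) (simp add: comul_lift_def tensor_lift_cong_target[of A B])

text \<open>For maps between tensor products over \<open>L\<close> of which only additivity is
  recorded. The zero default of \<open>comul_lift\<close> is still preserved.\<close>

lemma (in hopf_algebra) comul_lift_hom_additive_map:
  assumes "abelian_group N" "abelian_group B" "additive_map N B \<phi>"
    and "\<And>x y. x \<in> carrier H \<Longrightarrow> y \<in> carrier H \<Longrightarrow> f x y \<in> carrier N"
  shows "\<phi> (\<Delta> N h f) = \<Delta> B h (\<lambda>x y. \<phi> (f x y))"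
  unfolding comul_lift_def
  using HH.P.lift_hom[OF comul_in assms(1-3), of h f] additive_map_zero[OF assms(1-3)] assms(4) by simp

context base_algebra
begin

lemma S_assoc:
  assumes x: "x \<in> carrier S" and y: "y \<in> carrier S" and z: "z \<in> carrier S"
  shows "(x \<otimes>\<^bsub>S\<^esub> y) \<otimes>\<^bsub>S\<^esub> z = x \<otimes>\<^bsub>S\<^esub> (y \<otimes>\<^bsub>S\<^esub> z)"
proof -
  have 1: "((l \<sharp> f) \<otimes>\<^bsub>S\<^esub> (m \<sharp> g)) \<otimes>\<^bsub>S\<^esub> z = (l \<sharp> f) \<otimes>\<^bsub>S\<^esub> ((m \<sharp> g) \<otimes>\<^bsub>S\<^esub> z)"
    if "l \<in> carrier L" "f \<in> carrier H" "m \<in> carrier L" "g \<in> carrier H" for l f m g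
    by (rule LH.lin_eqI[OF _ _ _ z]) (rule lin_intro S_assoc_pure | simp add: that)+
  have 2: "((l \<sharp> f) \<otimes>\<^bsub>S\<^esub> y) \<otimes>\<^bsub>S\<^esub> z = (l \<sharp> f) \<otimes>\<^bsub>S\<^esub> (y \<otimes>\<^bsub>S\<^esub> z)"
    if "l \<in> carrier L" "f \<in> carrier H" for l f
    by (rule LH.lin_eqI[OF _ _ _ y]) (rule lin_intro 1 | simp add: that z)+
  show ?thesis
    by (rule LH.lin_eqI[OF _ _ _ x]) (rule lin_intro 2 | simp add: y z)+
qed

lemma src_mult:
  "\<lbrakk>l \<in> carrier L; m \<in> carrier L; h \<in> carrier H\<rbrakk> \<Longrightarrow> src S l \<otimes>\<^bsub>S\<^esub> (m \<sharp> h) = (l \<otimes>\<^bsub>L\<^esub> m) \<sharp> h"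
  unfolding S_sel
  by (subst S_mult_pure, simp_all, subst H.comul_lift_one[OF module_S]) (rule lin_intro | simp add: act_one)+

lemma S_l_one: "z \<in> carrier S \<Longrightarrow> \<one>\<^bsub>S\<^esub> \<otimes>\<^bsub>S\<^esub> z = z"
  by (rule LH.lin_eqI[where f="\<lambda>z. \<one>\<^bsub>S\<^esub> \<otimes>\<^bsub>S\<^esub> z" and g="\<lambda>z. z"])
    (use src_mult[of "\<one>\<^bsub>L\<^esub>"] in \<open>auto intro!: lin_intro simp: S_sel(5,6)\<close>)

lemma S_r_one: "z \<in> carrier S \<Longrightarrow> z \<otimes>\<^bsub>S\<^esub> \<one>\<^bsub>S\<^esub> = z"
proof (rule LH.lin_eqI[where f="\<lambda>z. z \<otimes>\<^bsub>S\<^esub> \<one>\<^bsub>S\<^esub>" and g="\<lambda>z. z"])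
  show "(l \<sharp> h) \<otimes>\<^bsub>S\<^esub> \<one>\<^bsub>S\<^esub> = l \<sharp> h" if "l \<in> carrier L" "h \<in> carrier H" for l h
  proof -
    have "(l \<sharp> h) \<otimes>\<^bsub>S\<^esub> \<one>\<^bsub>S\<^esub> = \<Delta> S h (\<lambda>x y. \<epsilon> x \<odot>\<^bsub>S\<^esub> (l \<sharp> y))"
      using that by (simp add: S_sel(5) S_mult_pure act_on_one L.smult_mult_right LH.smult_pure_left)
    also have "\<dots> = l \<sharp> h"
      by (rule H.comul_lift_counit_left[OF module_S]) (rule lin_intro | simp add: that)+
    finally show ?thesis .
  qed
qed (auto intro!: lin_intro simp: S_sel(5))

lemma S_one_closed [simp]: "\<one>\<^bsub>S\<^esub> \<in> carrier S"
  by (simp add: S_sel(5) LH.pure_in)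

lemma S_algebra: "assoc_algebra K S"
proof -
  have "ring S"
    by (rule ringI[OF LH.Z.M.abelian_group_axioms])
      (auto intro!: monoidI simp: S_assoc S_l_one S_r_one linD(2)[OF bilinD(1)[OF S_mult_bilin]]
        linD(2)[OF bilinD(2)[OF S_mult_bilin]])
  then show ?thesis
    by (auto intro!: assoc_algebra.intro assoc_algebra_axioms.intro LH.Z_module
      simp: linD(3)[OF bilinD(1)[OF S_mult_bilin]] linD(3)[OF bilinD(2)[OF S_mult_bilin]])
qed

sublocale S: assoc_algebra K S by (rule S_algebra)

lemma src_closed [simp]: "l \<in> carrier L \<Longrightarrow> src S l \<in> carrier S"
  by (simp add: S_sel(6) LH.pure_in)

lemma lin_src: "lin K L S (src S)"
  unfolding S_sel(6) by (rule lin_intro | simp)+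

lemma src_src: "\<lbrakk>l \<in> carrier L; m \<in> carrier L\<rbrakk> \<Longrightarrow> src S (l \<otimes>\<^bsub>L\<^esub> m) = src S l \<otimes>\<^bsub>S\<^esub> src S m"
  using src_mult[of l m "\<one>\<^bsub>H\<^esub>"] by (simp add: S_sel(6))

lemma src_one: "src S \<one>\<^bsub>L\<^esub> = \<one>\<^bsub>S\<^esub>"
  by (simp only: S_sel(5,6))

lemma src_alg_hom: "src S \<in> algebra_hom K L S"
  using src_src linD[OF lin_src] src_one by (auto simp: algebra_hom_def ring_hom_def)

end

section \<open>The target map of the smash product\<close>

locale bij_base = base_algebra K H L + H: bij_hopf K H
  for K :: "'k ring" and H :: "('k, 'h, 'x) hopf_scheme"
    and L :: "('k, 'h, 'l, 'y) base_alg_scheme"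
begin

abbreviation "\<iota> \<equiv> antipode_inv H"

lemmas L_pulls = coact_lift_hom[OF module_S bilinD(1)[OF S_mult_bilin] module_S]
  coact_lift_hom[OF module_S bilinD(2)[OF S_mult_bilin] module_S]
  coact_lift_hom[OF H.module_H LH.lin_pure2 module_S]
  coact_lift_hom[OF module_L LH.lin_pure1 module_S]
  coact_lift_hom[OF module_L L.lin_mult1 module_L] coact_lift_hom[OF module_L L.lin_mult2 module_L]

text \<open>Braided commutativity turns \<open>n (\<iota>(p) \<rhd> m)\<close> into
  \<open>(q \<iota>(p) \<rhd> m) n'\<close> with \<open>q\<close> the coaction leg of
  \<open>n\<close>. By coassociativity \<open>p\<close> and \<open>q\<close> are the two legs of one
  element, and \<open>p2 \<iota>(p1)\<close> collapses to the counit.\<close>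

lemma braided_op:
  assumes [simp]: "l \<in> carrier L" "m \<in> carrier L"
  shows "\<delta> L l (\<lambda>p n. n \<otimes>\<^bsub>L\<^esub> (\<iota> p \<rhd> m)) = m \<otimes>\<^bsub>L\<^esub> l"
proof -
  have "\<delta> L l (\<lambda>p n. n \<otimes>\<^bsub>L\<^esub> (\<iota> p \<rhd> m)) = \<delta> L l (\<lambda>p n. \<delta> L n (\<lambda>q n'. ((q \<otimes>\<^bsub>H\<^esub> \<iota> p) \<rhd> m) \<otimes>\<^bsub>L\<^esub> n'))"
    by (intro coact_lift_cong) (simp add: coact_lift_braided act_mult)
  also have "\<dots> = \<delta> L l (\<lambda>p n. \<Delta> L p (\<lambda>u v. ((v \<otimes>\<^bsub>H\<^esub> \<iota> u) \<rhd> m) \<otimes>\<^bsub>L\<^esub> n))"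
    by (rule coact_lift_coassoc[OF module_L, symmetric]) (rule lin_intro | simp)+
  also have "\<dots> = \<delta> L l (\<lambda>p n. \<epsilon> p \<odot>\<^bsub>L\<^esub> ((\<one>\<^bsub>H\<^esub> \<rhd> m) \<otimes>\<^bsub>L\<^esub> n))"
    by (intro coact_lift_cong H.comul_lift_antipode_inv_left[OF module_L]) (rule lin_intro | simp)+
  also have "\<dots> = (\<one>\<^bsub>H\<^esub> \<rhd> m) \<otimes>\<^bsub>L\<^esub> l"
    by (rule coact_lift_counit[OF module_L]) (rule lin_intro | simp)+
  finally show ?thesis by (simp add: act_one)
qed

lemma tgt_closed [simp]: "l \<in> carrier L \<Longrightarrow> tgt S l \<in> carrier S"
  by (simp add: S_tgt)

lemma lin_tgt: "lin K L S (tgt S)"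
  by (rule lin_cong[OF module_L S_tgt]) (rule lin_intro | simp)+

lemma tgt_mult:
  assumes [simp]: "l \<in> carrier L" "m \<in> carrier L" "h \<in> carrier H"
  shows "tgt S l \<otimes>\<^bsub>S\<^esub> (m \<sharp> h) = \<delta> S l (\<lambda>p n. (m \<otimes>\<^bsub>L\<^esub> n) \<sharp> (\<iota> p \<otimes>\<^bsub>H\<^esub> h))"
proof -
  have "tgt S l \<otimes>\<^bsub>S\<^esub> (m \<sharp> h) = \<delta> S l (\<lambda>p n. \<Delta> S (\<iota> p) (\<lambda>a b. (n \<otimes>\<^bsub>L\<^esub> (a \<rhd> m)) \<sharp> (b \<otimes>\<^bsub>H\<^esub> h)))"
    by (simp add: S_tgt L_pulls S_mult_pure)
  \<comment> \<open>The inverse antipode reverses the legs, so the factor acting on \<open>m\<close>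
    comes from the second leg of \<open>p\<close>. Coassociativity hands that leg to the coaction of
    \<open>n\<close>, which is the shape required by \<open>braided_op\<close>.\<close>
  also have "\<dots> = \<delta> S l (\<lambda>p n. \<Delta> S p (\<lambda>x y. (n \<otimes>\<^bsub>L\<^esub> (\<iota> y \<rhd> m)) \<sharp> (\<iota> x \<otimes>\<^bsub>H\<^esub> h)))"
    by (intro coact_lift_cong H.antipode_inv_comul[OF module_S]) (rule lin_intro | simp)+
  also have "\<dots> = \<delta> S l (\<lambda>p n. \<delta> S n (\<lambda>q n'. (n' \<otimes>\<^bsub>L\<^esub> (\<iota> q \<rhd> m)) \<sharp> (\<iota> p \<otimes>\<^bsub>H\<^esub> h)))"
    by (rule coact_lift_coassoc[OF module_S]) (rule lin_intro | simp)+
  also have "\<dots> = \<delta> S l (\<lambda>p n. \<delta> L n (\<lambda>q n'. n' \<otimes>\<^bsub>L\<^esub> (\<iota> q \<rhd> m)) \<sharp> (\<iota> p \<otimes>\<^bsub>H\<^esub> h))"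
    by (intro coact_lift_cong) (simp add: L_pulls)
  also have "\<dots> = \<delta> S l (\<lambda>p n. (m \<otimes>\<^bsub>L\<^esub> n) \<sharp> (\<iota> p \<otimes>\<^bsub>H\<^esub> h))"
    by (intro coact_lift_cong) (simp add: braided_op)
  finally show ?thesis .
qed

lemma tgt_tgt:
  assumes [simp]: "l \<in> carrier L" "m \<in> carrier L"
  shows "tgt S (m \<otimes>\<^bsub>L\<^esub> l) = tgt S l \<otimes>\<^bsub>S\<^esub> tgt S m"
proof -
  have "tgt S l \<otimes>\<^bsub>S\<^esub> tgt S m = \<delta> S m (\<lambda>q n. \<delta> S l (\<lambda>p n'. (n \<otimes>\<^bsub>L\<^esub> n') \<sharp> (\<iota> p \<otimes>\<^bsub>H\<^esub> \<iota> q)))"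
    by (simp add: S_tgt[of m] L_pulls tgt_mult)
  also have "\<dots> = \<delta> S (m \<otimes>\<^bsub>L\<^esub> l) (\<lambda>p n. n \<sharp> \<iota> p)"
    by (subst coact_lift_mult[OF module_S]) (rule lin_intro | simp add: H.antipode_inv_mult)+
  finally show ?thesis by (simp add: S_tgt)
qed

lemma tgt_one: "tgt S \<one>\<^bsub>L\<^esub> = \<one>\<^bsub>S\<^esub>"
  by (subst S_tgt, simp, subst coact_lift_one[OF module_S]) (rule lin_intro | simp add: H.antipode_inv_one S_sel(5))+

lemma tgt_alg_hom: "tgt S \<in> algebra_hom K (op_alg L) S"
  using tgt_tgt linD[OF lin_tgt] tgt_one by (auto simp: algebra_hom_def ring_hom_def op_alg_def)

text \<open>A source multiplies the \<open>L\<close>-slot on the left, while by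
  \<open>tgt_mult\<close> a target multiplies it on the right and changes only the
  \<open>H\<close>-slot besides; the two operations do not interfere.\<close>

lemma src_tgt:
  assumes [simp]: "l \<in> carrier L" "m \<in> carrier L"
  shows "src S l \<otimes>\<^bsub>S\<^esub> tgt S m = tgt S m \<otimes>\<^bsub>S\<^esub> src S l"
proof -
  have "src S l \<otimes>\<^bsub>S\<^esub> tgt S m = \<delta> S m (\<lambda>p n. (l \<otimes>\<^bsub>L\<^esub> n) \<sharp> \<iota> p)"
    by (simp add: S_tgt L_pulls src_mult)
  also have "\<dots> = tgt S m \<otimes>\<^bsub>S\<^esub> src S l"
    by (simp add: S_sel(6) tgt_mult)
  finally show ?thesis .
qed

end

lemma st_bimodule_sel [simp]:
  "carrier (st_bimodule B) = carrier B" "monoid.mult (st_bimodule B) = monoid.mult B"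
  "one (st_bimodule B) = one B" "add (st_bimodule B) = add B" "ring.zero (st_bimodule B) = ring.zero B"
  "lact (st_bimodule B) l a = src B l \<otimes>\<^bsub>B\<^esub> a" "ract (st_bimodule B) a l = tgt B l \<otimes>\<^bsub>B\<^esub> a"
  by (simp_all add: st_bimodule_def)

text \<open>Centrality holds because source and target are both \<open>K\<close>-linear and unital,
  so they send a multiple of the unit to the same multiple of the unit.\<close>

lemma st_central_bimod:
  assumes "assoc_algebra K A" "assoc_algebra K B" "src B \<in> algebra_hom K A B"
    "tgt B \<in> algebra_hom K (op_alg A) B"
    and comm: "\<And>l m. \<lbrakk>l \<in> carrier A; m \<in> carrier A\<rbrakk> \<Longrightarrow> src B l \<otimes>\<^bsub>B\<^esub> tgt B m = tgt B m \<otimes>\<^bsub>B\<^esub> src B l"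
  shows "central_bimod K A (st_bimodule B)"
proof -
  interpret A: assoc_algebra K A by fact
  interpret B: assoc_algebra K B by fact
  have s: "\<And>l. l \<in> carrier A \<Longrightarrow> src B l \<in> carrier B" "src B \<one>\<^bsub>A\<^esub> = \<one>\<^bsub>B\<^esub>"
     "\<And>l m. \<lbrakk>l \<in> carrier A; m \<in> carrier A\<rbrakk> \<Longrightarrow> src B (l \<oplus>\<^bsub>A\<^esub> m) = src B l \<oplus>\<^bsub>B\<^esub> src B m"
     "\<And>l m. \<lbrakk>l \<in> carrier A; m \<in> carrier A\<rbrakk> \<Longrightarrow> src B (l \<otimes>\<^bsub>A\<^esub> m) = src B l \<otimes>\<^bsub>B\<^esub> src B m"
     "\<And>c l. \<lbrakk>c \<in> carrier K; l \<in> carrier A\<rbrakk> \<Longrightarrow> src B (c \<odot>\<^bsub>A\<^esub> l) = c \<odot>\<^bsub>B\<^esub> src B l"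
    using assms(3) by (auto simp: algebra_hom_def ring_hom_def)
  have t: "\<And>l. l \<in> carrier A \<Longrightarrow> tgt B l \<in> carrier B" "tgt B \<one>\<^bsub>A\<^esub> = \<one>\<^bsub>B\<^esub>"
     "\<And>c l. \<lbrakk>c \<in> carrier K; l \<in> carrier A\<rbrakk> \<Longrightarrow> tgt B (c \<odot>\<^bsub>A\<^esub> l) = c \<odot>\<^bsub>B\<^esub> tgt B l"
    using assms(4) by (auto simp: algebra_hom_def ring_hom_def op_alg_def)
  interpret BB: abelian_group "st_bimodule B"
    by (rule abelian_group_cong[OF B.M.abelian_group_axioms]) simp_all
  show ?thesis
    by unfold_locales
      (simp_all add: s t B.r_distr B.l_distr B.m_assoc[symmetric] comm)
qed

section \<open>The smash product bialgebroid\<close>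

context tensor_pair
begin

lemma rmult_eq: "tensor_rmult R M N z c d = tensor_lift T (\<lambda>a b. pure R M N (a \<otimes>\<^bsub>M\<^esub> c) (b \<otimes>\<^bsub>N\<^esub> d)) z"
  unfolding tensor_rmult_def tensor_lift_cong_target[OF T_group_sel] ..

lemma mult_eq: "z \<otimes>\<^bsub>T\<^esub> w = tensor_lift T (tensor_rmult R M N z) w"
  unfolding tensor_lift_cong_target[OF T_group_sel, symmetric]
  by (simp only: tensor_def Let_def partial_object.simps monoid.simps)

end

lemma assoc_algebra_cong:
  assumes "assoc_algebra K A" "carrier B = carrier A" "add B = add A" "ring.zero B = ring.zero A"
    "monoid.mult B = monoid.mult A" "one B = one A" "smult B = smult A"
  shows "assoc_algebra K B"
proof -
  interpret A: assoc_algebra K A by fact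
  have ab: "abelian_group B"
    by (rule abelian_group_cong[OF A.M.abelian_group_axioms]) (simp_all add: assms)
  have "ring B"
    by (rule ringI[OF ab]) (auto intro!: monoidI simp: assms A.m_assoc A.l_distr A.r_distr)
  moreover have "module K B"
    by (rule moduleI[OF A.R.cring_axioms ab])
      (simp_all add: assms A.smult_l_distr A.smult_r_distr A.smult_assoc1)
  ultimately show ?thesis
    by (auto intro!: assoc_algebra.intro assoc_algebra_axioms.intro
      simp: assms A.smult_mult_left A.smult_mult_right)
qed

text \<open>A bialgebroid without coproduct and counit. The tensor products over the base can thus
  be set up for the smash algebra before its coproduct exists, and likewise for the
  coopposite.\<close>

locale st_alg = A: assoc_algebra K A + B: assoc_algebra K B
  for K :: "'k ring" and A :: "('k, 'l, 'x) module_scheme" and B :: "('k, 'l, 'b, 'y) st_algebra_scheme" +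
  assumes src_hom: "src B \<in> algebra_hom K A B"
    and tgt_antihom: "tgt B \<in> algebra_hom K (op_alg A) B"
    and src_tgt_commute: "\<lbrakk>l \<in> carrier A; m \<in> carrier A\<rbrakk> \<Longrightarrow>
          src B l \<otimes>\<^bsub>B\<^esub> tgt B m = tgt B m \<otimes>\<^bsub>B\<^esub> src B l"
begin

lemma src_in [simp]: "l \<in> carrier A \<Longrightarrow> src B l \<in> carrier B"
  using src_hom by (auto simp: algebra_hom_def ring_hom_def)

lemma tgt_in [simp]: "l \<in> carrier A \<Longrightarrow> tgt B l \<in> carrier B"
  using tgt_antihom by (auto simp: algebra_hom_def ring_hom_def op_alg_def)

lemma st_central: "central_bimod K A (st_bimodule B)"
  by (rule st_central_bimod[OF A.assoc_algebra_axioms B.assoc_algebra_axioms src_hom tgt_antihom src_tgt_commute])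

sublocale C: central_bimod K A "st_bimodule B" by (rule st_central)

sublocale T2: central_pair K A "st_bimodule B" "st_bimodule B" ..

sublocale TC: central_bimod K A "st_tensor A B" by (rule T2.T_central)

sublocale T3: central_pair K A "st_bimodule B" "st_tensor A B" ..

sublocale T3C: central_bimod K A "tensor A (st_bimodule B) (st_tensor A B)" by (rule T3.T_central)

sublocale T3': central_pair K A "st_tensor A B" "st_bimodule B" ..

sublocale A3: tensor_triple A "st_bimodule B" "st_bimodule B" "st_bimodule B" ..

abbreviation st (infix "\<diamondop>" 66) where "x \<diamondop> y \<equiv> st_pure A B x y"

lemma st_in [simp, intro]: "x \<in> carrier B \<Longrightarrow> y \<in> carrier B \<Longrightarrow> x \<diamondop> y \<in> carrier (st_tensor A B)"
  by (rule T2.P.pure_closed) simp_all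

lemma st_balanced: "\<lbrakk>x \<in> carrier B; r \<in> carrier A; y \<in> carrier B\<rbrakk> \<Longrightarrow>
    (tgt B r \<otimes>\<^bsub>B\<^esub> x) \<diamondop> y = x \<diamondop> (src B r \<otimes>\<^bsub>B\<^esub> y)"
  using T2.P.pure_balanced[of x r y] by simp

abbreviation rm where "rm z c d \<equiv> tensor_rmult A (st_bimodule B) (st_bimodule B) z c d"

lemma st_add_left: "\<lbrakk>x \<in> carrier B; x' \<in> carrier B; y \<in> carrier B\<rbrakk>
    \<Longrightarrow> (x \<oplus>\<^bsub>B\<^esub> x') \<diamondop> y = x \<diamondop> y \<oplus>\<^bsub>st_tensor A B\<^esub> x' \<diamondop> y"
  and st_add_right: "\<lbrakk>x \<in> carrier B; y \<in> carrier B; y' \<in> carrier B\<rbrakk>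
    \<Longrightarrow> x \<diamondop> (y \<oplus>\<^bsub>B\<^esub> y') = x \<diamondop> y \<oplus>\<^bsub>st_tensor A B\<^esub> x \<diamondop> y'"
  using T2.P.pure_add_left T2.P.pure_add_right by simp_all

text \<open>The bimodule actions are left multiplications, hence commute with multiplication on the
  right.\<close>

lemma rm_balanced:
  assumes [simp]: "c \<in> carrier B" "d \<in> carrier B"
  shows "balanced A (st_bimodule B) (st_bimodule B) (st_tensor A B) (\<lambda>x y. (x \<otimes>\<^bsub>B\<^esub> c) \<diamondop> (y \<otimes>\<^bsub>B\<^esub> d))"
  by (rule balancedI)
    (auto intro!: additive_mapI simp: B.l_distr st_add_left st_add_right B.m_assoc st_balanced)

lemma rm_additive_map: "\<lbrakk>c \<in> carrier B; d \<in> carrier B\<rbrakk> \<Longrightarrow> additive_map (st_tensor A B) (st_tensor A B) (\<lambda>z. rm z c d)"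
  unfolding T2.P.rmult_eq using T2.P.lift_additive_map[OF T2.P.T_abelian rm_balanced] by simp

lemma rm_st: "\<lbrakk>x \<in> carrier B; y \<in> carrier B; c \<in> carrier B; d \<in> carrier B\<rbrakk>
    \<Longrightarrow> rm (x \<diamondop> y) c d = (x \<otimes>\<^bsub>B\<^esub> c) \<diamondop> (y \<otimes>\<^bsub>B\<^esub> d)"
  unfolding T2.P.rmult_eq using T2.P.lift_pure[OF T2.P.T_abelian rm_balanced] by simp

lemma rm_in: "\<lbrakk>z \<in> carrier (st_tensor A B); c \<in> carrier B; d \<in> carrier B\<rbrakk> \<Longrightarrow> rm z c d \<in> carrier (st_tensor A B)"
  by (rule additive_map_closed[OF rm_additive_map])

lemma st_induct [consumes 1, case_names pure add]:
  assumes "z \<in> carrier (st_tensor A B)"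
    and "\<And>x y. x \<in> carrier B \<Longrightarrow> y \<in> carrier B \<Longrightarrow> P (x \<diamondop> y)"
    and "\<And>z w. \<lbrakk>z \<in> carrier (st_tensor A B); w \<in> carrier (st_tensor A B); P z; P w\<rbrakk> \<Longrightarrow> P (z \<oplus>\<^bsub>st_tensor A B\<^esub> w)"
  shows "P z"
  using T2.P.T_induct[of z P] assms by simp

lemma rm_rm:
  assumes "z \<in> carrier (st_tensor A B)" "a \<in> carrier B" "b \<in> carrier B" "c \<in> carrier B" "d \<in> carrier B"
  shows "rm (rm z a b) c d = rm z (a \<otimes>\<^bsub>B\<^esub> c) (b \<otimes>\<^bsub>B\<^esub> d)"
  using assms(1)
  by (induction rule: st_induct)
    (use assms in \<open>simp_all add: rm_st B.m_assoc additive_map_add[OF rm_additive_map] rm_in\<close>)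

lemma rm_add_left:
  assumes "z \<in> carrier (st_tensor A B)" "a \<in> carrier B" "b \<in> carrier B" "d \<in> carrier B"
  shows "rm z (a \<oplus>\<^bsub>B\<^esub> b) d = rm z a d \<oplus>\<^bsub>st_tensor A B\<^esub> rm z b d"
  using assms(1)
  by (induction rule: st_induct)
    (use assms in \<open>simp_all add: rm_st B.r_distr additive_map_add[OF rm_additive_map] rm_in st_add_left T2.P.T.a_ac\<close>)

lemma rm_add_right:
  assumes "z \<in> carrier (st_tensor A B)" "a \<in> carrier B" "b \<in> carrier B" "d \<in> carrier B"
  shows "rm z d (a \<oplus>\<^bsub>B\<^esub> b) = rm z d a \<oplus>\<^bsub>st_tensor A B\<^esub> rm z d b"
  using assms(1)
  by (induction rule: st_induct)
    (use assms in \<open>simp_all add: rm_st B.r_distr additive_map_add[OF rm_additive_map] rm_in st_add_right T2.P.T.a_ac\<close>)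

text \<open>Balancing in the factors \<open>c\<close>, \<open>d\<close> of
  \<open>z (c \<otimes> d)\<close> is the Takeuchi condition on \<open>z\<close>, multiplied on the
  right by \<open>c\<close> and \<open>d\<close>. This is what makes the product with
  \<open>z\<close> on the left well defined.\<close>

lemma rm_takeuchi_balanced:
  assumes z: "z \<in> takeuchi A B"
  shows "balanced A (st_bimodule B) (st_bimodule B) (st_tensor A B) (rm z)"
proof (rule balancedI)
  have zin: "z \<in> carrier (st_tensor A B)"
    and zt: "\<And>r. r \<in> carrier A \<Longrightarrow> rm z (tgt B r) \<one>\<^bsub>B\<^esub> = rm z \<one>\<^bsub>B\<^esub> (src B r)"
    using z by (auto simp: takeuchi_def)
  show "additive_map (st_bimodule B) (st_tensor A B) (\<lambda>x. rm z x y)" if "y \<in> carrier (st_bimodule B)" for y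
    by (rule additive_mapI) (use that zin in \<open>auto simp: rm_in rm_add_left\<close>)
  show "additive_map (st_bimodule B) (st_tensor A B) (rm z x)" if "x \<in> carrier (st_bimodule B)" for x
    by (rule additive_mapI) (use that zin in \<open>auto simp: rm_in rm_add_right\<close>)
  fix x r y assume "x \<in> carrier (st_bimodule B)" "r \<in> carrier A" "y \<in> carrier (st_bimodule B)"
  then have h: "x \<in> carrier B" "r \<in> carrier A" "y \<in> carrier B" by simp_all
  have "rm z (tgt B r \<otimes>\<^bsub>B\<^esub> x) y = rm (rm z (tgt B r) \<one>\<^bsub>B\<^esub>) x y"
    using h zin by (simp add: rm_rm)
  also have "\<dots> = rm z x (src B r \<otimes>\<^bsub>B\<^esub> y)"
    using h zin by (simp add: rm_rm zt)
  finally show "rm z (ract (st_bimodule B) x r) y = rm z x (lact (st_bimodule B) r y)"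
    by simp
qed

lemma mult_additive_map:
  assumes "z \<in> takeuchi A B"
  shows "additive_map (st_tensor A B) (st_tensor A B) (\<lambda>w. z \<otimes>\<^bsub>st_tensor A B\<^esub> w)"
  unfolding T2.P.mult_eq using T2.P.lift_additive_map[OF T2.P.T_abelian rm_takeuchi_balanced[OF assms]] by simp

lemma mult_st:
  assumes "z \<in> takeuchi A B" "c \<in> carrier B" "d \<in> carrier B"
  shows "z \<otimes>\<^bsub>st_tensor A B\<^esub> (c \<diamondop> d) = rm z c d"
  unfolding T2.P.mult_eq using T2.P.lift_pure[OF T2.P.T_abelian rm_takeuchi_balanced[OF assms(1)]] assms(2,3) by simp

end

context bij_base
begin

sublocale St: st_alg K L S
  by (intro st_alg.intro st_alg_axioms.intro L.assoc_algebra_axioms S.assoc_algebra_axioms src_alg_hom tgt_alg_hom src_tgt)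

abbreviation "ST \<equiv> base_module L (st_tensor L S)"
abbreviation "ST3 \<equiv> base_module L (tensor L (st_bimodule S) (st_tensor L S))"
abbreviation st_S (infix "\<diamondop>" 66) where "x \<diamondop> y \<equiv> st_pure L S x y"

lemma module_ST [simp]: "module K ST" by (rule St.TC.base_module_module)
lemma module_ST3 [simp]: "module K ST3" by (rule St.T3C.base_module_module)

lemma comul_lift_ST: "comul_lift H (st_tensor L S) = comul_lift H ST"
  and comul_lift_ST3: "comul_lift H (tensor L (st_bimodule S) (st_tensor L S)) = comul_lift H ST3"
  by (rule comul_lift_target; simp)+

text \<open>The smash algebra has two scalar actions, its own and the one through the source map.
  They agree, so linearity rules for \<open>S\<close> feed into tensor products over
  \<open>L\<close>.\<close>

lemma lin_base_module_S: "lin K Q (base_module L (st_bimodule S)) t \<longleftrightarrow> lin K Q S t"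
proof -
  have "src S (c \<odot>\<^bsub>L\<^esub> \<one>\<^bsub>L\<^esub>) \<otimes>\<^bsub>S\<^esub> x = c \<odot>\<^bsub>S\<^esub> x" if "c \<in> carrier K" "x \<in> carrier S" for c x
    using that linD(3)[OF lin_src] by (simp add: src_one S.smult_mult_left)
  then show ?thesis
    by (auto simp: lin_def additive_map_def Pi_iff)
qed

lemma lin_st_left [lin_intro]: "lin K Q S t \<Longrightarrow> y \<in> carrier S \<Longrightarrow> lin K Q ST (\<lambda>x. t x \<diamondop> y)"
  using St.T2.lin_pure_left[of Q t y] by (simp add: lin_base_module_S)

lemma lin_st_right [lin_intro]: "lin K Q S t \<Longrightarrow> y \<in> carrier S \<Longrightarrow> lin K Q ST (\<lambda>x. y \<diamondop> t x)"
  using St.T2.lin_pure_right[of Q t y] by (simp add: lin_base_module_S)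

lemma lin_st3_left [lin_intro]: "lin K Q S t \<Longrightarrow> y \<in> carrier (st_tensor L S) \<Longrightarrow>
    lin K Q ST3 (\<lambda>x. pure L (st_bimodule S) (st_tensor L S) (t x) y)"
  using St.T3.lin_pure_left[of Q t y] by (simp add: lin_base_module_S)

lemma lin_st3_right [lin_intro]: "lin K Q ST t \<Longrightarrow> y \<in> carrier S \<Longrightarrow>
    lin K Q ST3 (\<lambda>x. pure L (st_bimodule S) (st_tensor L S) y (t x))"
  using St.T3.lin_pure_right[of Q t y] by simp

lemma st3_in [simp, intro]: "x \<in> carrier S \<Longrightarrow> y \<in> carrier (st_tensor L S) \<Longrightarrow>
    pure L (st_bimodule S) (st_tensor L S) x y \<in> carrier (tensor L (st_bimodule S) (st_tensor L S))"
  by (rule St.T3.P.pure_closed) simp_all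

section \<open>The coproduct of the smash product\<close>

abbreviation "B \<equiv> smash K H L"

lemma B_sel [simp]:
  "carrier B = carrier S" "add B = add S" "ring.zero B = ring.zero S" "smult B = smult S"
  "monoid.mult B = monoid.mult S" "one B = one S" "src B = src S" "tgt B = tgt S"
  by (simp_all add: smash_def Let_def st_algebra.defs)

lemma B_algebra: "assoc_algebra K B"
  by (rule assoc_algebra_cong[OF S.assoc_algebra_axioms]) simp_all

lemma st_bimodule_B [simp]: "st_bimodule B = st_bimodule S"
  by (simp add: st_bimodule_def)

lemma st_target: "tensor_lift (st_tensor L S) = tensor_lift ST"
  by (rule tensor_lift_cong_target) simp_all

lemma cop_eq: "cop B = tensor_lift ST (\<lambda>l h. tensor_lift ST (\<lambda>h1 h2. (l \<sharp> h1) \<diamondop> (\<one>\<^bsub>L\<^esub> \<sharp> h2)) (comul H h))"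
  by (simp add: smash_def Let_def st_algebra.defs st_target)

lemma cop_comul_lift: "z \<in> carrier S \<Longrightarrow> cop B z = tensor_lift ST (\<lambda>l h. \<Delta> ST h (\<lambda>h1 h2. (l \<sharp> h1) \<diamondop> (\<one>\<^bsub>L\<^esub> \<sharp> h2))) z"
  unfolding cop_eq by (rule LH.P.lift_cong_strong) (simp_all add: S_sel comul_lift_def)

lemma cop_bilin: "bilin K L H ST (\<lambda>l h. \<Delta> ST h (\<lambda>h1 h2. (l \<sharp> h1) \<diamondop> (\<one>\<^bsub>L\<^esub> \<sharp> h2)))"
  by (rule lin_intro | simp)+

lemma cop_lin: "lin K S ST (cop B)"
  by (rule lin_cong[OF module_S cop_comul_lift LH.lift_lin[OF module_ST cop_bilin]])

lemma cop_pure: "\<lbrakk>l \<in> carrier L; h \<in> carrier H\<rbrakk> \<Longrightarrow> cop B (l \<sharp> h) = \<Delta> ST h (\<lambda>h1 h2. (l \<sharp> h1) \<diamondop> (\<one>\<^bsub>L\<^esub> \<sharp> h2))"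
  by (simp add: cop_comul_lift LH.pure_in LH.lift_pure[OF module_ST cop_bilin])

lemma cop_in: "z \<in> carrier S \<Longrightarrow> cop B z \<in> carrier (st_tensor L S)"
  using linD(1)[OF cop_lin] by simp

lemma cou_eq: "cou B = tensor_lift L (\<lambda>l h. \<epsilon> h \<odot>\<^bsub>L\<^esub> l)"
  by (simp add: smash_def Let_def st_algebra.defs)

lemma cou_bilin: "bilin K L H L (\<lambda>l h. \<epsilon> h \<odot>\<^bsub>L\<^esub> l)"
  by (rule lin_intro L.lin_smult | simp)+

lemma cou_lin: "lin K S L (cou B)"
  unfolding cou_eq by (rule LH.lift_lin[OF module_L cou_bilin])

lemma cou_pure: "\<lbrakk>l \<in> carrier L; h \<in> carrier H\<rbrakk> \<Longrightarrow> cou B (l \<sharp> h) = \<epsilon> h \<odot>\<^bsub>L\<^esub> l"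
  unfolding cou_eq by (rule LH.lift_pure[OF module_L cou_bilin])

lemma cou_closed [simp]: "z \<in> carrier S \<Longrightarrow> cou B z \<in> carrier L"
  by (rule linD(1)[OF cou_lin])

lemma lin_cou [lin_intro]: "lin K N S t \<Longrightarrow> lin K N L (\<lambda>x. cou B (t x))"
  by (rule lin_comp[OF cou_lin])

lemma lin_cop [lin_intro]: "lin K N S t \<Longrightarrow> lin K N ST (\<lambda>x. cop B (t x))"
  by (rule lin_comp[OF cop_lin])

lemma lin_src_comp [lin_intro]: "lin K N L t \<Longrightarrow> lin K N S (\<lambda>x. src S (t x))"
  by (rule lin_comp[OF lin_src])

lemma lin_tgt_comp [lin_intro]: "lin K N L t \<Longrightarrow> lin K N S (\<lambda>x. tgt S (t x))"
  by (rule lin_comp[OF lin_tgt])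

lemma cop_src:
  assumes [simp]: "l \<in> carrier L" "z \<in> carrier S"
  shows "cop B (src S l \<otimes>\<^bsub>S\<^esub> z) = lact (st_tensor L S) l (cop B z)"
proof (rule LH.lin_eqI[where z=z])
  show "lin K S ST (\<lambda>z. cop B (src S l \<otimes>\<^bsub>S\<^esub> z))" by (rule lin_intro | simp)+
  show "lin K S ST (\<lambda>z. lact (st_tensor L S) l (cop B z))"
    by (rule lin_comp[OF St.TC.lact_lin cop_lin]) simp
  show "cop B (src S l \<otimes>\<^bsub>S\<^esub> (m \<sharp> h)) = lact (st_tensor L S) l (cop B (m \<sharp> h))"
    if [simp]: "m \<in> carrier L" "h \<in> carrier H" for m h
  proof -
    have "lact (st_tensor L S) l (cop B (m \<sharp> h)) =
      \<Delta> ST h (\<lambda>h1 h2. lact (st_tensor L S) l ((m \<sharp> h1) \<diamondop> (\<one>\<^bsub>L\<^esub> \<sharp> h2)))"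
      unfolding cop_pure[OF that] by (rule H.comul_lift_hom[OF module_ST St.TC.lact_lin module_ST]) auto
    then show ?thesis
      by (simp add: src_mult cop_pure St.T2.P.lact_pure)
  qed
qed simp

text \<open>Right linearity is the harder half, because a target factor spreads over both legs.
  Coassociativity of the coaction separates the two contributions: the one in the first leg is a
  target factor, crosses the tensor sign as a source factor, and there completes the other
  contribution to a target factor of the second leg.\<close>

lemma cop_tgt:
  assumes [simp]: "l \<in> carrier L" "z \<in> carrier S"
  shows "cop B (tgt S l \<otimes>\<^bsub>S\<^esub> z) = ract (st_tensor L S) (cop B z) l"
proof (rule LH.lin_eqI[where z=z])
  show "lin K S ST (\<lambda>z. cop B (tgt S l \<otimes>\<^bsub>S\<^esub> z))" by (rule lin_intro | simp)+
  show "lin K S ST (\<lambda>z. ract (st_tensor L S) (cop B z) l)"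
    by (rule lin_comp[OF St.TC.ract_lin cop_lin]) simp
  show "cop B (tgt S l \<otimes>\<^bsub>S\<^esub> (m \<sharp> h)) = ract (st_tensor L S) (cop B (m \<sharp> h)) l"
    if [simp]: "m \<in> carrier L" "h \<in> carrier H" for m h
  proof -
    have "cop B (tgt S l \<otimes>\<^bsub>S\<^esub> (m \<sharp> h)) = \<delta> ST l (\<lambda>p n. cop B ((m \<otimes>\<^bsub>L\<^esub> n) \<sharp> (\<iota> p \<otimes>\<^bsub>H\<^esub> h)))"
      by (simp add: tgt_mult) (rule coact_lift_hom[OF module_S cop_lin module_ST], simp)
    also have "\<dots> = \<delta> ST l (\<lambda>p n. \<Delta> ST (\<iota> p) (\<lambda>a b. \<Delta> ST h (\<lambda>h1 h2.
        ((m \<otimes>\<^bsub>L\<^esub> n) \<sharp> (a \<otimes>\<^bsub>H\<^esub> h1)) \<diamondop> (\<one>\<^bsub>L\<^esub> \<sharp> (b \<otimes>\<^bsub>H\<^esub> h2)))))"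
      by (simp add: cop_pure, intro coact_lift_cong H.comul_lift_mult[OF module_ST]) (rule lin_intro | simp)+
    also have "\<dots> = \<delta> ST l (\<lambda>p n. \<Delta> ST p (\<lambda>x y. \<Delta> ST h (\<lambda>h1 h2.
        ((m \<otimes>\<^bsub>L\<^esub> n) \<sharp> (\<iota> y \<otimes>\<^bsub>H\<^esub> h1)) \<diamondop> (\<one>\<^bsub>L\<^esub> \<sharp> (\<iota> x \<otimes>\<^bsub>H\<^esub> h2)))))"
      by (intro coact_lift_cong H.antipode_inv_comul[OF module_ST]) (rule lin_intro | simp)+
    also have "\<dots> = \<delta> ST l (\<lambda>p n. \<delta> ST n (\<lambda>q n'. \<Delta> ST h (\<lambda>h1 h2.
        ((m \<otimes>\<^bsub>L\<^esub> n') \<sharp> (\<iota> q \<otimes>\<^bsub>H\<^esub> h1)) \<diamondop> (\<one>\<^bsub>L\<^esub> \<sharp> (\<iota> p \<otimes>\<^bsub>H\<^esub> h2)))))"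
      by (rule coact_lift_coassoc[OF module_ST]) (rule lin_intro | simp)+
    also have "\<dots> = \<delta> ST l (\<lambda>p n. \<Delta> ST h (\<lambda>h1 h2. \<delta> ST n (\<lambda>q n'.
        ((m \<otimes>\<^bsub>L\<^esub> n') \<sharp> (\<iota> q \<otimes>\<^bsub>H\<^esub> h1)) \<diamondop> (\<one>\<^bsub>L\<^esub> \<sharp> (\<iota> p \<otimes>\<^bsub>H\<^esub> h2)))))"
      by (intro coact_lift_cong coact_lift_comul_lift_fubini[OF module_ST]) simp
    also have "\<dots> = \<delta> ST l (\<lambda>p n. \<Delta> ST h (\<lambda>h1 h2.
        (tgt S n \<otimes>\<^bsub>S\<^esub> (m \<sharp> h1)) \<diamondop> (\<one>\<^bsub>L\<^esub> \<sharp> (\<iota> p \<otimes>\<^bsub>H\<^esub> h2))))"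
      by (intro coact_lift_cong H.comul_lift_cong, subst tgt_mult, simp_all,
          rule coact_lift_hom[OF module_S _ module_ST, symmetric]) (rule lin_intro | simp)+
    \<comment> \<open>Balancing moves \<open>tgt S n\<close> across as \<open>src S n\<close>, which
      then simply fills the unit in the \<open>L\<close>-slot.\<close>
    also have "\<dots> = \<delta> ST l (\<lambda>p n. \<Delta> ST h (\<lambda>h1 h2. (m \<sharp> h1) \<diamondop> (n \<sharp> (\<iota> p \<otimes>\<^bsub>H\<^esub> h2))))"
      by (intro coact_lift_cong H.comul_lift_cong) (simp add: St.st_balanced src_mult)
    also have "\<dots> = \<Delta> ST h (\<lambda>h1 h2. \<delta> ST l (\<lambda>p n. (m \<sharp> h1) \<diamondop> (n \<sharp> (\<iota> p \<otimes>\<^bsub>H\<^esub> h2))))"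
      by (rule coact_lift_comul_lift_fubini[OF module_ST]) simp
    \<comment> \<open>\<open>tgt_mult\<close> is read backwards, with the unit of \<open>L\<close>
      in place of \<open>m\<close>.\<close>
    also have "\<dots> = \<Delta> ST h (\<lambda>h1 h2. (m \<sharp> h1) \<diamondop> (tgt S l \<otimes>\<^bsub>S\<^esub> (\<one>\<^bsub>L\<^esub> \<sharp> h2)))"
      by (intro H.comul_lift_cong, subst tgt_mult, simp_all,
          subst coact_lift_hom[OF module_S _ module_ST]) (rule lin_intro refl | simp)+
    also have "\<dots> = \<Delta> ST h (\<lambda>h1 h2. ract (st_tensor L S) ((m \<sharp> h1) \<diamondop> (\<one>\<^bsub>L\<^esub> \<sharp> h2)) l)"
      by (intro H.comul_lift_cong) (simp add: St.T2.P.ract_pure)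
    also have "\<dots> = ract (st_tensor L S) (cop B (m \<sharp> h)) l"
      unfolding cop_pure[OF that] by (rule H.comul_lift_hom[OF module_ST St.TC.ract_lin module_ST, symmetric]) auto
    finally show ?thesis .
  qed
qed simp

lemma cop_left_lin: "left_lin L (st_bimodule S) (st_tensor L S) (cop B)"
  and cop_right_lin: "right_lin L (st_bimodule S) (st_tensor L S) (cop B)"
  using linD(4)[OF cop_lin] by (auto simp: left_lin_def right_lin_def additive_map_def cop_src cop_tgt)

text \<open>Linearity on the two sides, from \<open>cop_src\<close> and \<open>cop_tgt\<close>, is
  what allows the coproduct to be applied inside either leg. Both composites are then additive, and
  on pure elements the claim is coassociativity in \<open>H\<close>.\<close>

lemma cop_coassoc_S:
  assumes a: "a \<in> carrier S"
  shows "tensor_assoc L (st_bimodule S) (st_bimodule S) (st_bimodule S)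
            (tensor_map L (st_tensor L S) (st_bimodule S) (cop B) id (cop B a)) =
          tensor_map L (st_bimodule S) (st_tensor L S) id (cop B) (cop B a)"
proof -
  let ?T3 = "tensor L (st_bimodule S) (st_tensor L S)"
  note pairs = St.T2.P.tensor_pair_axioms St.T3.P.tensor_pair_axioms St.T3'.P.tensor_pair_axioms
  define F where "F = (\<lambda>z. tensor_assoc L (st_bimodule S) (st_bimodule S) (st_bimodule S)
            (tensor_map L (st_tensor L S) (st_bimodule S) (cop B) id z))"
  define F' where "F' = tensor_map L (st_bimodule S) (st_tensor L S) id (cop B)"
  note m1 = pairs(1) pairs(3) cop_right_lin left_lin_id[of L "st_bimodule S"]
  note m2 = pairs(1) pairs(2) right_lin_id[of L "st_bimodule S"] cop_left_lin
  have F: "additive_map (st_tensor L S) ?T3 F" and F': "additive_map (st_tensor L S) ?T3 F'"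
    using tensor_map_additive_map[OF m1] St.A3.tensor_assoc_additive_map tensor_map_additive_map[OF m2]
    by (auto simp: F_def F'_def additive_map_def Pi_iff)
  have Fp: "F (x \<diamondop> y) = St.A3.assoc_inner (cop B x) y" and F'p: "F' (x \<diamondop> y) = pure L (st_bimodule S) (st_tensor L S) x (cop B y)"
    if "x \<in> carrier S" "y \<in> carrier S" for x y
    using that by (simp_all add: F_def F'_def tensor_map_pure[OF m1] tensor_map_pure[OF m2] St.A3.tensor_assoc_pure1 cop_in)
  have ab: "abelian_group (st_tensor L S)" "abelian_group ?T3"
    by (rule St.T2.P.T_abelian St.T3.P.T_abelian)+
  have F_add: "additive_map S ?T3 (\<lambda>z. F (cop B z))" "additive_map S ?T3 (\<lambda>z. F' (cop B z))"
    using F F' linD(4)[OF cop_lin] by (auto simp: additive_map_def Pi_iff)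
  have pure: "F (cop B (l \<sharp> h)) = F' (cop B (l \<sharp> h))" if [simp]: "l \<in> carrier L" "h \<in> carrier H" for l h
  proof -
    have pull: "\<phi> (\<Delta> ST g f) = \<Delta> ST3 g (\<lambda>x y. \<phi> (f x y))"
      if "additive_map (st_tensor L S) ?T3 \<phi>" "\<And>x y. x \<in> carrier H \<Longrightarrow> y \<in> carrier H \<Longrightarrow> f x y \<in> carrier (st_tensor L S)" for \<phi> g f
      using H.comul_lift_hom_additive_map[OF ab that] by (simp add: comul_lift_ST comul_lift_ST3)
    have "F (cop B (l \<sharp> h)) = \<Delta> ST3 h (\<lambda>h1 h2. St.A3.assoc_inner (cop B (l \<sharp> h1)) (\<one>\<^bsub>L\<^esub> \<sharp> h2))"
      by (simp add: cop_pure[of l h] pull[OF F] Fp)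
    also have "\<dots> = \<Delta> ST3 h (\<lambda>h1 h2. \<Delta> ST3 h1 (\<lambda>u v.
        pure L (st_bimodule S) (st_tensor L S) (l \<sharp> u) ((\<one>\<^bsub>L\<^esub> \<sharp> v) \<diamondop> (\<one>\<^bsub>L\<^esub> \<sharp> h2))))"
      by (intro H.comul_lift_cong) (simp add: cop_pure pull[OF St.A3.assoc_inner_additive_map] St.A3.assoc_inner_pure)
    also have "\<dots> = \<Delta> ST3 h (\<lambda>h1 h2. \<Delta> ST3 h2 (\<lambda>u v.
        pure L (st_bimodule S) (st_tensor L S) (l \<sharp> h1) ((\<one>\<^bsub>L\<^esub> \<sharp> u) \<diamondop> (\<one>\<^bsub>L\<^esub> \<sharp> v))))"
      by (rule H.comul_lift_coassoc[OF module_ST3]) (rule lin_intro | simp)+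
    also have "\<dots> = \<Delta> ST3 h (\<lambda>h1 h2. pure L (st_bimodule S) (st_tensor L S) (l \<sharp> h1) (cop B (\<one>\<^bsub>L\<^esub> \<sharp> h2)))"
      by (intro H.comul_lift_cong) (simp add: cop_pure, rule pull[OF St.T3.P.pure_additive_map_right, symmetric], simp_all)
    also have "\<dots> = F' (cop B (l \<sharp> h))"
      by (simp add: cop_pure[of l h] pull[OF F'] F'p)
    finally show ?thesis .
  qed
  have "F (cop B a) = F' (cop B a)"
    using a by (induction rule: LH.Z_induct) (simp_all add: pure additive_map_add[OF F_add(1)] additive_map_add[OF F_add(2)])
  then show ?thesis by (simp add: F_def F'_def)
qed

end

context bij_base
begin

abbreviation rm where "rm z c d \<equiv> tensor_rmult L (st_bimodule S) (st_bimodule S) z c d"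

text \<open>The commutation rule behind the Takeuchi condition. The coaction of
  \<open>h2 \<rhd> l\<close> has leg \<open>u1 p \<gamma>(u3)\<close>, whose image under
  \<open>\<iota>\<close> is \<open>u3 \<iota>(p) \<iota>(u1)\<close>; the last factor cancels
  against \<open>h1\<close>.\<close>

lemma S_mult_tgt:
  assumes [simp]: "m \<in> carrier L" "h \<in> carrier H" "l \<in> carrier L"
  shows "\<Delta> S h (\<lambda>h1 h2. tgt S (h2 \<rhd> l) \<otimes>\<^bsub>S\<^esub> (m \<sharp> h1)) = (m \<sharp> h) \<otimes>\<^bsub>S\<^esub> tgt S l"
proof -
  let ?G = "\<lambda>x w. \<Delta> S w (\<lambda>u2 u3. \<delta> S l (\<lambda>p n. (m \<otimes>\<^bsub>L\<^esub> (u2 \<rhd> n)) \<sharp> (u3 \<otimes>\<^bsub>H\<^esub> (\<iota> p \<otimes>\<^bsub>H\<^esub> x))))"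
  have "\<Delta> S h (\<lambda>h1 h2. tgt S (h2 \<rhd> l) \<otimes>\<^bsub>S\<^esub> (m \<sharp> h1)) =
    \<Delta> S h (\<lambda>h1 h2. \<delta> S (h2 \<rhd> l) (\<lambda>p n. (m \<otimes>\<^bsub>L\<^esub> n) \<sharp> (\<iota> p \<otimes>\<^bsub>H\<^esub> h1)))"
    by (simp add: tgt_mult)
  also have "\<dots> = \<Delta> S h (\<lambda>h1 h2. \<Delta> S h2 (\<lambda>u1 w. \<Delta> S w (\<lambda>u2 u3. \<delta> S l (\<lambda>p n.
     (m \<otimes>\<^bsub>L\<^esub> (u2 \<rhd> n)) \<sharp> (\<iota> (u1 \<otimes>\<^bsub>H\<^esub> p \<otimes>\<^bsub>H\<^esub> \<gamma> u3) \<otimes>\<^bsub>H\<^esub> h1)))))"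
    by (intro H.comul_lift_cong coact_lift_act[OF module_S]) (rule lin_intro | simp)+
  also have "\<dots> = \<Delta> S h (\<lambda>h1 h2. \<Delta> S h2 (\<lambda>u1 w. ?G (\<iota> u1 \<otimes>\<^bsub>H\<^esub> h1) w))"
    by (simp add: H.antipode_inv_mult H.m_assoc)
  also have "\<dots> = ?G \<one>\<^bsub>H\<^esub> h"
    by (rule H.comul_lift_antipode_inv_right3[OF module_S]) (rule lin_intro | simp)+
  also have "\<dots> = \<delta> S l (\<lambda>p n. \<Delta> S h (\<lambda>u2 u3. (m \<otimes>\<^bsub>L\<^esub> (u2 \<rhd> n)) \<sharp> (u3 \<otimes>\<^bsub>H\<^esub> \<iota> p)))"
    by (simp add: coact_lift_comul_lift_fubini[OF module_S])
  also have "\<dots> = (m \<sharp> h) \<otimes>\<^bsub>S\<^esub> tgt S l"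
    by (simp add: S_tgt L_pulls S_mult_pure)
  finally show ?thesis .
qed

lemma pull_ST:
  assumes "additive_map (st_tensor L S) (st_tensor L S) \<phi>"
    "\<And>x y. x \<in> carrier H \<Longrightarrow> y \<in> carrier H \<Longrightarrow> f x y \<in> carrier (st_tensor L S)"
  shows "\<phi> (\<Delta> ST g f) = \<Delta> ST g (\<lambda>x y. \<phi> (f x y))"
  using H.comul_lift_hom_additive_map[OF St.T2.P.T_abelian St.T2.P.T_abelian assms] by (simp add: comul_lift_ST)

lemma S_to_ST:
  assumes "lin K S ST \<phi>" "\<And>x y. x \<in> carrier H \<Longrightarrow> y \<in> carrier H \<Longrightarrow> f x y \<in> carrier S"
  shows "\<phi> (\<Delta> S g f) = \<Delta> ST g (\<lambda>x y. \<phi> (f x y))"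
  using H.comul_lift_hom[OF module_S assms(1) module_ST assms(2)] by simp

lemma cop_add_comp: "additive_map (st_tensor L S) N \<phi> \<Longrightarrow> additive_map S N (\<lambda>a. \<phi> (cop B a))"
  using linD(4)[OF cop_lin] by (auto simp: additive_map_def Pi_iff)

text \<open>Multiplying the second leg by a source on the right gives
  \<open>src S (u \<rhd> l)\<close> on its left. Balancing turns this into a target on the first
  leg, and \<open>S_mult_tgt\<close> moves that target to the right.\<close>

lemma cop_takeuchi_eq:
  assumes a: "a \<in> carrier S" and [simp]: "l \<in> carrier L"
  shows "rm (cop B a) (tgt S l) \<one>\<^bsub>S\<^esub> = rm (cop B a) \<one>\<^bsub>S\<^esub> (src S l)"
  using a
proof (induction rule: LH.Z_induct)
  case (pure m h)
  note [simp] = pure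
  have "rm (cop B (m \<sharp> h)) \<one>\<^bsub>S\<^esub> (src S l) = \<Delta> ST h (\<lambda>h1 h2. (m \<sharp> h1) \<diamondop> ((\<one>\<^bsub>L\<^esub> \<sharp> h2) \<otimes>\<^bsub>S\<^esub> (l \<sharp> \<one>\<^bsub>H\<^esub>)))"
    by (simp add: cop_pure pull_ST[OF St.rm_additive_map] St.rm_st) (simp add: S_sel(6))
  also have "\<dots> = \<Delta> ST h (\<lambda>h1 h2. \<Delta> ST h2 (\<lambda>u v. (m \<sharp> h1) \<diamondop> ((u \<rhd> l) \<sharp> v)))"
    by (intro H.comul_lift_cong, simp add: S_mult_pure, rule S_to_ST) (rule lin_intro | simp)+
  also have "\<dots> = \<Delta> ST h (\<lambda>h1 h2. \<Delta> ST h2 (\<lambda>u v. (m \<sharp> h1) \<diamondop> (src S (u \<rhd> l) \<otimes>\<^bsub>S\<^esub> (\<one>\<^bsub>L\<^esub> \<sharp> v))))"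
    by (simp add: src_mult)
  also have "\<dots> = \<Delta> ST h (\<lambda>h1 h2. \<Delta> ST h2 (\<lambda>u v. (tgt S (u \<rhd> l) \<otimes>\<^bsub>S\<^esub> (m \<sharp> h1)) \<diamondop> (\<one>\<^bsub>L\<^esub> \<sharp> v)))"
    by (simp add: St.st_balanced)
  also have "\<dots> = \<Delta> ST h (\<lambda>r v. \<Delta> ST r (\<lambda>h1 u. (tgt S (u \<rhd> l) \<otimes>\<^bsub>S\<^esub> (m \<sharp> h1)) \<diamondop> (\<one>\<^bsub>L\<^esub> \<sharp> v)))"
    by (rule H.comul_lift_coassoc[OF module_ST, symmetric]) (rule lin_intro | simp)+
  also have "\<dots> = \<Delta> ST h (\<lambda>r v. \<Delta> S r (\<lambda>h1 u. tgt S (u \<rhd> l) \<otimes>\<^bsub>S\<^esub> (m \<sharp> h1)) \<diamondop> (\<one>\<^bsub>L\<^esub> \<sharp> v))"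
    by (intro H.comul_lift_cong S_to_ST[symmetric]) (rule lin_intro | simp)+
  also have "\<dots> = rm (cop B (m \<sharp> h)) (tgt S l) \<one>\<^bsub>S\<^esub>"
    by (simp add: S_mult_tgt cop_pure pull_ST[OF St.rm_additive_map] St.rm_st)
  finally show ?case by simp
next
  case (add z w)
  then show ?case
    by (simp add: additive_map_add[OF cop_add_comp[OF St.rm_additive_map]])
qed

lemma cop_takeuchi_S: "a \<in> carrier S \<Longrightarrow> cop B a \<in> takeuchi L S"
  by (simp add: takeuchi_def cop_in cop_takeuchi_eq)

lemma one_sharp_mult:
  assumes [simp]: "f \<in> carrier H" "g \<in> carrier H"
  shows "(\<one>\<^bsub>L\<^esub> \<sharp> f) \<otimes>\<^bsub>S\<^esub> (\<one>\<^bsub>L\<^esub> \<sharp> g) = \<one>\<^bsub>L\<^esub> \<sharp> (f \<otimes>\<^bsub>H\<^esub> g)"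
proof -
  have "(\<one>\<^bsub>L\<^esub> \<sharp> f) \<otimes>\<^bsub>S\<^esub> (\<one>\<^bsub>L\<^esub> \<sharp> g) = \<Delta> S f (\<lambda>x y. \<epsilon> x \<odot>\<^bsub>S\<^esub> (\<one>\<^bsub>L\<^esub> \<sharp> (y \<otimes>\<^bsub>H\<^esub> g)))"
    by (simp add: S_mult_pure act_on_one LH.smult_pure_left)
  also have "\<dots> = \<one>\<^bsub>L\<^esub> \<sharp> (f \<otimes>\<^bsub>H\<^esub> g)"
    by (rule H.comul_lift_counit_left[OF module_S]) (rule lin_intro | simp)+
  finally show ?thesis .
qed

text \<open>Additivity in \<open>a\<close> is taken from right multiplication \<open>rm\<close> by a
  fixed pair, and additivity in \<open>b\<close> from \<open>cop B a\<close> being in the Takeuchi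
  product. Hence the detour through the formula with \<open>rm\<close>, in which \<open>a\<close> is
  arbitrary but \<open>b\<close> is pure.\<close>

lemma cop_mult_S:
  assumes a: "a \<in> carrier S" and b: "b \<in> carrier S"
  shows "cop B (a \<otimes>\<^bsub>S\<^esub> b) = cop B a \<otimes>\<^bsub>st_tensor L S\<^esub> cop B b"
proof -
  have cop_mult_pure: "cop B ((l \<sharp> f) \<otimes>\<^bsub>S\<^esub> (m \<sharp> g)) = \<Delta> ST g (\<lambda>g1 g2. rm (cop B (l \<sharp> f)) (m \<sharp> g1) (\<one>\<^bsub>L\<^esub> \<sharp> g2))"
    if [simp]: "l \<in> carrier L" "f \<in> carrier H" "m \<in> carrier L" "g \<in> carrier H" for l f m g
  proof -
    have "cop B ((l \<sharp> f) \<otimes>\<^bsub>S\<^esub> (m \<sharp> g)) = \<Delta> ST f (\<lambda>f1 r. \<Delta> ST (r \<otimes>\<^bsub>H\<^esub> g) (\<lambda>x y. ((l \<otimes>\<^bsub>L\<^esub> (f1 \<rhd> m)) \<sharp> x) \<diamondop> (\<one>\<^bsub>L\<^esub> \<sharp> y)))"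
      by (simp add: S_mult_pure S_to_ST[OF cop_lin] cop_pure)
    also have "\<dots> = \<Delta> ST f (\<lambda>f1 r. \<Delta> ST r (\<lambda>x y. \<Delta> ST g (\<lambda>g1 g2.
        ((l \<otimes>\<^bsub>L\<^esub> (f1 \<rhd> m)) \<sharp> (x \<otimes>\<^bsub>H\<^esub> g1)) \<diamondop> (\<one>\<^bsub>L\<^esub> \<sharp> (y \<otimes>\<^bsub>H\<^esub> g2)))))"
      by (intro H.comul_lift_cong H.comul_lift_mult[OF module_ST]) (rule lin_intro | simp)+
    also have "\<dots> = \<Delta> ST f (\<lambda>r y. \<Delta> ST r (\<lambda>f1 x. \<Delta> ST g (\<lambda>g1 g2.
        ((l \<otimes>\<^bsub>L\<^esub> (f1 \<rhd> m)) \<sharp> (x \<otimes>\<^bsub>H\<^esub> g1)) \<diamondop> (\<one>\<^bsub>L\<^esub> \<sharp> (y \<otimes>\<^bsub>H\<^esub> g2)))))"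
      by (rule H.comul_lift_coassoc[OF module_ST, symmetric]) (rule lin_intro | simp)+
    also have "\<dots> = \<Delta> ST f (\<lambda>r y. \<Delta> ST g (\<lambda>g1 g2. \<Delta> ST r (\<lambda>f1 x.
        ((l \<otimes>\<^bsub>L\<^esub> (f1 \<rhd> m)) \<sharp> (x \<otimes>\<^bsub>H\<^esub> g1)) \<diamondop> (\<one>\<^bsub>L\<^esub> \<sharp> (y \<otimes>\<^bsub>H\<^esub> g2)))))"
      by (intro H.comul_lift_cong H.comul_lift_fubini[OF module_ST]) simp
    \<comment> \<open>The legs \<open>f1\<close> and \<open>x\<close> are now those of a single
      \<open>r\<close>, so the inner sum is a product in the smash algebra.\<close>
    also have "\<dots> = \<Delta> ST f (\<lambda>r y. \<Delta> ST g (\<lambda>g1 g2. ((l \<sharp> r) \<otimes>\<^bsub>S\<^esub> (m \<sharp> g1)) \<diamondop> (\<one>\<^bsub>L\<^esub> \<sharp> (y \<otimes>\<^bsub>H\<^esub> g2))))"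
      by (intro H.comul_lift_cong, simp add: S_mult_pure, rule S_to_ST[symmetric]) (rule lin_intro | simp)+
    also have "\<dots> = \<Delta> ST g (\<lambda>g1 g2. \<Delta> ST f (\<lambda>r y. ((l \<sharp> r) \<otimes>\<^bsub>S\<^esub> (m \<sharp> g1)) \<diamondop> (\<one>\<^bsub>L\<^esub> \<sharp> (y \<otimes>\<^bsub>H\<^esub> g2))))"
      by (rule H.comul_lift_fubini[OF module_ST]) simp
    also have "\<dots> = \<Delta> ST g (\<lambda>g1 g2. rm (cop B (l \<sharp> f)) (m \<sharp> g1) (\<one>\<^bsub>L\<^esub> \<sharp> g2))"
      by (intro H.comul_lift_cong) (simp add: cop_pure pull_ST[OF St.rm_additive_map] St.rm_st one_sharp_mult)
    finally show ?thesis .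
  qed
  have ab: "abelian_group (st_tensor L S)" by (rule St.T2.P.T_abelian)
  have 1: "cop B (a \<otimes>\<^bsub>S\<^esub> (m \<sharp> g)) = \<Delta> ST g (\<lambda>g1 g2. rm (cop B a) (m \<sharp> g1) (\<one>\<^bsub>L\<^esub> \<sharp> g2))"
    if [simp]: "m \<in> carrier L" "g \<in> carrier H" for m g
    using a
  proof (induction rule: LH.Z_induct)
    case (pure l f)
    then show ?case by (simp add: cop_mult_pure)
  next
    case (add z w)
    have "\<Delta> ST g (\<lambda>g1 g2. rm (cop B (z \<oplus>\<^bsub>S\<^esub> w)) (m \<sharp> g1) (\<one>\<^bsub>L\<^esub> \<sharp> g2)) =
      \<Delta> ST g (\<lambda>g1 g2. rm (cop B z) (m \<sharp> g1) (\<one>\<^bsub>L\<^esub> \<sharp> g2) \<oplus>\<^bsub>st_tensor L S\<^esub> rm (cop B w) (m \<sharp> g1) (\<one>\<^bsub>L\<^esub> \<sharp> g2))"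
      using add by (simp add: additive_map_add[OF cop_add_comp[OF St.rm_additive_map]])
    also have "\<dots> = \<Delta> ST g (\<lambda>g1 g2. rm (cop B z) (m \<sharp> g1) (\<one>\<^bsub>L\<^esub> \<sharp> g2)) \<oplus>\<^bsub>st_tensor L S\<^esub>
       \<Delta> ST g (\<lambda>g1 g2. rm (cop B w) (m \<sharp> g1) (\<one>\<^bsub>L\<^esub> \<sharp> g2))"
      using that unfolding comul_lift_ST[symmetric] comul_lift_def
      by simp (rule H.HH.P.lift_add_fun[OF H.comul_in ab], simp_all add: St.rm_in cop_in add(1,2))
    finally show ?case
      using add by (simp add: S.l_distr linD(2)[OF cop_lin, simplified])
  qed
  show ?thesis
    using b
  proof (induction rule: LH.Z_induct)
    case (pure m g)
    then show ?case
      by (simp add: 1 cop_pure pull_ST[OF St.mult_additive_map[OF cop_takeuchi_S[OF a]]] St.mult_st[OF cop_takeuchi_S[OF a]])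
  next
    case (add z w)
    then show ?case
      using a by (simp add: S.r_distr linD(2)[OF cop_lin, simplified] additive_map_add[OF St.mult_additive_map[OF cop_takeuchi_S[OF a]]] cop_in)
  qed
qed

lemma cop_one: "cop B \<one>\<^bsub>S\<^esub> = \<one>\<^bsub>st_tensor L S\<^esub>"
proof -
  have "cop B \<one>\<^bsub>S\<^esub> = (\<one>\<^bsub>L\<^esub> \<sharp> \<one>\<^bsub>H\<^esub>) \<diamondop> (\<one>\<^bsub>L\<^esub> \<sharp> \<one>\<^bsub>H\<^esub>)"
    by (simp add: S_sel(5) cop_pure, rule H.comul_lift_one[OF module_ST]) (rule lin_intro | simp)+
  also have "\<dots> = \<one>\<^bsub>st_tensor L S\<^esub>"
    by (simp add: tensor_def Let_def S_sel(5))
  finally show ?thesis .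
qed

lemma cou_one_S: "cou B \<one>\<^bsub>S\<^esub> = \<one>\<^bsub>L\<^esub>"
  by (simp add: S_sel(5) cou_pure H.counit_one)

lemma cou_src:
  assumes [simp]: "l \<in> carrier L" "a \<in> carrier S"
  shows "cou B (src S l \<otimes>\<^bsub>S\<^esub> a) = l \<otimes>\<^bsub>L\<^esub> cou B a"
  by (rule LH.lin_eqI[where z=a])
    (rule lin_intro | simp add: src_mult cou_pure L.smult_mult_right)+

lemma cou_tgt:
  assumes [simp]: "l \<in> carrier L" "a \<in> carrier S"
  shows "cou B (tgt S l \<otimes>\<^bsub>S\<^esub> a) = cou B a \<otimes>\<^bsub>L\<^esub> l"
proof (rule LH.lin_eqI[where z=a])
  show "cou B (tgt S l \<otimes>\<^bsub>S\<^esub> (m \<sharp> h)) = cou B (m \<sharp> h) \<otimes>\<^bsub>L\<^esub> l"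
    if [simp]: "m \<in> carrier L" "h \<in> carrier H" for m h
  proof -
    have "cou B (tgt S l \<otimes>\<^bsub>S\<^esub> (m \<sharp> h)) = \<delta> L l (\<lambda>p n. cou B ((m \<otimes>\<^bsub>L\<^esub> n) \<sharp> (\<iota> p \<otimes>\<^bsub>H\<^esub> h)))"
      by (simp add: tgt_mult) (rule coact_lift_hom[OF module_S cou_lin module_L], simp)
    also have "\<dots> = \<delta> L l (\<lambda>p n. \<epsilon> p \<odot>\<^bsub>L\<^esub> (\<epsilon> h \<odot>\<^bsub>L\<^esub> (m \<otimes>\<^bsub>L\<^esub> n)))"
      by (simp add: cou_pure H.counit_mult H.antipode_inv_counit L.smult_assoc1)
    also have "\<dots> = \<epsilon> h \<odot>\<^bsub>L\<^esub> (m \<otimes>\<^bsub>L\<^esub> l)"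
      by (rule coact_lift_counit[OF module_L]) (rule lin_intro L.lin_smult | simp)+
    finally show ?thesis by (simp add: cou_pure L.smult_mult_left)
  qed
qed (rule lin_intro | simp)+

lemma cou_mult_pure:
  assumes [simp]: "m \<in> carrier L" "h \<in> carrier H" "l \<in> carrier L" "g \<in> carrier H"
  shows "cou B ((m \<sharp> h) \<otimes>\<^bsub>S\<^esub> (l \<sharp> g)) = \<epsilon> g \<odot>\<^bsub>L\<^esub> (m \<otimes>\<^bsub>L\<^esub> (h \<rhd> l))"
proof -
  have "cou B ((m \<sharp> h) \<otimes>\<^bsub>S\<^esub> (l \<sharp> g)) = \<Delta> L h (\<lambda>x y. \<epsilon> y \<odot>\<^bsub>L\<^esub> (\<epsilon> g \<odot>\<^bsub>L\<^esub> (m \<otimes>\<^bsub>L\<^esub> (x \<rhd> l))))"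
    by (simp add: S_mult_pure H.comul_lift_hom[OF module_S cou_lin module_L] cou_pure H.counit_mult L.smult_assoc1)
  also have "\<dots> = \<epsilon> g \<odot>\<^bsub>L\<^esub> (m \<otimes>\<^bsub>L\<^esub> (h \<rhd> l))"
    by (rule H.comul_lift_counit_right[OF module_L]) (rule lin_intro L.lin_smult | simp)+
  finally show ?thesis .
qed

lemma cou_src_right:
  assumes a: "a \<in> carrier S" and b: "b \<in> carrier S"
  shows "cou B (a \<otimes>\<^bsub>S\<^esub> src S (cou B b)) = cou B (a \<otimes>\<^bsub>S\<^esub> b)"
proof (rule LH.lin_eqI[OF _ _ _ b])
  show "cou B (a \<otimes>\<^bsub>S\<^esub> src S (cou B (l \<sharp> g))) = cou B (a \<otimes>\<^bsub>S\<^esub> (l \<sharp> g))"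
    if [simp]: "l \<in> carrier L" "g \<in> carrier H" for l g
  proof (rule LH.lin_eqI[OF _ _ _ a])
    show "cou B ((m \<sharp> h) \<otimes>\<^bsub>S\<^esub> src S (cou B (l \<sharp> g))) = cou B ((m \<sharp> h) \<otimes>\<^bsub>S\<^esub> (l \<sharp> g))"
      if [simp]: "m \<in> carrier L" "h \<in> carrier H" for m h
      using S_sel(6) by (simp add: cou_pure cou_mult_pure H.counit_one act_smult_right L.smult_mult_right)
  qed (rule lin_intro | simp)+
qed (rule lin_intro | simp add: a)+

text \<open>After the counit a target cannot be told from a source, because \<open>\<iota>\<close>
  preserves the counit and the coaction is counital. The target form of the counit axiom thus
  follows from the source form.\<close>

lemma cou_tgt_src:
  assumes a: "a \<in> carrier S" and [simp]: "l \<in> carrier L"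
  shows "cou B (a \<otimes>\<^bsub>S\<^esub> tgt S l) = cou B (a \<otimes>\<^bsub>S\<^esub> src S l)"
proof (rule LH.lin_eqI[OF _ _ _ a])
  show "cou B ((m \<sharp> h) \<otimes>\<^bsub>S\<^esub> tgt S l) = cou B ((m \<sharp> h) \<otimes>\<^bsub>S\<^esub> src S l)"
    if [simp]: "m \<in> carrier L" "h \<in> carrier H" for m h
  proof -
    have "cou B ((m \<sharp> h) \<otimes>\<^bsub>S\<^esub> tgt S l) = \<delta> L l (\<lambda>p n. cou B ((m \<sharp> h) \<otimes>\<^bsub>S\<^esub> (n \<sharp> \<iota> p)))"
      by (simp add: S_tgt L_pulls) (rule coact_lift_hom[OF module_S cou_lin module_L], simp)
    also have "\<dots> = \<delta> L l (\<lambda>p n. \<epsilon> p \<odot>\<^bsub>L\<^esub> (m \<otimes>\<^bsub>L\<^esub> (h \<rhd> n)))"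
      by (simp add: cou_mult_pure H.antipode_inv_counit)
    also have "\<dots> = m \<otimes>\<^bsub>L\<^esub> (h \<rhd> l)"
      by (rule coact_lift_counit[OF module_L]) (rule lin_intro | simp)+
    also have "\<dots> = cou B ((m \<sharp> h) \<otimes>\<^bsub>S\<^esub> src S l)"
      using S_sel(6) by (simp add: cou_mult_pure H.counit_one)
    finally show ?thesis .
  qed
qed (rule lin_intro | simp)+

text \<open>The lifted map is balanced by \<open>cou_tgt\<close>: a target factor in the first leg
  becomes multiplication on the right after the counit, hence a source factor in front of the second
  leg.\<close>

lemma cou_left_S:
  assumes a: "a \<in> carrier S"
  shows "tensor_lift S (\<lambda>x y. src S (cou B x) \<otimes>\<^bsub>S\<^esub> y) (cop B a) = a"
proof -
  let ?f = "\<lambda>x y. src S (cou B x) \<otimes>\<^bsub>S\<^esub> y"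
  have bal: "balanced L (st_bimodule S) (st_bimodule S) S ?f"
    by (rule balancedI)
      (auto intro!: additive_mapI simp: linD(2)[OF cou_lin] linD(2)[OF lin_src] S.l_distr S.r_distr
        cou_tgt src_src S.m_assoc)
  have ad: "additive_map (st_tensor L S) S (tensor_lift S ?f)"
    by (rule St.T2.P.lift_additive_map[OF LH.Z_abelian bal])
  have f: "tensor_lift S ?f (x \<diamondop> y) = ?f x y" if "x \<in> carrier S" "y \<in> carrier S" for x y
    using St.T2.P.lift_pure[OF LH.Z_abelian bal] that by simp
  show ?thesis
    using a
  proof (induction rule: LH.Z_induct)
    case (pure l h)
    note [simp] = pure
    have "tensor_lift S ?f (cop B (l \<sharp> h)) = \<Delta> S h (\<lambda>x y. \<epsilon> x \<odot>\<^bsub>S\<^esub> (l \<sharp> y))"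
      using H.comul_lift_hom_additive_map[OF St.T2.P.T_abelian LH.Z_abelian ad, of "\<lambda>h1 h2. (l \<sharp> h1) \<diamondop> (\<one>\<^bsub>L\<^esub> \<sharp> h2)" h]
      by (simp add: cop_pure f comul_lift_ST cou_pure linD(3)[OF lin_src] S.smult_mult_left src_mult)
    also have "\<dots> = l \<sharp> h"
      by (rule H.comul_lift_counit_left[OF module_S]) (rule lin_intro | simp)+
    finally show ?case .
  next
    case (add z w)
    then show ?case by (simp add: additive_map_add[OF cop_add_comp[OF ad]])
  qed
qed

lemma cou_right_S:
  assumes a: "a \<in> carrier S"
  shows "tensor_lift S (\<lambda>x y. tgt S (cou B y) \<otimes>\<^bsub>S\<^esub> x) (cop B a) = a"
proof -
  let ?f = "\<lambda>x y. tgt S (cou B y) \<otimes>\<^bsub>S\<^esub> x"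
  have bal: "balanced L (st_bimodule S) (st_bimodule S) S ?f"
    by (rule balancedI)
      (auto intro!: additive_mapI simp: linD(2)[OF cou_lin] linD(2)[OF lin_tgt] S.l_distr S.r_distr
        cou_src tgt_tgt S.m_assoc)
  have ad: "additive_map (st_tensor L S) S (tensor_lift S ?f)"
    by (rule St.T2.P.lift_additive_map[OF LH.Z_abelian bal])
  have f: "tensor_lift S ?f (x \<diamondop> y) = ?f x y" if "x \<in> carrier S" "y \<in> carrier S" for x y
    using St.T2.P.lift_pure[OF LH.Z_abelian bal] that by simp
  show ?thesis
    using a
  proof (induction rule: LH.Z_induct)
    case (pure l h)
    note [simp] = pure
    have "tensor_lift S ?f (cop B (l \<sharp> h)) = \<Delta> S h (\<lambda>x y. \<epsilon> y \<odot>\<^bsub>S\<^esub> (l \<sharp> x))"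
      using H.comul_lift_hom_additive_map[OF St.T2.P.T_abelian LH.Z_abelian ad, of "\<lambda>h1 h2. (l \<sharp> h1) \<diamondop> (\<one>\<^bsub>L\<^esub> \<sharp> h2)" h]
      by (simp add: cop_pure f comul_lift_ST cou_pure linD(3)[OF lin_tgt] S.smult_mult_left tgt_one)
    also have "\<dots> = l \<sharp> h"
      by (rule H.comul_lift_counit_right[OF module_S]) (rule lin_intro | simp)+
    finally show ?case .
  next
    case (add z w)
    then show ?case by (simp add: additive_map_add[OF cop_add_comp[OF ad]])
  qed
qed

theorem smash_bialgebroid: "bialgebroid K L B"
proof -
  have B_target: "tensor_lift B = tensor_lift S"
    by (rule tensor_lift_cong_target) simp_all
  show ?thesis
  proof (intro bialgebroid.intro bialgebroid_axioms.intro L.assoc_algebra_axioms B_algebra)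
    show "src B \<in> algebra_hom K L B" "tgt B \<in> algebra_hom K (op_alg L) B"
      using src_alg_hom tgt_alg_hom by (simp_all add: algebra_hom_def ring_hom_def)
    show "cop B \<in> bimodule_hom L (st_bimodule B) (st_tensor L B)"
      using cop_left_lin cop_right_lin by (simp add: bimodule_hom_iff)
    show "cop B a \<in> takeuchi L B" if "a \<in> carrier B" for a
      using cop_takeuchi_S[of a] that by (simp add: takeuchi_def)
    show "cop B \<in> ring_hom B (st_tensor L B)"
      using cop_in cop_mult_S cop_one linD(2)[OF cop_lin] by (auto simp: ring_hom_def)
    show "cou B \<in> bimodule_hom L (st_bimodule B) (regular_bimodule L)"
      using linD[OF cou_lin] cou_src cou_tgt by (auto simp: bimodule_hom_def regular_bimodule_def)
    show "cou B (a \<otimes>\<^bsub>B\<^esub> tgt B (cou B b)) = cou B (a \<otimes>\<^bsub>B\<^esub> b)" if "a \<in> carrier B" "b \<in> carrier B" for a b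
      using cou_tgt_src[of a "cou B b"] cou_src_right[of a b] that by simp
  qed (simp_all add: src_tgt cop_coassoc_S cou_one_S cou_src_right cou_left_S cou_right_S B_target)
qed

end

section \<open>The coopposite bialgebroid\<close>

text \<open>The tensor constructions use the base ring only through its carrier. A ring and its
  opposite therefore give literally the same tensor sets, and only the bimodule structures have to
  be exchanged.\<close>

lemma tensor_ring_cong:
  assumes "carrier R = carrier R'"
  shows "pure R = pure R'" "tensor_group R = tensor_group R'" "tensor_rmult R = tensor_rmult R'"
    "tensor R = tensor R'" "tensor_map R = tensor_map R'" "tensor_assoc R = tensor_assoc R'"
proof -
  have rel: "tensor_relations R M N = tensor_relations R' M N" for M N
    by (simp add: tensor_relations_def assms)
  show p: "pure R = pure R'" by (intro ext) (simp add: pure_def rel)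
  show g: "tensor_group R = tensor_group R'" by (intro ext) (simp add: tensor_group_def rel)
  show rm: "tensor_rmult R = tensor_rmult R'" by (intro ext) (simp add: tensor_rmult_def p g)
  show t: "tensor R = tensor R'" by (intro ext) (simp add: tensor_def p g rm)
  show "tensor_map R = tensor_map R'" by (intro ext) (simp add: tensor_map_def p t)
  show "tensor_assoc R = tensor_assoc R'" by (intro ext) (simp add: tensor_assoc_def p t)
qed

text \<open>A bimodule regarded over the opposite ring. The base ring is not changed, because
  \<open>bimod\<close> refers to it only through its carrier.\<close>

definition flip :: "('r, 'm, 'y) bimodule_scheme \<Rightarrow> ('r, 'm, 'y) bimodule_scheme" where
  "flip M = M\<lparr>lact := (\<lambda>r x. ract M x r), ract := (\<lambda>x r. lact M r x)\<rparr>"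

lemma flip_sel [simp]:
  "carrier (flip M) = carrier M" "add (flip M) = add M" "ring.zero (flip M) = ring.zero M"
  "monoid.mult (flip M) = monoid.mult M" "one (flip M) = one M"
  "lact (flip M) r x = ract M x r" "ract (flip M) x r = lact M r x"
  by (simp_all add: flip_def)

lemma bimod_flip:
  assumes "bimod R M"
  shows "bimod R (flip M)"
proof -
  interpret bimod R M by fact
  interpret F: abelian_group "flip M"
    by (rule abelian_group_cong[OF M.abelian_group_axioms]) simp_all
  show ?thesis
    by unfold_locales (simp_all add: lact_closed ract_closed lact_add ract_add lact_ract)
qed

context tensor_pair
begin

lemma flip_pair: "tensor_pair R (flip N) (flip M)"
  by (simp add: tensor_pair_def bimod_flip M.bimod_axioms N.bimod_axioms)

interpretation Sw: tensor_pair R "flip N" "flip M" by (rule flip_pair)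

definition swap where
  "swap = tensor_lift (tensor R (flip N) (flip M)) (\<lambda>x y. pure R (flip N) (flip M) y x)"

lemma swap_balanced: "balanced R M N (tensor R (flip N) (flip M)) (\<lambda>x y. pure R (flip N) (flip M) y x)"
  by (rule balancedI)
    (use Sw.pure_additive_map_left Sw.pure_additive_map_right Sw.pure_balanced in \<open>auto simp: additive_map_def\<close>)

lemma swap_additive_map: "additive_map T (tensor R (flip N) (flip M)) swap"
  unfolding swap_def by (rule lift_additive_map[OF Sw.T_abelian swap_balanced])

lemma swap_pure: "\<lbrakk>x \<in> carrier M; y \<in> carrier N\<rbrakk> \<Longrightarrow> swap (pure R M N x y) = pure R (flip N) (flip M) y x"
  unfolding swap_def by (rule lift_pure[OF Sw.T_abelian swap_balanced])

lemma swap_closed: "z \<in> carrier T \<Longrightarrow> swap z \<in> carrier (tensor R (flip N) (flip M))"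
  by (rule additive_map_closed[OF swap_additive_map])

text \<open>Interchanging the factors exchanges the two outer actions; this and
  \<open>swap_ract\<close> make the coopposite coproduct bilinear over the opposite base.\<close>

lemma swap_lact: "\<lbrakk>r \<in> carrier R; z \<in> carrier T\<rbrakk> \<Longrightarrow> swap (lact T r z) = ract (tensor R (flip N) (flip M)) (swap z) r"
proof -
  assume r: "r \<in> carrier R" and z: "z \<in> carrier T"
  show ?thesis
    using z
    by (induction rule: T_induct)
      (use r in \<open>simp_all add: lact_pure swap_pure Sw.ract_pure M.lact_closed T.lact_add T.lact_closed
        additive_map_add[OF swap_additive_map] swap_closed Sw.T.ract_add\<close>)
qed

lemma swap_ract: "\<lbrakk>r \<in> carrier R; z \<in> carrier T\<rbrakk> \<Longrightarrow> swap (ract T z r) = lact (tensor R (flip N) (flip M)) r (swap z)"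
proof -
  assume r: "r \<in> carrier R" and z: "z \<in> carrier T"
  show ?thesis
    using z
    by (induction rule: T_induct)
      (use r in \<open>simp_all add: ract_pure swap_pure Sw.lact_pure N.ract_closed T.ract_add T.ract_closed
        additive_map_add[OF swap_additive_map] swap_closed Sw.T.lact_add\<close>)
qed

lemma lift_swap:
  assumes "abelian_group A" "balanced R (flip N) (flip M) A f" "balanced R M N A (\<lambda>x y. f y x)" "z \<in> carrier T"
  shows "tensor_lift A f (swap z) = tensor_lift A (\<lambda>x y. f y x) z"
proof -
  note f = Sw.lift_additive_map[OF assms(1,2)]
  have "additive_map T A (\<lambda>z. tensor_lift A f (swap z))"
    using f swap_additive_map by (auto simp: additive_map_def Pi_iff)
  then show ?thesis
    by (rule additive_map_eqI[OF _ lift_additive_map[OF assms(1,3)] _ assms(4)])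
      (simp add: swap_pure Sw.lift_pure[OF assms(1,2)] lift_pure[OF assms(1,3)])
qed

end

lemma st_bimodule_swap: "st_bimodule (st_swap B) = flip (st_bimodule B)"
  by (simp add: st_bimodule_def st_swap_def flip_def)

lemma coop_sel [simp]:
  "carrier (coop A B) = carrier B" "add (coop A B) = add B" "ring.zero (coop A B) = ring.zero B"
  "monoid.mult (coop A B) = monoid.mult B" "one (coop A B) = one B" "smult (coop A B) = smult B"
  "src (coop A B) = tgt B" "tgt (coop A B) = src B" "cou (coop A B) = cou B"
  by (simp_all add: coop_def st_swap_def)

lemma st_bimodule_coop: "st_bimodule (coop A B) = flip (st_bimodule B)"
  by (simp add: st_bimodule_def flip_def)

text \<open>The base \<open>L'\<close> is described by its fields, not as a fixed record, since it
  will be \<open>op_base\<close>, which carries an action and a coaction besides the opposite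
  product.\<close>

lemma (in bialgebroid) coop_bialgebroid:
  fixes L' :: "('k, 'l, 'z) module_scheme"
  assumes L': "carrier L' = carrier L" "add L' = add L" "ring.zero L' = ring.zero L" "one L' = one L"
    "smult L' = smult L" "monoid.mult L' = (\<lambda>x y. y \<otimes>\<^bsub>L\<^esub> x)"
    and alg: "assoc_algebra K L'"
  shows "bialgebroid K L' (coop L B)"
proof -
  interpret L': assoc_algebra K L' by fact
  interpret s: st_alg K L B
    by unfold_locales (rule src_hom tgt_antihom src_tgt_commute; assumption?)+
  let ?M = "st_bimodule B"
  let ?F = "flip ?M"
  let ?T = "tensor L ?M ?M"
  let ?T' = "tensor L ?F ?F"
  let ?C = "coop L B"
  let ?\<sigma> = "s.T2.P.swap"
  have C_alg: "assoc_algebra K ?C"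
    by (rule assoc_algebra_cong[OF B.assoc_algebra_axioms]) simp_all
  have src': "src ?C \<in> algebra_hom K L' ?C" and tgt': "tgt ?C \<in> algebra_hom K (op_alg L') ?C"
    using src_hom tgt_antihom by (auto simp: algebra_hom_def ring_hom_def op_alg_def L')
  interpret c: st_alg K L' ?C
    by (intro st_alg.intro st_alg_axioms.intro C_alg alg src' tgt')
      (simp add: L' src_tgt_commute)
  note ring = tensor_ring_cong[of L' L, OF L'(1)]
  have op_ring: "tensor (op_alg L) = tensor L" "pure (op_alg L) = pure L"
    by (rule tensor_ring_cong; simp add: op_alg_def)+
  have cop: "cop ?C = (\<lambda>a. ?\<sigma> (cop B a))"
    by (simp add: coop_def st_bimodule_swap op_ring s.T2.P.swap_def)
  note M = st_bimodule_coop
  have left: "left_lin L ?M ?T (cop B)" and right: "right_lin L ?M ?T (cop B)"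
    using cop_bimodule_hom by (simp_all add: bimodule_hom_iff)
  have cop_additive_map: "additive_map ?M ?T (cop B)" using left by (simp add: left_lin_def)
  have cop_in: "a \<in> carrier B \<Longrightarrow> cop B a \<in> carrier ?T" for a
    using additive_map_closed[OF cop_additive_map] by simp
  have cop_comp: "additive_map ?M N (\<lambda>a. \<phi> (cop B a))" if "additive_map ?T N \<phi>" for N \<phi>
    using cop_additive_map that by (auto simp: additive_map_def Pi_iff)
  note \<sigma>_add = additive_map_add[OF s.T2.P.swap_additive_map] and \<sigma>_in = s.T2.P.swap_closed and \<sigma>_pure = s.T2.P.swap_pure
  have left': "left_lin L ?F ?T' (cop ?C)" and right': "right_lin L ?F ?T' (cop ?C)"
    using left right s.T2.P.swap_lact s.T2.P.swap_ract cop_comp[OF s.T2.P.swap_additive_map] cop_in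
    by (auto simp: left_lin_def right_lin_def cop additive_map_def)
  interpret f3: tensor_triple L ?F ?F ?F
    by (simp add: tensor_triple_def bimod_flip s.C.bimod_axioms)
  note unf = M ring coop_sel L'(1)
  \<comment> \<open>Right multiplication by \<open>(c, d)\<close> after the interchange is right
    multiplication by \<open>(d, c)\<close> before it. With source and target exchanged too, the
    Takeuchi condition becomes the original one with its sides exchanged.\<close>
  have rm_\<sigma>: "tensor_rmult L ?F ?F (?\<sigma> z) c d = ?\<sigma> (s.rm z d c)"
    if "z \<in> carrier ?T" "c \<in> carrier B" "d \<in> carrier B" for z c d
    using that(1)
    by (induction rule: s.st_induct)
      (use that(2,3) c.rm_st[unfolded unf] additive_map_add[OF c.rm_additive_map[unfolded unf]] in
        \<open>simp_all add: \<sigma>_pure \<sigma>_add \<sigma>_in s.rm_st additive_map_add[OF s.rm_additive_map] s.rm_in\<close>)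
  have takeuchi: "cop ?C a \<in> takeuchi L' ?C" if a: "a \<in> carrier B" for a
  proof -
    have t: "s.rm (cop B a) (tgt B l) \<one>\<^bsub>B\<^esub> = s.rm (cop B a) \<one>\<^bsub>B\<^esub> (src B l)" if "l \<in> carrier L" for l
      using cop_takeuchi[OF a] that by (simp add: takeuchi_def)
    show ?thesis
      by (simp add: takeuchi_def unf cop \<sigma>_in cop_in a rm_\<sigma> t)
  qed
  have coassoc: "tensor_assoc L ?F ?F ?F (tensor_map L ?T' ?F (cop ?C) id (cop ?C a)) =
     tensor_map L ?F ?T' id (cop ?C) (cop ?C a)" if a: "a \<in> carrier B" for a
  proof -
    note src_M = s.T2.P.tensor_pair_axioms and src_F = s.T2.P.flip_pair
    define F1 where "F1 = (\<lambda>z. tensor_assoc L ?M ?M ?M (tensor_map L ?T ?M (cop B) id z))"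
    define F2 where "F2 = tensor_map L ?M ?T id (cop B)"
    define G1 where "G1 = (\<lambda>z. tensor_assoc L ?F ?F ?F (tensor_map L ?T' ?F (cop ?C) id z))"
    define G2 where "G2 = tensor_map L ?F ?T' id (cop ?C)"
    \<comment> \<open>Reversal of threefold tensors: interchange the outer factors, interchange the
      inner pair, and reassociate. It carries the two sides of coassociativity for
      \<open>cop B\<close> to those for the coopposite, each to the opposite side, as facts 1 and 2
      record.\<close>
    define \<Psi> where "\<Psi> = (\<lambda>z. tensor_assoc L ?F ?F ?F (tensor_map L ?T' ?F ?\<sigma> id (s.T3.P.swap z)))"
    have \<sigma>_right: "right_lin L (flip ?T) ?T' ?\<sigma>"
      using s.T2.P.swap_additive_map s.T2.P.swap_lact by (simp add: right_lin_def additive_map_def)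
    note m1 = src_M s.T3'.P.tensor_pair_axioms right left_lin_id[of L ?M]
    note m2 = src_M s.T3.P.tensor_pair_axioms right_lin_id[of L ?M] left
    note n1 = src_F f3.MN_P.tensor_pair_axioms right' left_lin_id[of L ?F]
    note n2 = src_F f3.M_NP.tensor_pair_axioms right_lin_id[of L ?F] left'
    note p1 = s.T3.P.flip_pair f3.MN_P.tensor_pair_axioms \<sigma>_right left_lin_id[of L ?F]
    have add: "additive_map ?T (tensor L ?M ?T) F1" "additive_map ?T (tensor L ?M ?T) F2"
      "additive_map ?T' (tensor L ?F ?T') G1" "additive_map ?T' (tensor L ?F ?T') G2"
      using tensor_map_additive_map[OF m1] s.A3.tensor_assoc_additive_map tensor_map_additive_map[OF m2]
        tensor_map_additive_map[OF n1] f3.tensor_assoc_additive_map tensor_map_additive_map[OF n2]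
      by (auto simp: F1_def F2_def G1_def G2_def additive_map_def Pi_iff)
    have \<Psi>: "additive_map (tensor L ?M ?T) (tensor L ?F ?T') \<Psi>"
      using tensor_map_additive_map[OF p1] f3.tensor_assoc_additive_map s.T3.P.swap_additive_map
      by (auto simp: \<Psi>_def additive_map_def Pi_iff)
    have comp: "additive_map ?T N (\<lambda>z. \<phi> (\<psi> z))" if "additive_map ?T Q \<psi>" "additive_map Q N \<phi>" for Q N \<phi> \<psi>
      using that by (auto simp: additive_map_def Pi_iff)
    have \<Psi>_pure: "\<Psi> (pure L ?M ?T x w) = tensor_assoc L ?F ?F ?F (pure L ?T' ?F (?\<sigma> w) x)"
      if "x \<in> carrier B" "w \<in> carrier ?T" for x w
      using that by (simp add: \<Psi>_def s.T3.P.swap_pure tensor_map_pure[OF p1])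
    have 1: "G1 (?\<sigma> z) = \<Psi> (F2 z)" if "z \<in> carrier ?T" for z
      by (rule s.T2.P.additive_map_eqI[OF comp[OF s.T2.P.swap_additive_map add(3)] comp[OF add(2) \<Psi>] _ that])
        (simp add: \<sigma>_pure G1_def F2_def tensor_map_pure[OF n1, unfolded cop] tensor_map_pure[OF m2] \<Psi>_pure cop_in cop)
    have assoc: "\<Psi> (s.A3.assoc_inner w y) = pure L ?F ?T' y (?\<sigma> w)" if "w \<in> carrier ?T" "y \<in> carrier B" for w y
    proof (rule s.T2.P.additive_map_eqI[OF _ _ _ that(1)])
      show "additive_map ?T (tensor L ?F ?T') (\<lambda>w. \<Psi> (s.A3.assoc_inner w y))"
        by (rule comp[OF s.A3.assoc_inner_additive_map \<Psi>]) (use that in simp)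
      show "additive_map ?T (tensor L ?F ?T') (\<lambda>w. pure L ?F ?T' y (?\<sigma> w))"
        by (rule comp[OF s.T2.P.swap_additive_map f3.M_NP.pure_additive_map_right]) (use that in simp)
      show "\<Psi> (s.A3.assoc_inner (pure L ?M ?M u v) y) = pure L ?F ?T' y (?\<sigma> (pure L ?M ?M u v))"
        if "u \<in> carrier ?M" "v \<in> carrier ?M" for u v
        using that \<open>y \<in> carrier B\<close>
        by (simp add: s.A3.assoc_inner_pure \<Psi>_pure \<sigma>_pure f3.tensor_assoc_pure)
    qed
    have 2: "G2 (?\<sigma> z) = \<Psi> (F1 z)" if "z \<in> carrier ?T" for z
      by (rule s.T2.P.additive_map_eqI[OF comp[OF s.T2.P.swap_additive_map add(4)] comp[OF add(1) \<Psi>] _ that])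
        (simp add: \<sigma>_pure G2_def F1_def tensor_map_pure[OF n2, unfolded cop] tensor_map_pure[OF m1]
          s.A3.tensor_assoc_pure1 cop_in assoc cop)
    have "F1 (cop B a) = F2 (cop B a)"
      using cop_coassoc[OF a] by (simp add: F1_def F2_def)
    then have "G1 (cop ?C a) = G2 (cop ?C a)"
      by (simp add: cop 1 2 cop_in a)
    then show ?thesis by (simp add: G1_def G2_def)
  qed
  have mult: "cop ?C (a \<otimes>\<^bsub>B\<^esub> b) = cop ?C a \<otimes>\<^bsub>?T'\<^esub> cop ?C b" if a: "a \<in> carrier B" and b: "b \<in> carrier B" for a b
  proof -
    note t = cop_takeuchi[OF a] and t' = takeuchi[OF a]
    \<comment> \<open>The interchange respects the product because both left factors lie in their
      Takeuchi products; additivity in \<open>w\<close> is available on each side for that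
      reason.\<close>
    have "?\<sigma> (cop B a \<otimes>\<^bsub>?T\<^esub> w) = ?\<sigma> (cop B a) \<otimes>\<^bsub>?T'\<^esub> ?\<sigma> w" if "w \<in> carrier ?T" for w
      using that
    proof (induction rule: s.st_induct)
      case (pure x y)
      then show ?case
        using c.mult_st[OF t', of y x, unfolded unf]
        by (simp add: s.mult_st[OF t] \<sigma>_pure rm_\<sigma>[symmetric] cop_in a cop)
    next
      case (add z w)
      then show ?case
        using additive_map_add[OF c.mult_additive_map[OF t', unfolded unf]] additive_map_closed[OF s.mult_additive_map[OF t]]
        by (simp add: additive_map_add[OF s.mult_additive_map[OF t]] \<sigma>_add \<sigma>_in cop)
    qed
    moreover have "cop B (a \<otimes>\<^bsub>B\<^esub> b) = cop B a \<otimes>\<^bsub>?T\<^esub> cop B b"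
      using cop_ring_hom a b by (auto simp: ring_hom_def)
    ultimately show ?thesis using b by (simp add: cop cop_in)
  qed
  have one: "cop ?C \<one>\<^bsub>B\<^esub> = \<one>\<^bsub>?T'\<^esub>"
  proof -
    have "cop B \<one>\<^bsub>B\<^esub> = pure L ?M ?M \<one>\<^bsub>B\<^esub> \<one>\<^bsub>B\<^esub>"
      using cop_ring_hom by (simp add: ring_hom_def tensor_def Let_def)
    then show ?thesis by (simp add: cop \<sigma>_pure) (simp add: tensor_def Let_def)
  qed
  have s: "\<And>l m. \<lbrakk>l \<in> carrier L; m \<in> carrier L\<rbrakk> \<Longrightarrow> src B (l \<otimes>\<^bsub>L\<^esub> m) = src B l \<otimes>\<^bsub>B\<^esub> src B m"
     "\<And>l m. \<lbrakk>l \<in> carrier L; m \<in> carrier L\<rbrakk> \<Longrightarrow> src B (l \<oplus>\<^bsub>L\<^esub> m) = src B l \<oplus>\<^bsub>B\<^esub> src B m"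
    using src_hom by (auto simp: algebra_hom_def ring_hom_def)
  have t: "\<And>l m. \<lbrakk>l \<in> carrier L; m \<in> carrier L\<rbrakk> \<Longrightarrow> tgt B (l \<otimes>\<^bsub>L\<^esub> m) = tgt B m \<otimes>\<^bsub>B\<^esub> tgt B l"
     "\<And>l m. \<lbrakk>l \<in> carrier L; m \<in> carrier L\<rbrakk> \<Longrightarrow> tgt B (l \<oplus>\<^bsub>L\<^esub> m) = tgt B l \<oplus>\<^bsub>B\<^esub> tgt B m"
    using tgt_antihom by (auto simp: algebra_hom_def ring_hom_def op_alg_def)
  have e: "\<And>a. a \<in> carrier B \<Longrightarrow> cou B a \<in> carrier L"
     "\<And>a b. \<lbrakk>a \<in> carrier B; b \<in> carrier B\<rbrakk> \<Longrightarrow> cou B (a \<oplus>\<^bsub>B\<^esub> b) = cou B a \<oplus>\<^bsub>L\<^esub> cou B b"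
     "\<And>l a. \<lbrakk>l \<in> carrier L; a \<in> carrier B\<rbrakk> \<Longrightarrow> cou B (src B l \<otimes>\<^bsub>B\<^esub> a) = l \<otimes>\<^bsub>L\<^esub> cou B a"
     "\<And>l a. \<lbrakk>l \<in> carrier L; a \<in> carrier B\<rbrakk> \<Longrightarrow> cou B (tgt B l \<otimes>\<^bsub>B\<^esub> a) = cou B a \<otimes>\<^bsub>L\<^esub> l"
    using cou_bimodule_hom by (auto simp: bimodule_hom_def regular_bimodule_def)
  have target: "tensor_lift ?C = tensor_lift B"
    by (rule tensor_lift_cong_target) simp_all
  have lift: "tensor_lift B f (cop ?C a) = tensor_lift B (\<lambda>x y. f y x) (cop B a)"
    if "a \<in> carrier B" "balanced L ?F ?F B f" "balanced L ?M ?M B (\<lambda>x y. f y x)" for f a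
    unfolding cop by (rule s.T2.P.lift_swap) (use that in \<open>simp_all add: cop_in B.M.abelian_group_axioms\<close>)
  \<comment> \<open>The left counit law of the coopposite is the right counit law of
    \<open>B\<close> with the summed variables renamed, and the other way round for
    \<open>right_cou\<close>.\<close>
  have left_cou: "tensor_lift B (\<lambda>x y. tgt B (cou B x) \<otimes>\<^bsub>B\<^esub> y) (cop ?C a) = a" if "a \<in> carrier B" for a
  proof (subst lift[OF that])
    show "balanced L ?F ?F B (\<lambda>x y. tgt B (cou B x) \<otimes>\<^bsub>B\<^esub> y)"
      "balanced L ?M ?M B (\<lambda>x y. tgt B (cou B y) \<otimes>\<^bsub>B\<^esub> x)"
      by (auto intro!: balancedI additive_mapI simp: e t B.l_distr B.r_distr B.m_assoc)
    show "tensor_lift B (\<lambda>x y. tgt B (cou B y) \<otimes>\<^bsub>B\<^esub> x) (cop B a) = a"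
      using cou_right[OF that] by simp
  qed
  have right_cou: "tensor_lift B (\<lambda>x y. src B (cou B y) \<otimes>\<^bsub>B\<^esub> x) (cop ?C a) = a" if "a \<in> carrier B" for a
  proof (subst lift[OF that])
    show "balanced L ?F ?F B (\<lambda>x y. src B (cou B y) \<otimes>\<^bsub>B\<^esub> x)"
      "balanced L ?M ?M B (\<lambda>x y. src B (cou B x) \<otimes>\<^bsub>B\<^esub> y)"
      by (auto intro!: balancedI additive_mapI simp: e s B.l_distr B.r_distr B.m_assoc)
    show "tensor_lift B (\<lambda>x y. src B (cou B x) \<otimes>\<^bsub>B\<^esub> y) (cop B a) = a"
      using cou_left[OF that] by simp
  qed
  show ?thesis
  proof (intro bialgebroid.intro bialgebroid_axioms.intro alg C_alg src' tgt')
    show "cop ?C \<in> bimodule_hom L' (st_bimodule ?C) (st_tensor L' ?C)"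
      using left' right' by (simp add: bimodule_hom_iff unf left_lin_def right_lin_def)
    show "cop ?C \<in> ring_hom ?C (st_tensor L' ?C)"
      using mult one c.T2.P.T.add.m_closed additive_map_add[OF left'[unfolded left_lin_def, THEN conjunct1]]
        additive_map_closed[OF left'[unfolded left_lin_def, THEN conjunct1]]
      by (auto simp: ring_hom_def unf)
    show "cou ?C \<in> bimodule_hom L' (st_bimodule ?C) (regular_bimodule L')"
      using e by (auto simp: bimodule_hom_def regular_bimodule_def L')
  qed (auto simp: unf takeuchi coassoc left_cou right_cou target L' src_tgt_commute cou_one
      cou_mult_src cou_mult_tgt)
qed

section \<open>The opposite base algebra\<close>

text \<open>The balanced tensor product does not see the multiplicative fields of its factors.\<close>

definition same_bimodule :: "('r, 'm, 'x) bimodule_scheme \<Rightarrow> ('r, 'm, 'y) bimodule_scheme \<Rightarrow> bool" where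
  "same_bimodule M M' \<longleftrightarrow> carrier M = carrier M' \<and> add M = add M' \<and> ring.zero M = ring.zero M' \<and>
     lact M = lact M' \<and> ract M = ract M'"

lemma same_bimoduleD:
  assumes "same_bimodule M M'"
  shows "carrier M = carrier M'" "add M = add M'" "ring.zero M = ring.zero M'" "lact M = lact M'" "ract M = ract M'"
  using assms by (simp_all add: same_bimodule_def)

lemma same_target: "same_bimodule M M' \<Longrightarrow> tensor_lift M = tensor_lift M'"
  by (rule tensor_lift_cong_target) (simp_all add: same_bimodule_def)

lemma same_pure:
  assumes "same_bimodule M M'" "same_bimodule N N'"
  shows "pure R M N = pure R M' N'"
  by (intro ext) (simp add: pure_def tensor_relations_def same_bimoduleD[OF assms(1)] same_bimoduleD[OF assms(2)])

lemma same_tensor_group: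
  assumes "same_bimodule M M'" "same_bimodule N N'"
  shows "tensor_group R M N = tensor_group R M' N'"
  by (simp add: tensor_group_def tensor_relations_def same_bimoduleD[OF assms(1)] same_bimoduleD[OF assms(2)])

lemma same_tensor:
  assumes "same_bimodule M M'" "same_bimodule N N'"
  shows "same_bimodule (tensor R M N) (tensor R M' N')"
  by (simp add: same_bimodule_def tensor_def Let_def same_tensor_group[OF assms] same_pure[OF assms]
      same_bimoduleD[OF assms(1)] same_bimoduleD[OF assms(2)])

lemma same_tensor_map:
  assumes "same_bimodule M M'" "same_bimodule N N'"
  shows "tensor_map R M N = tensor_map R M' N'"
  by (intro ext) (simp add: tensor_map_def same_pure[OF assms] same_target[OF same_tensor[OF assms]])

lemma same_tensor_assoc:
  assumes "same_bimodule M M'" "same_bimodule N N'" "same_bimodule P P'"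
  shows "tensor_assoc R M N P = tensor_assoc R M' N' P'"
proof -
  note NP = same_tensor[OF assms(2,3), of R]
  show ?thesis
    by (intro ext) (simp add: tensor_assoc_def Let_def same_pure[OF assms(2,3)] same_pure[OF assms(1) NP]
        same_target[OF same_tensor[OF assms(1) NP]])
qed

lemma same_bimodule_hom:
  assumes "same_bimodule M M'" "same_bimodule N N'"
  shows "bimodule_hom R M N = bimodule_hom R M' N'"
  by (simp add: bimodule_hom_def same_bimoduleD[OF assms(1)] same_bimoduleD[OF assms(2)])

lemma op_alg_sel [simp]:
  "carrier (op_alg A) = carrier A" "add (op_alg A) = add A" "ring.zero (op_alg A) = ring.zero A"
  "one (op_alg A) = one A" "monoid.mult (op_alg A) = (\<lambda>x y. y \<otimes>\<^bsub>A\<^esub> x)"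
  by (simp_all add: op_alg_def)

lemma op_hopf_sel [simp]:
  "carrier (op_hopf H) = carrier H" "add (op_hopf H) = add H" "ring.zero (op_hopf H) = ring.zero H"
  "one (op_hopf H) = one H" "monoid.mult (op_hopf H) = (\<lambda>x y. y \<otimes>\<^bsub>H\<^esub> x)" "smult (op_hopf H) = smult H"
  "comul (op_hopf H) = comul H" "counit (op_hopf H) = counit H" "antipode (op_hopf H) = antipode_inv H"
  by (simp_all add: op_hopf_def op_alg_def)

lemma op_base_sel [simp]:
  "carrier (op_base H L) = carrier L" "add (op_base H L) = add L" "ring.zero (op_base H L) = ring.zero L"
  "one (op_base H L) = one L" "monoid.mult (op_base H L) = (\<lambda>x y. y \<otimes>\<^bsub>L\<^esub> x)" "smult (op_base H L) = smult L"
  "coact (op_base H L) = coact L" "act (op_base H L) x l = act L (antipode_inv H x) l"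
  by (simp_all add: op_base_def op_alg_def)

lemma assoc_algebra_op:
  assumes "assoc_algebra K A" "carrier B = carrier A" "add B = add A" "ring.zero B = ring.zero A"
    "monoid.mult B = (\<lambda>x y. y \<otimes>\<^bsub>A\<^esub> x)" "one B = one A" "smult B = smult A"
  shows "assoc_algebra K B"
proof -
  interpret A: assoc_algebra K A by fact
  have ab: "abelian_group B"
    by (rule abelian_group_cong[OF A.M.abelian_group_axioms]) (simp_all add: assms)
  have "ring B"
    by (rule ringI[OF ab]) (auto intro!: monoidI simp: assms A.m_assoc A.l_distr A.r_distr)
  moreover have "module K B"
    by (rule moduleI[OF A.R.cring_axioms ab])
      (simp_all add: assms A.smult_l_distr A.smult_r_distr A.smult_assoc1)
  ultimately show ?thesis
    by (auto intro!: assoc_algebra.intro assoc_algebra_axioms.intro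
      simp: assms A.smult_mult_left A.smult_mult_right)
qed

text \<open>Both products are double sums of the same terms, one with the outer and inner sums
  interchanged. This makes comultiplication and coaction multiplicative for the opposite
  algebras.\<close>

lemma ktensor_mult_op:
  assumes "assoc_algebra K A" "assoc_algebra K B" "assoc_algebra K A'" "assoc_algebra K B'"
    and sA: "same_bimodule (sym_bimodule A') (sym_bimodule A)" and mA: "monoid.mult A' = (\<lambda>x y. y \<otimes>\<^bsub>A\<^esub> x)"
    and sB: "same_bimodule (sym_bimodule B') (sym_bimodule B)" and mB: "monoid.mult B' = (\<lambda>x y. y \<otimes>\<^bsub>B\<^esub> x)"
    and z: "z \<in> carrier (ktensor K A B)" and w: "w \<in> carrier (ktensor K A B)"
  shows "z \<otimes>\<^bsub>ktensor K A' B'\<^esub> w = w \<otimes>\<^bsub>ktensor K A B\<^esub> z"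
proof -
  interpret A: assoc_algebra K A by fact
  interpret B: assoc_algebra K B by fact
  interpret A': assoc_algebra K A' by fact
  interpret B': assoc_algebra K B' by fact
  interpret t: ktensor_pair K A B "ktensor_module K A B" by (rule ktensor_pair_ktensor_module; unfold_locales)
  interpret t': ktensor_pair K A' B' "ktensor_module K A' B'" by (rule ktensor_pair_ktensor_module; unfold_locales)
  let ?T = "ktensor K A B"
  have cA: "carrier A' = carrier A" and cB: "carrier B' = carrier B"
    using same_bimoduleD[OF sA] same_bimoduleD[OF sB] by simp_all
  note T = same_tensor[OF sA sB, of K]
  have rmult: "tensor_rmult K (sym_bimodule A) (sym_bimodule B) w =
      (\<lambda>c d. tensor_lift ?T (\<lambda>a b. kpure K A B (a \<otimes>\<^bsub>A\<^esub> c) (b \<otimes>\<^bsub>B\<^esub> d)) w)"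
    by (intro ext) (simp add: t.P.rmult_eq)
  have rmult': "tensor_rmult K (sym_bimodule A') (sym_bimodule B') z =
      (\<lambda>c d. tensor_lift ?T (\<lambda>a b. kpure K A B (c \<otimes>\<^bsub>A\<^esub> a) (d \<otimes>\<^bsub>B\<^esub> b)) z)"
    by (intro ext) (simp add: t'.P.rmult_eq mA mB same_target[OF T] same_pure[OF sA sB])
  have "w \<otimes>\<^bsub>?T\<^esub> z = tensor_lift ?T (\<lambda>c d. tensor_lift ?T (\<lambda>a b. kpure K A B (a \<otimes>\<^bsub>A\<^esub> c) (b \<otimes>\<^bsub>B\<^esub> d)) w) z"
    unfolding t.P.mult_eq rmult ..
  also have "\<dots> = tensor_lift ?T (\<lambda>a b. tensor_lift ?T (\<lambda>c d. kpure K A B (a \<otimes>\<^bsub>A\<^esub> c) (b \<otimes>\<^bsub>B\<^esub> d)) z) w"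
    by (rule t.P.lift_fubini[OF t.P.tensor_pair_axioms t.P.T_abelian z w]) (auto intro!: t.P.pure_closed)
  also have "\<dots> = z \<otimes>\<^bsub>ktensor K A' B'\<^esub> w"
    unfolding t'.P.mult_eq rmult' same_target[OF T] ..
  finally show ?thesis by simp
qed

lemma same_sym:
  "\<lbrakk>carrier A' = carrier A; add A' = add A; ring.zero A' = ring.zero A; smult A' = smult A\<rbrakk>
    \<Longrightarrow> same_bimodule (sym_bimodule A') (sym_bimodule A)"
  by (simp add: same_bimodule_def sym_bimodule_def)

lemma same_op_hopf: "same_bimodule (sym_bimodule (op_hopf H)) (sym_bimodule H)"
  and same_op_base: "same_bimodule (sym_bimodule (op_base H L)) (sym_bimodule L)"
  by (rule same_sym; simp)+

lemma ktensor_one: "one (ktensor K A B) = kpure K A B (one A) (one B)"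
  by (simp add: tensor_def Let_def)

lemma lift_op_hopf: "tensor_lift (op_hopf H) = tensor_lift H"
  and lift_op_base: "tensor_lift (op_base H L) = tensor_lift L"
  by (rule tensor_lift_cong_target; simp)+

section \<open>The opposite Hopf algebra and the opposite base algebra\<close>

context bij_hopf
begin

lemma op_hopf_algebra: "hopf_algebra K (op_hopf H)"
proof -
  let ?O = "op_hopf H"
  have alg: "assoc_algebra K ?O"
    by (rule assoc_algebra_op[OF assoc_algebra_axioms]) simp_all
  note s = same_op_hopf[of H]
  note ss = same_tensor[OF s s, of K]
  show ?thesis
  proof (intro hopf_algebra.intro hopf_algebra_axioms.intro alg)
    show "comul ?O \<in> bimodule_hom K (sym_bimodule ?O) (ktensor K ?O ?O)"
      using comul_linear by (simp add: same_bimodule_hom[OF s ss])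
    show "comul ?O \<in> ring_hom ?O (ktensor K ?O ?O)"
      using comul_ring_hom ktensor_mult_op[OF assoc_algebra_axioms assoc_algebra_axioms alg alg s _ s]
      by (auto simp: ring_hom_def same_bimoduleD[OF ss] ktensor_one same_pure[OF s s])
    show "counit ?O \<in> bimodule_hom K (sym_bimodule ?O) (regular_bimodule K)"
      using counit_add counit_smult
      by (auto simp: bimodule_hom_def regular_bimodule_def R.m_comm)
    show "counit ?O \<in> ring_hom ?O K"
      using counit_ring_hom by (simp add: ring_hom_def R.m_comm)
    show "antipode ?O \<in> bimodule_hom K (sym_bimodule ?O) (sym_bimodule ?O)"
      using linD[OF lin_antipode_inv1] by (auto simp: bimodule_hom_def)
    show "tensor_assoc K (sym_bimodule ?O) (sym_bimodule ?O) (sym_bimodule ?O)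
            (tensor_map K (ktensor K ?O ?O) (sym_bimodule ?O) (comul ?O) id (comul ?O h)) =
          tensor_map K (sym_bimodule ?O) (ktensor K ?O ?O) id (comul ?O) (comul ?O h)"
      if "h \<in> carrier ?O" for h
      using coassoc that by (simp add: same_tensor_assoc[OF s s s] same_tensor_map[OF ss s] same_tensor_map[OF s ss])
    show "tensor_lift ?O (\<lambda>x y. antipode ?O x \<otimes>\<^bsub>?O\<^esub> y) (comul ?O h) = counit ?O h \<odot>\<^bsub>?O\<^esub> \<one>\<^bsub>?O\<^esub>"
      if "h \<in> carrier ?O" for h
      using comul_lift_antipode_inv_left[OF module_H lin_id, of h] that by (simp add: lift_op_hopf comul_lift_def)
    show "tensor_lift ?O (\<lambda>x y. x \<otimes>\<^bsub>?O\<^esub> antipode ?O y) (comul ?O h) = counit ?O h \<odot>\<^bsub>?O\<^esub> \<one>\<^bsub>?O\<^esub>"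
      if "h \<in> carrier ?O" for h
      using comul_lift_antipode_inv_right[OF module_H lin_id, of h] that by (simp add: lift_op_hopf comul_lift_def)
  qed (simp_all add: lift_op_hopf counit_left counit_right)
qed

lemma op_bij_hopf: "bij_hopf K (op_hopf H)"
  using bij_betw_inv_into[OF antipode_bij]
  by (intro bij_hopf.intro op_hopf_algebra bij_hopf_axioms.intro) simp

lemma antipode_inv_op_hopf: "h \<in> carrier H \<Longrightarrow> antipode_inv (op_hopf H) h = \<gamma> h"
  using bij_betw_inv_into[OF antipode_bij]
  by (simp, intro inv_into_f_eq[of \<iota>]) (simp_all add: bij_betw_def)

end

context bij_base
begin

lemma op_base_assoc_algebra: "assoc_algebra K (op_base H L)"
  by (rule assoc_algebra_op[OF L.assoc_algebra_axioms]) simp_all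

lemma op_base_algebra: "base_algebra K (op_hopf H) (op_base H L)"
proof -
  let ?O = "op_hopf H" and ?L = "op_base H L"
  let ?T = "ktensor_module K H L"
  interpret O: hopf_algebra K ?O by (rule H.op_hopf_algebra)
  note sH = same_op_hopf[of H] and sL = same_op_base[of H L]
  note sHH = same_tensor[OF sH sH, of K] and sHL = same_tensor[OF sH sL, of K]
  show ?thesis
  proof (intro base_algebra.intro base_algebra_axioms.intro H.op_hopf_algebra op_base_assoc_algebra)
    show "coact ?L \<in> bimodule_hom K (sym_bimodule ?L) (ktensor K ?O ?L)"
      using coact_linear by (simp add: same_bimodule_hom[OF sL sHL])
    show "coact ?L \<in> ring_hom ?L (ktensor K ?O ?L)"
      using coact_ring_hom ktensor_mult_op[OF H.assoc_algebra_axioms L.assoc_algebra_axioms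
        O.assoc_algebra_axioms op_base_assoc_algebra sH _ sL]
      by (auto simp: ring_hom_def same_bimoduleD[OF sHL] ktensor_one same_pure[OF sH sL])
    show "tensor_assoc K (sym_bimodule ?O) (sym_bimodule ?O) (sym_bimodule ?L)
            (tensor_map K (ktensor K ?O ?O) (sym_bimodule ?L) (comul ?O) id (coact ?L l)) =
          tensor_map K (sym_bimodule ?O) (ktensor K ?O ?L) id (coact ?L) (coact ?L l)"
      if "l \<in> carrier ?L" for l
      using coact_coassoc that
      by (simp add: same_tensor_assoc[OF sH sH sL] same_tensor_map[OF sHH sL] same_tensor_map[OF sH sHL])
    \<comment> \<open>Two reversals cancel here: that of the coproduct legs by the inverse antipode
      and that of the product in \<open>L\<close>.\<close>
    show "act ?L h (l \<otimes>\<^bsub>?L\<^esub> m) = tensor_lift ?L (\<lambda>x y. act ?L x l \<otimes>\<^bsub>?L\<^esub> act ?L y m) (comul ?O h)"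
      if "h \<in> carrier ?O" "l \<in> carrier ?L" "m \<in> carrier ?L" for h l m
    proof -
      have [simp]: "h \<in> carrier H" "l \<in> carrier L" "m \<in> carrier L" using that by simp_all
      have "\<iota> h \<rhd> (m \<otimes>\<^bsub>L\<^esub> l) = \<Delta> L (\<iota> h) (\<lambda>x y. (x \<rhd> m) \<otimes>\<^bsub>L\<^esub> (y \<rhd> l))"
        by (simp add: comul_lift_act_mult)
      also have "\<dots> = \<Delta> L h (\<lambda>x y. (\<iota> y \<rhd> m) \<otimes>\<^bsub>L\<^esub> (\<iota> x \<rhd> l))"
        by (rule H.antipode_inv_comul[OF module_L]) (rule lin_intro | simp)+
      finally show ?thesis by (simp add: lift_op_base comul_lift_def)
    qed
    show "coact ?L (act ?L h l) = tensor_lift (ktensor K ?O ?L) (\<lambda>h1 w. tensor_lift (ktensor K ?O ?L) (\<lambda>h2 h3.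
       tensor_lift (ktensor K ?O ?L) (\<lambda>p m. kpure K ?O ?L (h1 \<otimes>\<^bsub>?O\<^esub> p \<otimes>\<^bsub>?O\<^esub> antipode ?O h3) (act ?L h2 m))
        (coact ?L l)) (comul ?O w)) (comul ?O h)"
      if "h \<in> carrier ?O" "l \<in> carrier ?L" for h l
    proof -
      have [simp]: "h \<in> carrier H" "l \<in> carrier L" using that by simp_all
      have "coact L (\<iota> h \<rhd> l) = \<delta> ?T (\<iota> h \<rhd> l) (kpure K H L)"
        using HL.P.lift_pure_id[OF coact_in, of "\<iota> h \<rhd> l"] by (simp add: coact_lift_def HL.lift_target)
      also have "\<dots> = \<Delta> ?T (\<iota> h) (\<lambda>h1 w. \<Delta> ?T w (\<lambda>h2 h3. \<delta> ?T l (\<lambda>p m.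
         kpure K H L (h1 \<otimes>\<^bsub>H\<^esub> p \<otimes>\<^bsub>H\<^esub> \<gamma> h3) (h2 \<rhd> m))))"
        by (rule coact_lift_act[OF module_HL]) (rule lin_intro | simp)+
      also have "\<dots> = \<Delta> ?T h (\<lambda>a b. \<Delta> ?T (\<iota> a) (\<lambda>h2 h3. \<delta> ?T l (\<lambda>p m.
         kpure K H L (\<iota> b \<otimes>\<^bsub>H\<^esub> p \<otimes>\<^bsub>H\<^esub> \<gamma> h3) (h2 \<rhd> m))))"
        by (rule H.antipode_inv_comul[OF module_HL]) (rule lin_intro | simp)+
      also have "\<dots> = \<Delta> ?T h (\<lambda>a b. \<Delta> ?T a (\<lambda>u v. \<delta> ?T l (\<lambda>p m.
         kpure K H L (\<iota> b \<otimes>\<^bsub>H\<^esub> p \<otimes>\<^bsub>H\<^esub> \<gamma> (\<iota> u)) (\<iota> v \<rhd> m))))"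
        by (intro H.comul_lift_cong H.antipode_inv_comul[OF module_HL]) (rule lin_intro | simp)+
      also have "\<dots> = \<Delta> ?T h (\<lambda>a b. \<Delta> ?T a (\<lambda>u v. \<delta> ?T l (\<lambda>p m.
         kpure K H L (\<iota> b \<otimes>\<^bsub>H\<^esub> (p \<otimes>\<^bsub>H\<^esub> u)) (\<iota> v \<rhd> m))))"
        \<comment> \<open>The three legs of \<open>\<iota>(h)\<close> come in reversed order and
          \<open>\<gamma>\<close> undoes \<open>\<iota>\<close> on one of them, leaving
          \<open>\<iota>(h3) p h1\<close>. In the opposite product this reads as \<open>h1\<close>,
          \<open>p\<close>, antipode of \<open>h3\<close>, which is the required form.\<close>
        by (intro H.comul_lift_cong coact_lift_cong) (simp add: H.m_assoc)
      also have "\<dots> = \<Delta> ?T h (\<lambda>u w. \<Delta> ?T w (\<lambda>v b. \<delta> ?T l (\<lambda>p m.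
         kpure K H L (\<iota> b \<otimes>\<^bsub>H\<^esub> (p \<otimes>\<^bsub>H\<^esub> u)) (\<iota> v \<rhd> m))))"
        by (rule H.comul_lift_coassoc[OF module_HL]) (rule lin_intro | simp)+
      also have "\<dots> = tensor_lift ?T (\<lambda>u w. tensor_lift ?T (\<lambda>v b. tensor_lift ?T (\<lambda>p m.
         kpure K H L (\<iota> b \<otimes>\<^bsub>H\<^esub> (p \<otimes>\<^bsub>H\<^esub> u)) (\<iota> v \<rhd> m)) (coact L l)) (comul H w)) (comul H h)"
        by (simp add: comul_lift_def coact_lift_def) (rule H.HH.P.lift_cong_strong[OF H.comul_in], simp_all)
      finally show ?thesis by (simp add: same_target[OF sHL] HL.lift_target same_pure[OF sH sL])
    qed
    show "l \<otimes>\<^bsub>?L\<^esub> m = tensor_lift ?L (\<lambda>p n. act ?L p m \<otimes>\<^bsub>?L\<^esub> n) (coact ?L l)"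
      if "l \<in> carrier ?L" "m \<in> carrier ?L" for l m
      using braided_op[of l m] that by (simp add: lift_op_base coact_lift_def)
  qed (simp_all add: linD[OF H.lin_antipode_inv1] act_add_left act_add_right act_smult_left act_smult_right
      H.antipode_inv_mult H.antipode_inv_one act_mult act_one act_on_one H.antipode_inv_counit
      lift_op_base coact_counit)
qed

lemma op_bij_base: "bij_base K (op_hopf H) (op_base H L)"
  by (intro bij_base.intro op_base_algebra H.op_bij_hopf)

end

section \<open>The isomorphism\<close>

lemma coact_lift_target:
  "\<lbrakk>carrier A = carrier B; add A = add B; ring.zero A = ring.zero B\<rbrakk> \<Longrightarrow> coact_lift L A = coact_lift L B"
  by (intro ext) (simp add: coact_lift_def tensor_lift_cong_target[of A B])

context bij_base
begin

abbreviation "H' \<equiv> op_hopf H"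
abbreviation "L' \<equiv> op_base H L"
abbreviation "S' \<equiv> smash_algebra K H' L'"
abbreviation "B' \<equiv> smash K H' L'"

lemma same_LH: "same_bimodule (ktensor K L' H') (ktensor K L H)"
  by (rule same_tensor[OF same_op_base same_op_hopf])

lemma kpure_op [simp]: "kpure K L' H' = kpure K L H"
  by (rule same_pure[OF same_op_base same_op_hopf])

lemma S'_sel [simp]: "carrier S' = carrier S" "add S' = add S" "ring.zero S' = ring.zero S" "smult S' = smult S"
  using same_bimoduleD[OF same_LH] by (simp_all add: smash_algebra_def Let_def)

lemma comul_lift_op [simp]: "comul_lift H' = comul_lift H"
  by (intro ext) (simp add: comul_lift_def)

lemma coact_lift_op [simp]: "coact_lift L' = coact_lift L"
  by (intro ext) (simp add: coact_lift_def)

lemma comul_lift_S' [simp]: "comul_lift H S' = comul_lift H S" and coact_lift_S' [simp]: "coact_lift L S' = coact_lift L S"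
  by (rule comul_lift_target coact_lift_target; simp)+

lemma lin_S' [simp]: "lin K Q S' t = lin K Q S t" "lin K S' Q t' = lin K S Q t'"
  by (simp_all add: lin_def additive_map_def)

text \<open>All results on smash products now hold for \<open>S'\<close> as well; the simplification
  rules above translate its carrier, sums and linearity back into those of \<open>S\<close>.\<close>

interpretation O: bij_base K H' L' by (rule op_bij_base)

text \<open>The simplifier keeps one congruence rule per constant, and the interpretation has just replaced
  the rules for \<open>H\<close> and \<open>L\<close> by those for their opposites.\<close>

declare H.comul_lift_cong_simp [cong] coact_lift_cong_simp [cong]

lemma S'_mult_pure:
  "\<lbrakk>l \<in> carrier L; f \<in> carrier H; m \<in> carrier L; g \<in> carrier H\<rbrakk> \<Longrightarrow>
    (l \<sharp> f) \<otimes>\<^bsub>S'\<^esub> (m \<sharp> g) = \<Delta> S f (\<lambda>f1 f2. ((\<iota> f1 \<rhd> m) \<otimes>\<^bsub>L\<^esub> l) \<sharp> (g \<otimes>\<^bsub>H\<^esub> f2))"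
  using O.S_mult_pure[of l f m g] by simp

lemma S'_lin: "w \<in> carrier S \<Longrightarrow> lin K S S (\<lambda>z. z \<otimes>\<^bsub>S'\<^esub> w)" "z \<in> carrier S \<Longrightarrow> lin K S S (\<lambda>w. z \<otimes>\<^bsub>S'\<^esub> w)"
  using bilinD(1,2)[OF O.S_mult_bilin] by simp_all

lemma S'_lin_comp [lin_intro]:
  "lin K Q S t \<Longrightarrow> w \<in> carrier S \<Longrightarrow> lin K Q S (\<lambda>x. t x \<otimes>\<^bsub>S'\<^esub> w)"
  "lin K Q S t \<Longrightarrow> z \<in> carrier S \<Longrightarrow> lin K Q S (\<lambda>x. z \<otimes>\<^bsub>S'\<^esub> t x)"
  by (rule lin_comp[OF S'_lin(1)] lin_comp[OF S'_lin(2)]; assumption)+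

lemma S'_closed [simp]: "z \<in> carrier S \<Longrightarrow> w \<in> carrier S \<Longrightarrow> z \<otimes>\<^bsub>S'\<^esub> w \<in> carrier S"
  using O.S_mult_closed by simp

lemma S'_one: "\<one>\<^bsub>S'\<^esub> = \<one>\<^bsub>S\<^esub>"
  by (simp add: S_sel(5) O.S_sel(5))

lemma S'_src: "src S' l = src S l"
  by (simp add: S_sel(6) O.S_sel(6))

lemma S'_tgt: "l \<in> carrier L \<Longrightarrow> tgt S' l = \<delta> S l (\<lambda>p m. m \<sharp> \<gamma> p)"
  using O.S_tgt[of l] by (simp add: H.antipode_inv_op_hopf[simplified])

text \<open>The product in \<open>H\<close> appears with its factors reversed, as the formula for
  the map multiplies in the opposite algebra.\<close>

definition zeta_bilinear where "zeta_bilinear l h = \<delta> S l (\<lambda>p m. m \<sharp> (\<gamma> h \<otimes>\<^bsub>H\<^esub> \<gamma> p))"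

lemma zeta_bilinear_bilin: "bilin K L H S zeta_bilinear"
  unfolding zeta_bilinear_def by (rule lin_intro | simp)+

lemma zeta_target: "tensor_lift (ktensor K L' H') = tensor_lift S"
  by (rule tensor_lift_cong_target) (simp_all add: same_bimoduleD[OF same_LH] S_sel)

lemma zeta_lift: "z \<in> carrier S \<Longrightarrow> zeta K H L z = tensor_lift S zeta_bilinear z"
  unfolding zeta_def Let_def zeta_target
  by (rule LH.P.lift_cong_strong) (simp_all add: S_sel zeta_bilinear_def coact_lift_def zeta_target)

lemma zeta_lin: "lin K S S (zeta K H L)"
  by (rule lin_cong[OF module_S zeta_lift LH.lift_lin[OF module_S zeta_bilinear_bilin]])

lemma zeta_pure_lift: "\<lbrakk>l \<in> carrier L; h \<in> carrier H\<rbrakk> \<Longrightarrow> zeta K H L (l \<sharp> h) = zeta_bilinear l h"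
  by (simp add: zeta_lift LH.pure_in LH.lift_pure[OF module_S zeta_bilinear_bilin])

text \<open>On simple tensors the choice of a representative in \<open>zeta\<close> disappears,
  because \<open>zeta_bilinear\<close> is bilinear.\<close>

lemma zeta_formula:
  assumes "l \<in> carrier L" "h \<in> carrier H"
  shows "zeta K H L (l \<sharp> h) = tensor_lift (ktensor K L' H')
    (\<lambda>p m. kpure K L' H' m (\<gamma> p \<otimes>\<^bsub>H'\<^esub> \<gamma> h)) (coact L l)"
  using assms by (simp add: zeta_pure_lift zeta_bilinear_def coact_lift_def zeta_target)

abbreviation "\<zeta> \<equiv> zeta K H L"

lemma zeta_pure: "\<lbrakk>l \<in> carrier L; h \<in> carrier H\<rbrakk> \<Longrightarrow> \<zeta> (l \<sharp> h) = \<delta> S l (\<lambda>p m. m \<sharp> \<gamma> (p \<otimes>\<^bsub>H\<^esub> h))"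
  by (simp add: zeta_pure_lift zeta_bilinear_def H.antipode_mult)

lemma zeta_closed [simp]: "z \<in> carrier S \<Longrightarrow> \<zeta> z \<in> carrier S"
  by (rule linD(1)[OF zeta_lin])

lemma lin_zeta [lin_intro]: "lin K Q S t \<Longrightarrow> lin K Q S (\<lambda>x. \<zeta> (t x))"
  by (rule lin_comp[OF zeta_lin])

lemma coact_lift_braided_sharp:
  assumes "l \<in> carrier L" "m \<in> carrier L" "h \<in> carrier H"
  shows "\<delta> S l (\<lambda>p n. ((p \<rhd> m) \<otimes>\<^bsub>L\<^esub> n) \<sharp> h) = (l \<otimes>\<^bsub>L\<^esub> m) \<sharp> h"
  unfolding coact_lift_braided[OF assms(1,2)] using assms by (simp add: L_pulls)

text \<open>Both sides are brought to \<open>?E\<close>, whose summand is the \<open>L\<close>-part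
  \<open>n (b \<rhd> k)\<close> with the \<open>H\<close>-part \<open>\<gamma>(p a q g)\<close>,
  where \<open>a\<close>, \<open>b\<close> are the legs of \<open>h\<close>. The left side gets
  there by compatibility of coaction and action, the right side by braided commutativity.\<close>

lemma zeta_mult_pure:
  assumes [simp]: "l \<in> carrier L" "h \<in> carrier H" "m \<in> carrier L" "g \<in> carrier H"
  shows "\<zeta> ((l \<sharp> h) \<otimes>\<^bsub>S\<^esub> (m \<sharp> g)) = \<zeta> (l \<sharp> h) \<otimes>\<^bsub>S'\<^esub> \<zeta> (m \<sharp> g)"
proof -
  let ?F = "\<lambda>p n a b q k. (n \<otimes>\<^bsub>L\<^esub> (b \<rhd> k)) \<sharp> \<gamma> (p \<otimes>\<^bsub>H\<^esub> (a \<otimes>\<^bsub>H\<^esub> (q \<otimes>\<^bsub>H\<^esub> g)))"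
  \<comment> \<open>The argument \<open>x\<close> marks the place of \<open>\<gamma>(c) r\<close>,
    the pair of neighbouring legs of \<open>h\<close> that will cancel.\<close>
  let ?Q = "\<lambda>p n a b x. \<delta> S m (\<lambda>q k. (n \<otimes>\<^bsub>L\<^esub> (b \<rhd> k)) \<sharp> \<gamma> (p \<otimes>\<^bsub>H\<^esub> (a \<otimes>\<^bsub>H\<^esub> (q \<otimes>\<^bsub>H\<^esub> (x \<otimes>\<^bsub>H\<^esub> g)))))"
  let ?E = "\<delta> S l (\<lambda>p n. \<Delta> S h (\<lambda>a b. \<delta> S m (\<lambda>q k. ?F p n a b q k)))"
  have "\<zeta> ((l \<sharp> h) \<otimes>\<^bsub>S\<^esub> (m \<sharp> g)) = \<Delta> S h (\<lambda>h1 r. \<delta> S (l \<otimes>\<^bsub>L\<^esub> (h1 \<rhd> m)) (\<lambda>p n. n \<sharp> \<gamma> (p \<otimes>\<^bsub>H\<^esub> (r \<otimes>\<^bsub>H\<^esub> g))))"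
    by (simp add: S_mult_pure H.comul_lift_hom[OF module_S zeta_lin module_S] zeta_pure)
  also have "\<dots> = \<Delta> S h (\<lambda>h1 r. \<delta> S l (\<lambda>p n. \<delta> S (h1 \<rhd> m) (\<lambda>q k. (n \<otimes>\<^bsub>L\<^esub> k) \<sharp> \<gamma> ((p \<otimes>\<^bsub>H\<^esub> q) \<otimes>\<^bsub>H\<^esub> (r \<otimes>\<^bsub>H\<^esub> g)))))"
    by (intro H.comul_lift_cong coact_lift_mult[OF module_S]) (rule lin_intro | simp)+
  also have "\<dots> = \<Delta> S h (\<lambda>h1 r. \<delta> S l (\<lambda>p n. \<Delta> S h1 (\<lambda>a w. \<Delta> S w (\<lambda>b c. \<delta> S m (\<lambda>q k.
      (n \<otimes>\<^bsub>L\<^esub> (b \<rhd> k)) \<sharp> \<gamma> ((p \<otimes>\<^bsub>H\<^esub> (a \<otimes>\<^bsub>H\<^esub> q \<otimes>\<^bsub>H\<^esub> \<gamma> c)) \<otimes>\<^bsub>H\<^esub> (r \<otimes>\<^bsub>H\<^esub> g)))))))"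
    by (intro H.comul_lift_cong coact_lift_cong coact_lift_act[OF module_S]) (rule lin_intro | simp)+
  also have "\<dots> = \<Delta> S h (\<lambda>h1 r. \<delta> S l (\<lambda>p n. \<Delta> S h1 (\<lambda>a w. \<Delta> S w (\<lambda>b c. ?Q p n a b (\<gamma> c \<otimes>\<^bsub>H\<^esub> r)))))"
    by (intro H.comul_lift_cong coact_lift_cong) (simp add: H.m_assoc)
  also have "\<dots> = \<delta> S l (\<lambda>p n. \<Delta> S h (\<lambda>h1 r. \<Delta> S h1 (\<lambda>a w. \<Delta> S w (\<lambda>b c. ?Q p n a b (\<gamma> c \<otimes>\<^bsub>H\<^esub> r)))))"
    by (rule coact_lift_comul_lift_fubini[OF module_S, symmetric]) (simp add: H.comul_lift_closed[OF module_S])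
  \<comment> \<open>Two regroupings of the four legs of \<open>h\<close> put \<open>c\<close> and
    \<open>r\<close> under one coproduct, so that the left antipode axiom applies.\<close>
  also have "\<dots> = \<delta> S l (\<lambda>p n. \<Delta> S h (\<lambda>a s. \<Delta> S s (\<lambda>w r. \<Delta> S w (\<lambda>b c. ?Q p n a b (\<gamma> c \<otimes>\<^bsub>H\<^esub> r)))))"
    by (intro coact_lift_cong H.comul_lift_coassoc[OF module_S]) (rule lin_intro | simp)+
  also have "\<dots> = \<delta> S l (\<lambda>p n. \<Delta> S h (\<lambda>a s. \<Delta> S s (\<lambda>b t. \<Delta> S t (\<lambda>c r. ?Q p n a b (\<gamma> c \<otimes>\<^bsub>H\<^esub> r)))))"
    by (intro coact_lift_cong H.comul_lift_cong H.comul_lift_coassoc[OF module_S]) (rule lin_intro | simp)+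
  also have "\<dots> = \<delta> S l (\<lambda>p n. \<Delta> S h (\<lambda>a s. \<Delta> S s (\<lambda>b t. \<epsilon> t \<odot>\<^bsub>S\<^esub> ?Q p n a b \<one>\<^bsub>H\<^esub>)))"
    by (intro coact_lift_cong H.comul_lift_cong H.comul_lift_antipode_left[OF module_S, where f="?Q _ _ _ _"]) (rule lin_intro | simp)+
  also have "\<dots> = \<delta> S l (\<lambda>p n. \<Delta> S h (\<lambda>a s. ?Q p n a s \<one>\<^bsub>H\<^esub>))"
    by (intro coact_lift_cong H.comul_lift_cong H.comul_lift_counit_right[OF module_S]) (rule lin_intro | simp)+
  also have "\<dots> = ?E"
    by simp
  finally have 1: "\<zeta> ((l \<sharp> h) \<otimes>\<^bsub>S\<^esub> (m \<sharp> g)) = ?E" .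
  have pull: "\<delta> S l' f \<otimes>\<^bsub>S'\<^esub> w = \<delta> S l' (\<lambda>p n. f p n \<otimes>\<^bsub>S'\<^esub> w)" "w \<otimes>\<^bsub>S'\<^esub> \<delta> S l' f = \<delta> S l' (\<lambda>p n. w \<otimes>\<^bsub>S'\<^esub> f p n)"
    if "w \<in> carrier S" "\<And>p n. p \<in> carrier H \<Longrightarrow> n \<in> carrier L \<Longrightarrow> f p n \<in> carrier S" for l' f w
    by (rule coact_lift_hom[OF module_S S'_lin(1)[OF that(1)] module_S that(2)], assumption+)
      (rule coact_lift_hom[OF module_S S'_lin(2)[OF that(1)] module_S that(2)], assumption+)
  have "\<zeta> (l \<sharp> h) \<otimes>\<^bsub>S'\<^esub> \<zeta> (m \<sharp> g) = \<delta> S l (\<lambda>p n. \<delta> S m (\<lambda>q k. \<Delta> S (\<gamma> (p \<otimes>\<^bsub>H\<^esub> h)) (\<lambda>a b.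
      ((\<iota> a \<rhd> k) \<otimes>\<^bsub>L\<^esub> n) \<sharp> (\<gamma> (q \<otimes>\<^bsub>H\<^esub> g) \<otimes>\<^bsub>H\<^esub> b))))"
    by (simp add: zeta_pure pull S'_mult_pure) (rule coact_lift_fubini[OF module_S], simp add: H.comul_lift_closed[OF module_S])
  \<comment> \<open>The action in the opposite base algebra goes through \<open>\<iota>\<close>,
    which undoes the antipode coming from the first factor; what acts on \<open>k\<close> is the
    second leg of \<open>p h\<close> itself.\<close>
  also have "\<dots> = \<delta> S l (\<lambda>p n. \<delta> S m (\<lambda>q k. \<Delta> S (p \<otimes>\<^bsub>H\<^esub> h) (\<lambda>x y.
      ((\<iota> (\<gamma> y) \<rhd> k) \<otimes>\<^bsub>L\<^esub> n) \<sharp> (\<gamma> (q \<otimes>\<^bsub>H\<^esub> g) \<otimes>\<^bsub>H\<^esub> \<gamma> x))))"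
    by (intro coact_lift_cong H.antipode_comul[OF module_S]) (rule lin_intro | simp)+
  also have "\<dots> = \<delta> S l (\<lambda>p n. \<delta> S m (\<lambda>q k. \<Delta> S p (\<lambda>p1 p2. \<Delta> S h (\<lambda>h1 h2.
      ((\<iota> (\<gamma> (p2 \<otimes>\<^bsub>H\<^esub> h2)) \<rhd> k) \<otimes>\<^bsub>L\<^esub> n) \<sharp> (\<gamma> (q \<otimes>\<^bsub>H\<^esub> g) \<otimes>\<^bsub>H\<^esub> \<gamma> (p1 \<otimes>\<^bsub>H\<^esub> h1))))))"
    by (intro coact_lift_cong H.comul_lift_mult[OF module_S]) (rule lin_intro | simp)+
  also have "\<dots> = \<delta> S l (\<lambda>p n. \<delta> S m (\<lambda>q k. \<Delta> S p (\<lambda>p1 p2. \<Delta> S h (\<lambda>h1 h2.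
      ((p2 \<rhd> (h2 \<rhd> k)) \<otimes>\<^bsub>L\<^esub> n) \<sharp> \<gamma> (p1 \<otimes>\<^bsub>H\<^esub> (h1 \<otimes>\<^bsub>H\<^esub> (q \<otimes>\<^bsub>H\<^esub> g)))))))"
    by (intro coact_lift_cong H.comul_lift_cong) (simp add: act_mult H.antipode_mult[symmetric] H.m_assoc)
  also have "\<dots> = \<delta> S l (\<lambda>p n. \<Delta> S p (\<lambda>p1 p2. \<delta> S m (\<lambda>q k. \<Delta> S h (\<lambda>h1 h2.
      ((p2 \<rhd> (h2 \<rhd> k)) \<otimes>\<^bsub>L\<^esub> n) \<sharp> \<gamma> (p1 \<otimes>\<^bsub>H\<^esub> (h1 \<otimes>\<^bsub>H\<^esub> (q \<otimes>\<^bsub>H\<^esub> g)))))))"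
    by (intro coact_lift_cong coact_lift_comul_lift_fubini[OF module_S]) (simp add: H.comul_lift_closed[OF module_S])
  \<comment> \<open>Coassociativity makes \<open>p2\<close> the coaction leg of \<open>n\<close>.
    Braided commutativity for \<open>n\<close> and \<open>h2 \<rhd> k\<close> then absorbs
    it.\<close>
  also have "\<dots> = \<delta> S l (\<lambda>p n. \<delta> S n (\<lambda>p2 n'. \<delta> S m (\<lambda>q k. \<Delta> S h (\<lambda>h1 h2.
      ((p2 \<rhd> (h2 \<rhd> k)) \<otimes>\<^bsub>L\<^esub> n') \<sharp> \<gamma> (p \<otimes>\<^bsub>H\<^esub> (h1 \<otimes>\<^bsub>H\<^esub> (q \<otimes>\<^bsub>H\<^esub> g)))))))"
    by (rule coact_lift_coassoc[OF module_S]) (rule lin_intro | simp)+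
  also have "\<dots> = \<delta> S l (\<lambda>p n. \<delta> S m (\<lambda>q k. \<delta> S n (\<lambda>p2 n'. \<Delta> S h (\<lambda>h1 h2.
      ((p2 \<rhd> (h2 \<rhd> k)) \<otimes>\<^bsub>L\<^esub> n') \<sharp> \<gamma> (p \<otimes>\<^bsub>H\<^esub> (h1 \<otimes>\<^bsub>H\<^esub> (q \<otimes>\<^bsub>H\<^esub> g)))))))"
    by (intro coact_lift_cong coact_lift_fubini[OF module_S]) (simp add: H.comul_lift_closed[OF module_S])
  also have "\<dots> = \<delta> S l (\<lambda>p n. \<delta> S m (\<lambda>q k. \<Delta> S h (\<lambda>h1 h2. \<delta> S n (\<lambda>p2 n'.
      ((p2 \<rhd> (h2 \<rhd> k)) \<otimes>\<^bsub>L\<^esub> n') \<sharp> \<gamma> (p \<otimes>\<^bsub>H\<^esub> (h1 \<otimes>\<^bsub>H\<^esub> (q \<otimes>\<^bsub>H\<^esub> g)))))))"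
    by (intro coact_lift_cong coact_lift_comul_lift_fubini[OF module_S]) simp
  also have "\<dots> = \<delta> S l (\<lambda>p n. \<delta> S m (\<lambda>q k. \<Delta> S h (\<lambda>h1 h2. ?F p n h1 h2 q k)))"
    by (intro coact_lift_cong H.comul_lift_cong) (simp add: coact_lift_braided_sharp)
  also have "\<dots> = ?E"
    by (intro coact_lift_cong coact_lift_comul_lift_fubini[OF module_S]) simp
  finally show ?thesis using 1 by simp
qed

lemma zeta_mult:
  assumes x: "x \<in> carrier S" and y: "y \<in> carrier S"
  shows "\<zeta> (x \<otimes>\<^bsub>S\<^esub> y) = \<zeta> x \<otimes>\<^bsub>S'\<^esub> \<zeta> y"
proof -
  have 1: "\<zeta> ((l \<sharp> f) \<otimes>\<^bsub>S\<^esub> y) = \<zeta> (l \<sharp> f) \<otimes>\<^bsub>S'\<^esub> \<zeta> y"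
    if "l \<in> carrier L" "f \<in> carrier H" for l f
    by (rule LH.lin_eqI[OF _ _ _ y]) (rule lin_intro zeta_mult_pure | simp add: that)+
  show ?thesis
    by (rule LH.lin_eqI[OF _ _ _ x]) (rule lin_intro 1 | simp add: y)+
qed

lemma zeta_one_sharp: "h \<in> carrier H \<Longrightarrow> \<zeta> (\<one>\<^bsub>L\<^esub> \<sharp> h) = \<one>\<^bsub>L\<^esub> \<sharp> \<gamma> h"
  by (simp add: zeta_pure, subst coact_lift_one[OF module_S]) (rule lin_intro | simp)+

lemma zeta_one: "\<zeta> \<one>\<^bsub>S\<^esub> = \<one>\<^bsub>S'\<^esub>"
  by (simp add: S'_one S_sel(5) zeta_one_sharp H.antipode_one)

lemma zeta_src: "l \<in> carrier L \<Longrightarrow> \<zeta> (src S l) = tgt S' l"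
  by (simp add: S_sel(6) zeta_pure S'_tgt)

text \<open>The two coaction legs meet as \<open>v \<iota>(u)\<close>, with \<open>u\<close>,
  \<open>v\<close> the legs of one element, and cancel; only \<open>l\<close> remains.\<close>

lemma zeta_tgt:
  assumes [simp]: "l \<in> carrier L"
  shows "\<zeta> (tgt S l) = src S' l"
proof -
  have "\<zeta> (tgt S l) = \<delta> S l (\<lambda>p n. \<delta> S n (\<lambda>q k. k \<sharp> \<gamma> (q \<otimes>\<^bsub>H\<^esub> \<iota> p)))"
    by (simp add: S_tgt coact_lift_hom[OF module_S zeta_lin module_S] zeta_pure)
  also have "\<dots> = \<delta> S l (\<lambda>p n. \<Delta> S p (\<lambda>u v. n \<sharp> \<gamma> (v \<otimes>\<^bsub>H\<^esub> \<iota> u)))"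
    by (rule coact_lift_coassoc[OF module_S, symmetric]) (rule lin_intro | simp)+
  also have "\<dots> = \<delta> S l (\<lambda>p n. \<epsilon> p \<odot>\<^bsub>S\<^esub> (n \<sharp> \<gamma> \<one>\<^bsub>H\<^esub>))"
    by (intro coact_lift_cong H.comul_lift_antipode_inv_left[OF module_S]) (rule lin_intro | simp)+
  also have "\<dots> = l \<sharp> \<gamma> \<one>\<^bsub>H\<^esub>"
    by (rule coact_lift_counit[OF module_S]) (rule lin_intro | simp)+
  finally show ?thesis by (simp add: S'_src S_sel(6) H.antipode_one)
qed

lemma zeta_cou:
  assumes z: "z \<in> carrier S"
  shows "cou B' (\<zeta> z) = cou B z"
proof -
  have lin': "lin K S L (cou B')"
    using O.cou_lin by (simp add: lin_def additive_map_def)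
  have pure': "cou B' (l \<sharp> h) = \<epsilon> h \<odot>\<^bsub>L\<^esub> l" if "l \<in> carrier L" "h \<in> carrier H" for l h
    using O.cou_pure[of l h] that by simp
  show ?thesis
  proof (rule LH.lin_eqI[OF lin_comp[OF lin' zeta_lin] cou_lin _ z])
    fix l h assume [simp]: "l \<in> carrier L" "h \<in> carrier H"
    have "cou B' (\<zeta> (l \<sharp> h)) = \<delta> L l (\<lambda>p m. \<epsilon> p \<odot>\<^bsub>L\<^esub> (\<epsilon> h \<odot>\<^bsub>L\<^esub> m))"
      by (simp add: zeta_pure coact_lift_hom[OF module_S lin' module_L] pure' H.antipode_counit H.counit_mult L.smult_assoc1)
    also have "\<dots> = cou B (l \<sharp> h)"
      by (subst coact_lift_counit[OF module_L]) (rule lin_intro L.lin_smult | simp add: cou_pure)+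
    finally show "cou B' (\<zeta> (l \<sharp> h)) = cou B (l \<sharp> h)" .
  qed
qed

text \<open>This is the formula for the map itself with \<open>H\<close> and \<open>L\<close>
  replaced by their opposites: the antipode becomes \<open>\<iota>\<close>, and the twice opposite
  product is the original one.\<close>

definition zeta_inv_bilinear where "zeta_inv_bilinear l h = \<delta> S l (\<lambda>p m. m \<sharp> (\<iota> p \<otimes>\<^bsub>H\<^esub> \<iota> h))"

lemma zeta_inv_bilinear_bilin: "bilin K L H S zeta_inv_bilinear"
  unfolding zeta_inv_bilinear_def by (rule lin_intro | simp)+

lemma zeta_bij: "bij_betw \<zeta> (carrier S) (carrier S)"
proof -
  let ?\<eta> = "tensor_lift S zeta_inv_bilinear"
  have lin: "lin K S S ?\<eta>" by (rule LH.lift_lin[OF module_S zeta_inv_bilinear_bilin])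
  have pure: "?\<eta> (l \<sharp> h) = \<delta> S l (\<lambda>p m. m \<sharp> (\<iota> p \<otimes>\<^bsub>H\<^esub> \<iota> h))" if "l \<in> carrier L" "h \<in> carrier H" for l h
    using that by (simp add: LH.lift_pure[OF module_S zeta_inv_bilinear_bilin] zeta_inv_bilinear_def)
  have 1: "?\<eta> (\<zeta> z) = z" if z: "z \<in> carrier S" for z
  proof (rule LH.lin_eqI[OF lin_comp[OF lin zeta_lin] lin_id _ z])
    fix l h assume [simp]: "l \<in> carrier L" "h \<in> carrier H"
    \<comment> \<open>The inverse antipode removes \<open>\<gamma>\<close> from the
      \<open>H\<close>-slot; a second coaction leg \<open>q\<close> is left in front as
      \<open>\<iota>(q)\<close>, and coassociativity lets it cancel against
      \<open>p\<close>.\<close>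
    have "?\<eta> (\<zeta> (l \<sharp> h)) = \<delta> S l (\<lambda>p m. \<delta> S m (\<lambda>q n. n \<sharp> ((\<iota> q \<otimes>\<^bsub>H\<^esub> p) \<otimes>\<^bsub>H\<^esub> h)))"
      by (simp add: zeta_pure coact_lift_hom[OF module_S lin module_S] pure H.m_assoc)
    also have "\<dots> = \<delta> S l (\<lambda>p m. \<Delta> S p (\<lambda>u v. m \<sharp> ((\<iota> v \<otimes>\<^bsub>H\<^esub> u) \<otimes>\<^bsub>H\<^esub> h)))"
      by (rule coact_lift_coassoc[OF module_S, symmetric]) (rule lin_intro | simp)+
    also have "\<dots> = \<delta> S l (\<lambda>p m. \<epsilon> p \<odot>\<^bsub>S\<^esub> (m \<sharp> (\<one>\<^bsub>H\<^esub> \<otimes>\<^bsub>H\<^esub> h)))"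
      by (intro coact_lift_cong H.comul_lift_antipode_inv_right[OF module_S]) (rule lin_intro | simp)+
    also have "\<dots> = l \<sharp> (\<one>\<^bsub>H\<^esub> \<otimes>\<^bsub>H\<^esub> h)"
      by (rule coact_lift_counit[OF module_S]) (rule lin_intro | simp)+
    finally show "?\<eta> (\<zeta> (l \<sharp> h)) = l \<sharp> h" by simp
  qed
  have 2: "\<zeta> (?\<eta> z) = z" if z: "z \<in> carrier S" for z
  proof (rule LH.lin_eqI[OF lin_comp[OF zeta_lin lin] lin_id _ z])
    fix l h assume [simp]: "l \<in> carrier L" "h \<in> carrier H"
    have "\<zeta> (?\<eta> (l \<sharp> h)) = \<delta> S l (\<lambda>p m. \<delta> S m (\<lambda>q n. n \<sharp> \<gamma> ((q \<otimes>\<^bsub>H\<^esub> \<iota> p) \<otimes>\<^bsub>H\<^esub> \<iota> h)))"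
      by (simp add: zeta_pure coact_lift_hom[OF module_S zeta_lin module_S] pure H.m_assoc)
    also have "\<dots> = \<delta> S l (\<lambda>p m. \<Delta> S p (\<lambda>u v. m \<sharp> \<gamma> ((v \<otimes>\<^bsub>H\<^esub> \<iota> u) \<otimes>\<^bsub>H\<^esub> \<iota> h)))"
      by (rule coact_lift_coassoc[OF module_S, symmetric]) (rule lin_intro | simp)+
    also have "\<dots> = \<delta> S l (\<lambda>p m. \<epsilon> p \<odot>\<^bsub>S\<^esub> (m \<sharp> \<gamma> (\<one>\<^bsub>H\<^esub> \<otimes>\<^bsub>H\<^esub> \<iota> h)))"
      by (intro coact_lift_cong H.comul_lift_antipode_inv_left[OF module_S]) (rule lin_intro | simp)+
    also have "\<dots> = l \<sharp> \<gamma> (\<one>\<^bsub>H\<^esub> \<otimes>\<^bsub>H\<^esub> \<iota> h)"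
      by (rule coact_lift_counit[OF module_S]) (rule lin_intro | simp)+
    finally show "\<zeta> (?\<eta> (l \<sharp> h)) = l \<sharp> h" by simp
  qed
  show ?thesis
    by (rule bij_betw_byWitness[of _ ?\<eta>]) (use 1 2 linD(1)[OF lin] in auto)
qed

section \<open>Compatibility with the coproducts\<close>

abbreviation "A \<equiv> coop L B"

lemma coop_bialg: "bialgebroid K L' A"
  by (rule bialgebroid.coop_bialgebroid[OF smash_bialgebroid]) (simp_all add: op_base_assoc_algebra)

lemma zeta_cop:
  assumes z: "z \<in> carrier S"
  shows "cop B' (\<zeta> z) = tensor_map L' (st_bimodule B') (st_bimodule B') \<zeta> \<zeta> (cop A z)"
proof -
  let ?F = "flip (st_bimodule S)" and ?N = "st_bimodule S'"
  let ?\<sigma> = "St.T2.P.swap"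
  interpret A: bialgebroid K L' A by (rule coop_bialg)
  interpret A: st_alg K L' A
    by unfold_locales (rule A.src_hom A.tgt_antihom A.src_tgt_commute; assumption?)+
  have op_ring: "tensor (op_alg L) = tensor L'" "pure (op_alg L) = pure L'"
    "tensor L = tensor L'" "pure L = pure L'"
    by (rule tensor_ring_cong; simp)+
  have M: "st_bimodule A = ?F"
    by (simp add: st_bimodule_coop)
  have cop: "cop A z = ?\<sigma> (cop B z)" for z
    by (simp add: coop_def st_bimodule_swap op_ring St.T2.P.swap_def)
  \<comment> \<open>Exchange of source and target by the map is precisely its linearity from the
    flipped bimodule of \<open>S\<close> to that of \<open>S'\<close>; it makes the tensor square of
    the map well defined over the base.\<close>
  have lin: "right_lin L' ?F ?N \<zeta>" "left_lin L' ?F ?N \<zeta>"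
    using linD(4)[OF zeta_lin]
    by (auto simp: right_lin_def left_lin_def additive_map_def zeta_mult zeta_src zeta_tgt)
  note m = A.T2.P.tensor_pair_axioms[unfolded M] O.St.T2.P.tensor_pair_axioms lin
  let ?G = "\<lambda>w. tensor_map L' ?N ?N \<zeta> \<zeta> (?\<sigma> w)"
  have G: "additive_map (st_tensor L S) (st_tensor L' S') ?G"
    using tensor_map_additive_map[OF m] St.T2.P.swap_additive_map by (auto simp: additive_map_def Pi_iff op_ring)
  have G_st: "?G (st_pure L S x y) = st_pure L' S' (\<zeta> y) (\<zeta> x)" if "x \<in> carrier S" "y \<in> carrier S" for x y
    using that tensor_map_pure[OF m] St.T2.P.swap_pure[of x y] by (simp add: op_ring)
  have module_ST': "module K O.ST" by (rule O.module_ST)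
  have lin_st': "lin K Q S t \<Longrightarrow> y \<in> carrier S \<Longrightarrow> lin K Q O.ST (\<lambda>x. st_pure L' S' (t x) y)"
    "lin K Q S t \<Longrightarrow> y \<in> carrier S \<Longrightarrow> lin K Q O.ST (\<lambda>x. st_pure L' S' y (t x))" for Q t y
    using O.lin_st_left[of Q t y] O.lin_st_right[of Q t y] by simp_all
  have st_in' [simp]: "x \<in> carrier S \<Longrightarrow> y \<in> carrier S \<Longrightarrow> st_pure L' S' x y \<in> carrier (st_tensor L' S')" for x y
    using O.St.st_in[of x y] by simp
  have cop_lin': "lin K S O.ST (cop B')"
    using O.cop_lin by simp
  have cop_pure': "cop B' (l \<sharp> h) = \<Delta> O.ST h (\<lambda>h1 h2. st_pure L' S' (l \<sharp> h1) (\<one>\<^bsub>L\<^esub> \<sharp> h2))"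
    if "l \<in> carrier L" "h \<in> carrier H" for l h
    using O.cop_pure[of l h] that by simp
  have "cop B' (\<zeta> z) = ?G (cop B z)"
    using z
  proof (induction rule: LH.Z_induct)
    case (pure l h)
    note [simp] = pure
    have "cop B' (\<zeta> (l \<sharp> h)) = \<delta> O.ST l (\<lambda>p m. \<Delta> O.ST (\<gamma> (p \<otimes>\<^bsub>H\<^esub> h)) (\<lambda>a b. st_pure L' S' (m \<sharp> a) (\<one>\<^bsub>L\<^esub> \<sharp> b)))"
      by (simp add: zeta_pure coact_lift_hom[OF module_S cop_lin' module_ST'] cop_pure')
    also have "\<dots> = \<delta> O.ST l (\<lambda>p m. \<Delta> O.ST (p \<otimes>\<^bsub>H\<^esub> h) (\<lambda>x y. st_pure L' S' (m \<sharp> \<gamma> y) (\<one>\<^bsub>L\<^esub> \<sharp> \<gamma> x)))"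
      by (intro coact_lift_cong H.antipode_comul[OF module_ST']) (rule lin_intro lin_st' | simp)+
    also have "\<dots> = \<delta> O.ST l (\<lambda>p m. \<Delta> O.ST p (\<lambda>p1 p2. \<Delta> O.ST h (\<lambda>h1 h2.
        st_pure L' S' (m \<sharp> \<gamma> (p2 \<otimes>\<^bsub>H\<^esub> h2)) (\<one>\<^bsub>L\<^esub> \<sharp> \<gamma> (p1 \<otimes>\<^bsub>H\<^esub> h1)))))"
      by (intro coact_lift_cong H.comul_lift_mult[OF module_ST']) (rule lin_intro lin_st' | simp)+
    \<comment> \<open>The second leg of \<open>p\<close> becomes the coaction leg of
      \<open>m\<close>, so the first tensor factor takes the shape of the map applied to
      \<open>m \<sharp> h2\<close>.\<close>
    also have "\<dots> = \<delta> O.ST l (\<lambda>p m. \<delta> O.ST m (\<lambda>q n. \<Delta> O.ST h (\<lambda>h1 h2.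
        st_pure L' S' (n \<sharp> \<gamma> (q \<otimes>\<^bsub>H\<^esub> h2)) (\<one>\<^bsub>L\<^esub> \<sharp> \<gamma> (p \<otimes>\<^bsub>H\<^esub> h1)))))"
      by (rule coact_lift_coassoc[OF module_ST']) (rule lin_intro lin_st' module_ST' | simp)+
    also have "\<dots> = \<delta> O.ST l (\<lambda>p m. \<Delta> O.ST h (\<lambda>h1 h2. \<delta> O.ST m (\<lambda>q n.
        st_pure L' S' (n \<sharp> \<gamma> (q \<otimes>\<^bsub>H\<^esub> h2)) (\<one>\<^bsub>L\<^esub> \<sharp> \<gamma> (p \<otimes>\<^bsub>H\<^esub> h1)))))"
      by (intro coact_lift_cong coact_lift_comul_lift_fubini[OF module_ST']) simp
    also have "\<dots> = \<delta> O.ST l (\<lambda>p m. \<Delta> O.ST h (\<lambda>h1 h2.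
        st_pure L' S' (\<zeta> (m \<sharp> h2)) (\<one>\<^bsub>L\<^esub> \<sharp> \<gamma> (p \<otimes>\<^bsub>H\<^esub> h1))))"
      by (intro coact_lift_cong H.comul_lift_cong, simp add: zeta_pure, rule coact_lift_hom[OF module_S _ module_ST', symmetric])
        (rule lin_intro lin_st' | simp)+
    also have "\<dots> = \<delta> O.ST l (\<lambda>p m. \<Delta> O.ST h (\<lambda>h1 h2.
        st_pure L' S' (\<one>\<^bsub>L\<^esub> \<sharp> \<gamma> h2) (m \<sharp> \<gamma> (p \<otimes>\<^bsub>H\<^esub> h1))))"
    proof (intro coact_lift_cong H.comul_lift_cong)
      fix p m h1 h2 assume [simp]: "p \<in> carrier H" "m \<in> carrier L" "h1 \<in> carrier H" "h2 \<in> carrier H"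
      have "\<zeta> (m \<sharp> h2) = \<zeta> (src S m \<otimes>\<^bsub>S\<^esub> (\<one>\<^bsub>L\<^esub> \<sharp> h2))"
        by (simp add: src_mult)
      also have "\<dots> = tgt S' m \<otimes>\<^bsub>S'\<^esub> (\<one>\<^bsub>L\<^esub> \<sharp> \<gamma> h2)"
        by (simp add: zeta_mult zeta_src zeta_one_sharp)
      finally have "st_pure L' S' (\<zeta> (m \<sharp> h2)) (\<one>\<^bsub>L\<^esub> \<sharp> \<gamma> (p \<otimes>\<^bsub>H\<^esub> h1)) =
        st_pure L' S' (tgt S' m \<otimes>\<^bsub>S'\<^esub> (\<one>\<^bsub>L\<^esub> \<sharp> \<gamma> h2)) (\<one>\<^bsub>L\<^esub> \<sharp> \<gamma> (p \<otimes>\<^bsub>H\<^esub> h1))"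
        by simp
      also have "\<dots> = st_pure L' S' (\<one>\<^bsub>L\<^esub> \<sharp> \<gamma> h2) (src S' m \<otimes>\<^bsub>S'\<^esub> (\<one>\<^bsub>L\<^esub> \<sharp> \<gamma> (p \<otimes>\<^bsub>H\<^esub> h1)))"
        by (rule O.St.st_balanced) simp_all
      also have "src S' m \<otimes>\<^bsub>S'\<^esub> (\<one>\<^bsub>L\<^esub> \<sharp> \<gamma> (p \<otimes>\<^bsub>H\<^esub> h1)) = m \<sharp> \<gamma> (p \<otimes>\<^bsub>H\<^esub> h1)"
        using O.src_mult[of m "\<one>\<^bsub>L\<^esub>" "\<gamma> (p \<otimes>\<^bsub>H\<^esub> h1)"] by simp
      finally show "st_pure L' S' (\<zeta> (m \<sharp> h2)) (\<one>\<^bsub>L\<^esub> \<sharp> \<gamma> (p \<otimes>\<^bsub>H\<^esub> h1)) =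
        st_pure L' S' (\<one>\<^bsub>L\<^esub> \<sharp> \<gamma> h2) (m \<sharp> \<gamma> (p \<otimes>\<^bsub>H\<^esub> h1))" .
    qed
    also have "\<dots> = \<Delta> O.ST h (\<lambda>h1 h2. \<delta> O.ST l (\<lambda>p m.
        st_pure L' S' (\<one>\<^bsub>L\<^esub> \<sharp> \<gamma> h2) (m \<sharp> \<gamma> (p \<otimes>\<^bsub>H\<^esub> h1))))"
      by (rule coact_lift_comul_lift_fubini[OF module_ST']) simp
    \<comment> \<open>The coaction sum of \<open>l\<close> now sits entirely in the second factor
      and folds back into the image of \<open>l \<sharp> h1\<close>. The legs \<open>h2\<close>,
      \<open>h1\<close> stand in the order of the coopposite.\<close>
    also have "\<dots> = \<Delta> O.ST h (\<lambda>h1 h2. st_pure L' S' (\<zeta> (\<one>\<^bsub>L\<^esub> \<sharp> h2)) (\<zeta> (l \<sharp> h1)))"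
      by (intro H.comul_lift_cong, simp add: zeta_one_sharp zeta_pure[of l], rule coact_lift_hom[OF module_S _ module_ST', symmetric])
        (rule lin_intro lin_st' | simp)+
    also have "\<dots> = \<Delta> O.ST h (\<lambda>h1 h2. ?G (st_pure L S (l \<sharp> h1) (\<one>\<^bsub>L\<^esub> \<sharp> h2)))"
      by (intro H.comul_lift_cong) (simp add: G_st)
    also have "\<dots> = ?G (cop B (l \<sharp> h))"
      unfolding cop_pure[OF pure] comul_lift_ST[symmetric] O.comul_lift_ST[unfolded comul_lift_op, symmetric]
      by (rule H.comul_lift_hom_additive_map[OF St.T2.P.T_abelian O.St.T2.P.T_abelian G, symmetric]) simp
    finally show ?case .
  next
    case (add z w)
    then show ?case
      using linD(2)[OF lin_comp[OF cop_lin' zeta_lin], of z w]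
      by (simp add: additive_map_add[OF cop_add_comp[OF G]])
  qed
  then show ?thesis
    by (simp add: cop)
qed

lemma zeta_iso: "\<zeta> \<in> bialgebroid_iso K L' A B'"
  using zeta_bij zeta_cop zeta_cou linD[OF zeta_lin] zeta_mult zeta_one
  by (auto simp: bialgebroid_iso_def bialgebroid_hom_def algebra_hom_def ring_hom_def bimodule_hom_def
    zeta_src zeta_tgt)

end

theorem proposition5p4:
  fixes K :: "'k ring"
    and H :: "('k, 'h) hopf"
    and L :: "('k, 'h, 'l) base_alg"
  assumes "ground_ring K"
    and "hopf_algebra K H"
    and "bij_betw (antipode H) (carrier H) (carrier H)"
    and "base_algebra K H L"
  shows "(\<forall>l\<in>carrier L. \<forall>h\<in>carrier H.
            zeta K H L (kpure K L H l h) =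
            tensor_lift (ktensor K (op_base H L) (op_hopf H))
              (\<lambda>p m. kpure K (op_base H L) (op_hopf H) m
                 (antipode H p \<otimes>\<^bsub>op_hopf H\<^esub> antipode H h))
              (coact L l)) \<and>
         bialgebroid K (op_base H L) (coop L (smash K H L)) \<and>
         bialgebroid K (op_base H L) (smash K (op_hopf H) (op_base H L)) \<and>
         zeta K H L \<in> bialgebroid_iso K (op_base H L)
           (coop L (smash K H L)) (smash K (op_hopf H) (op_base H L))"
proof -
  interpret bij_base K H L
    using assms(2-4) by (simp add: bij_base_def bij_hopf_def bij_hopf_axioms_def)
  show ?thesis
    using zeta_formula coop_bialg bij_base.smash_bialgebroid[OF op_bij_base] zeta_iso by blast
qed

end
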